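(* Let $\tau\ge1$, $\widetilde T=(t_1,\dots,t_\tau)$ and $p\in\{\infty,\omega\}$. If $f=\mathcal I(F)\in\mathcal S^p_T(\Omega_D,A)$, then there exists $g\in\mathcal S^p_T(\Omega_D,A)$ such that \[\overline\partial_{\widetilde T}f=\overline\partial_Tf+(1+t_0-t_1)g,\qquad \partial_{\widetilde T}f=\partial_Tf+(t_1-t_0-1)g\] (so that $\overline\partial_{\widetilde T}f,\partial_{\widetilde T}f\in\mathcal S^p_T(\Omega_D,A)$). For every $K\subseteq\{1,\dots,\tau\}$, the $K$-component of the $T$-stem function $G\in\mathrm{Stem}^p_T(D,A\otimes\mathbb R^{2^\tau})$ inducing $g$ satisfies $G_K(\alpha,\beta)=\beta_1^{-1}F_{\{1\}\cup K}(\alpha,\beta)$ if $1\notin K$ and $G_K(\alpha,\beta)=0$ if $1\in K$, for all $(\alpha,\beta)\in D'=\{(\alpha,\beta_1,\dots,\beta_\tau)\in D:\beta_1\ne0\}$.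
   Context: $A$ is a finite-dimensional associative real algebra with unit and a $*$-involution $x\mapsto x^c$; $\mathbb S_A=\{x:x+x^c=0,xx^c=1\}\ne\emptyset$. $V\subseteq A$ has basis $(v_0=1,v_1,\dots,v_N)$, $N\ge1$, $v_s\in\mathbb S_A$ pairwise anticommuting for $s\ge1$, $V\subseteq\bigcup_{J\in\mathbb S_A}(\mathbb R+J\mathbb R)$; $A$ carries the Euclidean norm making a completion of this basis orthonormal. $\mathbb R_{\ell,m}=\mathrm{Span}_{\mathbb R}(v_\ell,\dots,v_m)$, $\mathbb S_{\ell,m}$ its unit sphere. A list of steps $T=(t_0,\dots,t_\tau)$, $0\le t_0<\dots<t_\tau=N$, with torus $\mathbb T=\mathbb S_{t_0+1,t_1}\times\cdots\times\mathbb S_{t_{\tau-1}+1,t_\tau}$ (for $0$ steps: single index $J=\emptyset$). For $J\in\mathbb T$, $\beta\in\mathbb R^\tau$: $\beta J=\sum\beta_hJ_h$; $J_\emptyset=1$, $J_K=J_{k_1}\cdots J_{k_p}$; $\overline\beta^h$ flips the sign of $\beta_h$; $\sigma(h,K)$ is the parity of $\#\{k\in K:k\le h\}$. $D\subseteq\mathbb R_{0,t_0}\times\mathbb R^\tau$ open, reflection invariant, $\Omega_D=\{\alpha+\beta J\}$ open. $T$-stem functions $F=\sum_KE_KF_K$ ($F_K(\alpha,\overline\beta^h)=F_K$ if $h\notin K$, $-F_K$ if $h\in K$) induce $\mathcal I(F)(\alpha+\beta J)=\sum_KJ_KF_K(\alpha,\beta)$ ($\mathcal I$ injective); $\mathrm{Stem}^p_T,\mathcal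 S^p_T$ their $C^p$ versions. Operators on stems: with $\alpha=\sum_{s\le t_0}x_sv_s$, partial derivatives $\partial_{\alpha_s}$ (in $x_s$) and $\partial_{\beta_h}$, $\overline\partial^u_\alpha=\partial_{\alpha_0}-(-1)^u\sum_{s=1}^{t_0}v_s\partial_{\alpha_s}$; $(\overline\partial_TF)_K=\overline\partial^{|K|+1}_\alpha F_K+\sum_h(-1)^{\sigma(h,K)+1}\partial_{\beta_h}F_{K\triangle\{h\}}$, $(\partial_TF)_K=\overline\partial^{|K|}_\alpha F_K+\sum_h(-1)^{\sigma(h,K)}\partial_{\beta_h}F_{K\triangle\{h\}}$, and on $T$-functions $\overline\partial_T\mathcal I(F)=\mathcal I(\overline\partial_TF)$, $\partial_T\mathcal I(F)=\mathcal I(\partial_TF)$; the same definitions for any list of steps. $\widetilde T$ has mirror $\mathbb R_{0,t_1}$ and $\Omega_D=\Omega_{\widetilde D}$ for $\widetilde T$, with $\widetilde D=\{(\alpha+x^1,\beta_2,\dots,\beta_\tau):x^1\in\mathbb R_{t_0+1,t_1},(\alpha,\|x^1\|,\beta_2,\dots,\beta_\tau)\in D\}$; every element of $\mathcal S^p_T(\Omega_D,A)$, $p\in\{\infty,\omega\}$, is an element of $\mathcal S^p_{\widetilde T}(\Omega_D,A)$, and $\overline\partial_{\widetilde T},\partial_{\widetilde T}$ are applied in that sense. *)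

theory Defs
  imports "HOL-Analysis.Analysis"
begin

(* Points of a domain D are pairs (alpha, beta) with alpha in the mirror R_{0,t0} (a subspace of A)
   and beta : nat => real, supported in {1..tau} (this is R^tau); nat => real carries the product
   topology (HOL-Analysis.Function_Topology), which on the finitely supported subspace is the
   Euclidean topology.  A list of steps T = (t_0,...,t_tau) is a pair (t, tau). *)

definition SA :: "('a::real_algebra_1 \<Rightarrow> 'a) \<Rightarrow> 'a set" where
  "SA c = {x. x + c x = 0 \<and> x * c x = 1}"

definition setting :: "('a::{euclidean_space,real_algebra_1} \<Rightarrow> 'a) \<Rightarrow> (nat \<Rightarrow> 'a) \<Rightarrow> nat \<Rightarrow> bool" where
  "setting c v N \<longleftrightarrow>
     linear c \<and> (\<forall>x. c (c x) = x) \<and> (\<forall>x y. c (x * y) = c y * c x) \<and> c 1 = 1 \<and>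
     SA c \<noteq> {} \<and>
     N \<ge> 1 \<and> v 0 = 1 \<and>
     (\<forall>i\<in>{0..N}. \<forall>j\<in>{0..N}. inner (v i) (v j) = (if i = j then 1 else 0)) \<and>
     (\<forall>s\<in>{1..N}. v s \<in> SA c) \<and>
     (\<forall>s\<in>{1..N}. \<forall>r\<in>{1..N}. s \<noteq> r \<longrightarrow> v s * v r = - (v r * v s)) \<and>
     span (v ` {0..N}) \<subseteq> (\<Union>J\<in>SA c. {a *\<^sub>R 1 + b *\<^sub>R J | a b. True})"

definition Rlm :: "(nat \<Rightarrow> 'a::real_normed_vector) \<Rightarrow> nat \<Rightarrow> nat \<Rightarrow> 'a set" where
  "Rlm v l m = span (v ` {l..m})"

definition Slm :: "(nat \<Rightarrow> 'a::real_normed_vector) \<Rightarrow> nat \<Rightarrow> nat \<Rightarrow> 'a set" where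
  "Slm v l m = {x \<in> Rlm v l m. norm x = 1}"

definition steps :: "nat \<Rightarrow> (nat \<Rightarrow> nat) \<Rightarrow> nat \<Rightarrow> bool" where
  "steps N t \<tau> \<longleftrightarrow> (\<forall>i<\<tau>. t i < t (Suc i)) \<and> t \<tau> = N"

definition torus :: "(nat \<Rightarrow> 'a::real_normed_vector) \<Rightarrow> (nat \<Rightarrow> nat) \<Rightarrow> nat \<Rightarrow> (nat \<Rightarrow> 'a) set" where
  "torus v t \<tau> = {J. \<forall>h\<in>{1..\<tau>}. J h \<in> Slm v (t (h - 1) + 1) (t h)}"

definition bJ :: "nat \<Rightarrow> (nat \<Rightarrow> real) \<Rightarrow> (nat \<Rightarrow> 'a::real_vector) \<Rightarrow> 'a" where
  "bJ \<tau> \<beta> J = (\<Sum>h\<in>{1..\<tau>}. \<beta> h *\<^sub>R J h)"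

definition JK :: "(nat \<Rightarrow> 'a::monoid_mult) \<Rightarrow> nat set \<Rightarrow> 'a" where
  "JK J K = prod_list (map J (sorted_list_of_set K))"

definition Rtau :: "nat \<Rightarrow> (nat \<Rightarrow> real) set" where
  "Rtau \<tau> = {\<beta>. \<forall>i. i \<notin> {1..\<tau>} \<longrightarrow> \<beta> i = 0}"

definition flip :: "nat \<Rightarrow> (nat \<Rightarrow> real) \<Rightarrow> (nat \<Rightarrow> real)" where
  "flip h \<beta> = \<beta>(h := - \<beta> h)"

definition is_domain :: "(nat \<Rightarrow> 'a::real_normed_vector) \<Rightarrow> (nat \<Rightarrow> nat) \<Rightarrow> nat \<Rightarrow> ('a \<times> (nat \<Rightarrow> real)) set \<Rightarrow> bool" where
  "is_domain v t \<tau> D \<longleftrightarrow>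
     D \<subseteq> Rlm v 0 (t 0) \<times> Rtau \<tau> \<and>
     openin (top_of_set (Rlm v 0 (t 0) \<times> Rtau \<tau>)) D \<and>
     (\<forall>\<alpha> \<beta> h. (\<alpha>, \<beta>) \<in> D \<and> h \<in> {1..\<tau>} \<longrightarrow> (\<alpha>, flip h \<beta>) \<in> D)"

definition Omega :: "(nat \<Rightarrow> 'a::real_normed_vector) \<Rightarrow> (nat \<Rightarrow> nat) \<Rightarrow> nat \<Rightarrow> ('a \<times> (nat \<Rightarrow> real)) set \<Rightarrow> 'a set" where
  "Omega v t \<tau> D = {\<alpha> + bJ \<tau> \<beta> J | \<alpha> \<beta> J. (\<alpha>, \<beta>) \<in> D \<and> J \<in> torus v t \<tau>}"

text \<open>T-stem functions: families F K (K subset of {1..tau}) of A-valued functions on D,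
  i.e. F = sum_K E_K F_K with values in A (x) R^(2^tau).\<close>
definition is_stem :: "nat \<Rightarrow> ('a \<times> (nat \<Rightarrow> real)) set \<Rightarrow> (nat set \<Rightarrow> 'a \<times> (nat \<Rightarrow> real) \<Rightarrow> 'a::real_vector) \<Rightarrow> bool" where
  "is_stem \<tau> D F \<longleftrightarrow>
     (\<forall>K \<alpha> \<beta> h. K \<subseteq> {1..\<tau>} \<and> (\<alpha>, \<beta>) \<in> D \<and> h \<in> {1..\<tau>} \<longrightarrow>
        F K (\<alpha>, flip h \<beta>) = (if h \<in> K then - F K (\<alpha>, \<beta>) else F K (\<alpha>, \<beta>)))"

definition ind :: "(nat \<Rightarrow> 'a::{real_normed_vector,real_algebra_1}) \<Rightarrow> (nat \<Rightarrow> nat) \<Rightarrow> nat \<Rightarrow> ('a \<times> (nat \<Rightarrow> real)) set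
    \<Rightarrow> (nat set \<Rightarrow> 'a \<times> (nat \<Rightarrow> real) \<Rightarrow> 'a) \<Rightarrow> 'a \<Rightarrow> 'a" where
  "ind v t \<tau> D F x = (SOME y. \<exists>\<alpha> \<beta> J. (\<alpha>, \<beta>) \<in> D \<and> J \<in> torus v t \<tau> \<and> x = \<alpha> + bJ \<tau> \<beta> J \<and>
        y = (\<Sum>K\<in>Pow {1..\<tau>}. JK J K * F K (\<alpha>, \<beta>)))"

text \<open>Translate (alpha,beta) by the coordinate increment y: y s (s <= t0) along v_s,
  y (t0 + h) (1 <= h <= tau) along beta_h.  There are t0 + 1 + tau real coordinates.\<close>
definition shift :: "(nat \<Rightarrow> 'a::real_vector) \<Rightarrow> nat \<Rightarrow> nat \<Rightarrow> (nat \<Rightarrow> real) \<Rightarrow> 'a \<times> (nat \<Rightarrow> real) \<Rightarrow> 'a \<times> (nat \<Rightarrow> real)" where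
  "shift v t0 \<tau> y p = (fst p + (\<Sum>s\<le>t0. y s *\<^sub>R v s),
                         \<lambda>h. snd p h + (if h \<in> {1..\<tau>} then y (t0 + h) else 0))"

definition ncoord :: "nat \<Rightarrow> nat \<Rightarrow> nat" where
  "ncoord t0 \<tau> = t0 + 1 + \<tau>"

definition pdir :: "(nat \<Rightarrow> 'a::real_normed_vector) \<Rightarrow> nat \<Rightarrow> nat \<Rightarrow> nat \<Rightarrow> ('a \<times> (nat \<Rightarrow> real) \<Rightarrow> 'b::real_normed_vector)
    \<Rightarrow> 'a \<times> (nat \<Rightarrow> real) \<Rightarrow> 'b" where
  "pdir v t0 \<tau> i G p = vector_derivative (\<lambda>r. G (shift v t0 \<tau> (\<lambda>j. if j = i then r else 0) p)) (at 0)"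

fun iterd :: "(nat \<Rightarrow> 'a::real_normed_vector) \<Rightarrow> nat \<Rightarrow> nat \<Rightarrow> nat list \<Rightarrow> ('a \<times> (nat \<Rightarrow> real) \<Rightarrow> 'b::real_normed_vector)
    \<Rightarrow> 'a \<times> (nat \<Rightarrow> real) \<Rightarrow> 'b" where
  "iterd v t0 \<tau> [] G = G"
| "iterd v t0 \<tau> (i # is) G = pdir v t0 \<tau> i (iterd v t0 \<tau> is G)"

definition smooth_on :: "(nat \<Rightarrow> 'a::real_normed_vector) \<Rightarrow> nat \<Rightarrow> nat \<Rightarrow> ('a \<times> (nat \<Rightarrow> real)) set
    \<Rightarrow> ('a \<times> (nat \<Rightarrow> real) \<Rightarrow> 'b::real_normed_vector) \<Rightarrow> bool" where
  "smooth_on v t0 \<tau> D G \<longleftrightarrow>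
     (\<forall>is. set is \<subseteq> {..<ncoord t0 \<tau>} \<longrightarrow>
        continuous_on D (iterd v t0 \<tau> is G) \<and>
        (\<forall>p\<in>D. \<forall>i<ncoord t0 \<tau>.
           (\<lambda>r. iterd v t0 \<tau> is G (shift v t0 \<tau> (\<lambda>j. if j = i then r else 0) p)) differentiable (at 0)))"

definition analytic_on_dom :: "(nat \<Rightarrow> 'a::real_normed_vector) \<Rightarrow> nat \<Rightarrow> nat \<Rightarrow> ('a \<times> (nat \<Rightarrow> real)) set
    \<Rightarrow> ('a \<times> (nat \<Rightarrow> real) \<Rightarrow> 'b::{real_normed_vector,banach}) \<Rightarrow> bool" where
  "analytic_on_dom v t0 \<tau> D G \<longleftrightarrow>
     (\<forall>p\<in>D. \<exists>r>0. \<exists>c :: (nat \<Rightarrow> nat) \<Rightarrow> 'b.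
        \<forall>y. (\<forall>i. i \<ge> ncoord t0 \<tau> \<longrightarrow> y i = 0) \<and> (\<forall>i<ncoord t0 \<tau>. \<bar>y i\<bar> < r) \<longrightarrow>
            shift v t0 \<tau> y p \<in> D \<and>
            ((\<lambda>m. (\<Prod>i<ncoord t0 \<tau>. y i ^ m i) *\<^sub>R c m) has_sum G (shift v t0 \<tau> y p))
               {m. \<forall>i. i \<ge> ncoord t0 \<tau> \<longrightarrow> m i = 0})"

datatype regularity = Cinf | Comega

definition regular :: "regularity \<Rightarrow> (nat \<Rightarrow> 'a::real_normed_vector) \<Rightarrow> nat \<Rightarrow> nat \<Rightarrow> ('a \<times> (nat \<Rightarrow> real)) set
    \<Rightarrow> ('a \<times> (nat \<Rightarrow> real) \<Rightarrow> 'b::{real_normed_vector,banach}) \<Rightarrow> bool" where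
  "regular p v t0 \<tau> D G = (case p of Cinf \<Rightarrow> smooth_on v t0 \<tau> D G | Comega \<Rightarrow> analytic_on_dom v t0 \<tau> D G)"

definition stem_p :: "(nat \<Rightarrow> 'a::{real_normed_vector,banach}) \<Rightarrow> (nat \<Rightarrow> nat) \<Rightarrow> nat \<Rightarrow> ('a \<times> (nat \<Rightarrow> real)) set
    \<Rightarrow> regularity \<Rightarrow> (nat set \<Rightarrow> 'a \<times> (nat \<Rightarrow> real) \<Rightarrow> 'a) \<Rightarrow> bool" where
  "stem_p v t \<tau> D p F \<longleftrightarrow> is_stem \<tau> D F \<and> (\<forall>K. K \<subseteq> {1..\<tau>} \<longrightarrow> regular p v (t 0) \<tau> D (F K))"

definition sigma :: "nat \<Rightarrow> nat set \<Rightarrow> nat" where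
  "sigma h K = card {k\<in>K. k \<le> h}"

definition symd :: "nat set \<Rightarrow> nat \<Rightarrow> nat set" where
  "symd K h = (if h \<in> K then K - {h} else insert h K)"

definition dbar_alpha :: "(nat \<Rightarrow> 'a::{real_normed_vector,real_algebra_1}) \<Rightarrow> nat \<Rightarrow> nat \<Rightarrow> nat
    \<Rightarrow> ('a \<times> (nat \<Rightarrow> real) \<Rightarrow> 'a) \<Rightarrow> 'a \<times> (nat \<Rightarrow> real) \<Rightarrow> 'a" where
  "dbar_alpha v t0 \<tau> u G p = pdir v t0 \<tau> 0 G p - ((-1::real) ^ u) *\<^sub>R (\<Sum>s\<in>{1..t0}. v s * pdir v t0 \<tau> s G p)"

definition dbarT :: "(nat \<Rightarrow> 'a::{real_normed_vector,real_algebra_1}) \<Rightarrow> (nat \<Rightarrow> nat) \<Rightarrow> nat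
    \<Rightarrow> (nat set \<Rightarrow> 'a \<times> (nat \<Rightarrow> real) \<Rightarrow> 'a) \<Rightarrow> nat set \<Rightarrow> 'a \<times> (nat \<Rightarrow> real) \<Rightarrow> 'a" where
  "dbarT v t \<tau> F K p = dbar_alpha v (t 0) \<tau> (card K + 1) (F K) p
     + (\<Sum>h\<in>{1..\<tau>}. ((-1::real) ^ (sigma h K + 1)) *\<^sub>R pdir v (t 0) \<tau> (t 0 + h) (F (symd K h)) p)"

definition dT :: "(nat \<Rightarrow> 'a::{real_normed_vector,real_algebra_1}) \<Rightarrow> (nat \<Rightarrow> nat) \<Rightarrow> nat
    \<Rightarrow> (nat set \<Rightarrow> 'a \<times> (nat \<Rightarrow> real) \<Rightarrow> 'a) \<Rightarrow> nat set \<Rightarrow> 'a \<times> (nat \<Rightarrow> real) \<Rightarrow> 'a" where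
  "dT v t \<tau> F K p = dbar_alpha v (t 0) \<tau> (card K) (F K) p
     + (\<Sum>h\<in>{1..\<tau>}. ((-1::real) ^ (sigma h K)) *\<^sub>R pdir v (t 0) \<tau> (t 0 + h) (F (symd K h)) p)"

definition tstep :: "(nat \<Rightarrow> nat) \<Rightarrow> nat \<Rightarrow> nat" where
  "tstep t i = t (Suc i)"

definition Dtil :: "(nat \<Rightarrow> 'a::real_normed_vector) \<Rightarrow> (nat \<Rightarrow> nat) \<Rightarrow> nat \<Rightarrow> ('a \<times> (nat \<Rightarrow> real)) set
    \<Rightarrow> ('a \<times> (nat \<Rightarrow> real)) set" where
  "Dtil v t \<tau> D = {(\<alpha> + x, \<lambda>i. if i \<in> {1..\<tau> - 1} then \<beta> (Suc i) else 0) | \<alpha> x \<beta>.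
      x \<in> Rlm v (t 0 + 1) (t 1) \<and> (\<alpha>, \<beta>(1 := norm x)) \<in> D}"

end

theory Submission
  imports Defs
begin

text \<open>
  Write \<open>x\<close> for the component of a point in the span of \<open>v\<^bsub>t 0 + 1\<^esub>, \<dots>, v\<^bsub>t 1\<^esub>\<close> and \<open>H'\<close> for
  \<open>Suc ` H\<close>. The oddness of \<open>F\<^bsub>{1} \<union> K\<^esub>\<close> in \<open>\<beta>\<^sub>1\<close> makes \<open>G\<^sub>K = F\<^bsub>{1} \<union> K\<^esub> / \<beta>\<^sub>1\<close> regular
  across \<open>\<beta>\<^sub>1 = 0\<close>: in the smooth case it is the integral mean of \<open>\<partial>\<^bsub>\<beta>\<^sub>1\<^esub> F\<^bsub>{1} \<union> K\<^esub>\<close>, in the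
  analytic case one divides the power series. As \<open>J\<^sub>1\<close> anticommutes with the other units, the stem
  function of \<open>f\<close> for the shortened list of steps is
  \<open>Ft\<^sub>H(\<alpha> + x, \<beta>') = F\<^bsub>H'\<^esub>(\<alpha>, \<parallel>x\<parallel>, \<beta>') + (-1)\<^bsup>|H|\<^esup> x G\<^bsub>H'\<^esub>(\<alpha>, \<parallel>x\<parallel>, \<beta>')\<close>.
  Applying \<open>\<Sum>\<^sub>s v\<^sub>s \<partial>\<^sub>s\<close> over the directions of \<open>x\<close> to \<open>x G\<^bsub>H'\<^esub>\<close> gives \<open>- (t 1 - t 0) G\<^bsub>H'\<^esub>\<close> from the
  first factor and \<open>- \<beta>\<^sub>1 \<partial>\<^bsub>\<beta>\<^sub>1\<^esub> G\<^bsub>H'\<^esub>\<close> from the second, while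
  \<open>\<partial>\<^bsub>\<beta>\<^sub>1\<^esub> F\<^bsub>{1} \<union> H'\<^esub> = G\<^bsub>H'\<^esub> + \<beta>\<^sub>1 \<partial>\<^bsub>\<beta>\<^sub>1\<^esub> G\<^bsub>H'\<^esub>\<close>; the difference is the correction term.
\<close>

section \<open>Coordinate shifts and smoothness\<close>

text \<open>Three obstacles shape the proof. \<open>smooth_on\<close> speaks of all iterated partial
  derivatives, and no closed formula for those of a quotient is ever computed: it suffices to
  exhibit a class of continuous functions that contains the quotient and is closed under partial
  derivatives. Next, \<open>f\<close> determines only the sums of the terms J_H Ft_H, so the
  components have to be separated before anything can be differentiated; replacing units by their
  negatives multiplies J_H by a character of the group of sign changes, and distinct characters are
  independent. For the operator applied to \<open>Ft\<close>, independence of the chosen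
  representation is not established; the identity is evaluated at whichever representation the
  choice in \<open>ind\<close> selects, and \<open>Dtil\<close> makes that one of the form \<beta>_1
  = norm x, hence nonnegative. Finally, norm x is not differentiable at x = 0. The components F_H'
  and G_H' are even in \<beta>_1, because 1 is not in H', so their \<beta>_1-derivatives vanish
  there and the chain rule survives.\<close>

abbreviation cshift :: "(nat \<Rightarrow> 'a::real_vector) \<Rightarrow> nat \<Rightarrow> nat \<Rightarrow> nat \<Rightarrow> real
    \<Rightarrow> 'a \<times> (nat \<Rightarrow> real) \<Rightarrow> 'a \<times> (nat \<Rightarrow> real)" where
  "cshift v t0 \<tau> i r p \<equiv> shift v t0 \<tau> (\<lambda>j. if j = i then r else 0) p"

lemma cshift_alpha:
  assumes "i \<le> t0"
  shows "cshift v t0 \<tau> i r p = (fst p + r *\<^sub>R v i, snd p)"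
proof -
  have "(\<Sum>s\<le>t0. (if s = i then r else 0) *\<^sub>R v s) = (\<Sum>s\<le>t0. if s = i then r *\<^sub>R v s else 0)"
    by (rule sum.cong) auto
  also have "\<dots> = r *\<^sub>R v i" using assms by simp
  finally show ?thesis
    using assms by (auto simp: shift_def)
qed

lemma cshift_beta:
  assumes "h \<in> {1..\<tau>}"
  shows "cshift v t0 \<tau> (t0 + h) r p = (fst p, (snd p)(h := snd p h + r))"
proof -
  have "(\<Sum>s\<le>t0. (if s = t0 + h then r else 0) *\<^sub>R v s) = 0"
    by (rule sum.neutral) (use assms in auto)
  then show ?thesis
    using assms by (auto simp: shift_def fun_eq_iff)
qed

lemma coord_cases:
  assumes "i < ncoord t0 \<tau>"
  obtains (alpha) "i \<le> t0" | (beta) h where "h \<in> {1..\<tau>}" "i = t0 + h"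
proof (cases "i \<le> t0")
  case False
  then show thesis
    using assms by (intro beta[of "i - t0"]) (auto simp: ncoord_def)
qed (rule alpha)

lemma shift_0 [simp]: "shift v t0 \<tau> (\<lambda>j. 0) p = p"
  by (simp add: shift_def)

lemma cshift_add:
  assumes "i < ncoord t0 \<tau>"
  shows "cshift v t0 \<tau> i r (cshift v t0 \<tau> i s p) = cshift v t0 \<tau> i (s + r) p"
  using assms
  by (cases rule: coord_cases) (simp_all add: cshift_alpha cshift_beta scaleR_add_left add.assoc)

lemma cshift_carrier:
  assumes "p \<in> Rlm v 0 t0 \<times> Rtau \<tau>" "i < ncoord t0 \<tau>"
  shows "cshift v t0 \<tau> i r p \<in> Rlm v 0 t0 \<times> Rtau \<tau>"
  using assms(2)
proof (cases rule: coord_cases)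
  case alpha
  then have "v i \<in> Rlm v 0 t0" unfolding Rlm_def by (intro span_base) auto
  with assms(1) alpha show ?thesis
    by (auto simp: cshift_alpha Rlm_def intro!: span_add span_scale)
next
  case (beta h)
  with assms(1) show ?thesis by (auto simp: cshift_beta Rtau_def)
qed

lemma continuous_on_fun_upd [continuous_intros]:
  fixes b :: "'c::topological_space \<Rightarrow> nat \<Rightarrow> real"
  assumes "continuous_on S b" "continuous_on S x"
  shows "continuous_on S (\<lambda>z. (b z)(h := x z))"
proof (rule continuous_on_coordinatewise_then_product)
  fix i
  show "continuous_on S (\<lambda>z. ((b z)(h := x z)) i)"
    using assms continuous_on_product_then_coordinatewise[OF assms(1), of i] by (cases "i = h") auto
qed

lemma continuous_on_cshift [continuous_intros]:
  fixes v :: "nat \<Rightarrow> 'a::real_normed_vector" and P :: "'c::topological_space \<Rightarrow> _"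
  assumes "i < ncoord t0 \<tau>" "continuous_on S r" "continuous_on S P"
  shows "continuous_on S (\<lambda>z. cshift v t0 \<tau> i (r z) (P z))"
  using assms(1)
proof (cases rule: coord_cases)
  case alpha
  then show ?thesis using assms by (simp add: cshift_alpha continuous_intros)
next
  case (beta h)
  have "continuous_on S (\<lambda>z. snd (P z))" using assms(3) by (rule continuous_on_snd)
  note * = continuous_on_product_then_coordinatewise[OF this, of h]
  then show ?thesis using assms beta by (simp add: cshift_beta continuous_intros)
qed

text \<open>Openness along coordinate lines only. This is what a partial derivative sees, so
  functions that agree on such a set have the same partial derivatives there.\<close>

definition line_open :: "(nat \<Rightarrow> 'a::real_vector) \<Rightarrow> nat \<Rightarrow> nat \<Rightarrow> ('a \<times> (nat \<Rightarrow> real)) set \<Rightarrow> bool" where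
  "line_open v t0 \<tau> D \<longleftrightarrow> (\<forall>p\<in>D. \<forall>i<ncoord t0 \<tau>. \<forall>\<^sub>F r in nhds 0. cshift v t0 \<tau> i r p \<in> D)"

lemma openin_line_open:
  assumes "openin (top_of_set (Rlm v 0 t0 \<times> Rtau \<tau>)) D"
  shows "line_open v t0 \<tau> D"
  unfolding line_open_def
proof (intro ballI allI impI)
  fix p i assume p: "p \<in> D" and i: "i < ncoord t0 \<tau>"
  from assms obtain W where W: "open W" "D = (Rlm v 0 t0 \<times> Rtau \<tau>) \<inter> W"
    by (auto simp: openin_open)
  have "continuous_on UNIV (\<lambda>r. cshift v t0 \<tau> i r p)"
    using i by (intro continuous_intros)
  then have "open ((\<lambda>r. cshift v t0 \<tau> i r p) -` W)"
    using W(1) by (simp add: continuous_on_open_vimage)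
  then have "\<forall>\<^sub>F r in nhds 0. r \<in> (\<lambda>r. cshift v t0 \<tau> i r p) -` W"
    by (rule eventually_nhds_in_open) (use W p in auto)
  then show "\<forall>\<^sub>F r in nhds 0. cshift v t0 \<tau> i r p \<in> D"
    by (rule eventually_mono) (use W cshift_carrier[OF _ i, of p v] p in auto)
qed

lemma has_pdir_transform:
  assumes "line_open v t0 \<tau> D" "p \<in> D" "i < ncoord t0 \<tau>" "\<And>q. q \<in> D \<Longrightarrow> G q = H q"
  shows "((\<lambda>r. G (cshift v t0 \<tau> i r p)) has_vector_derivative d) (at 0) \<longleftrightarrow>
         ((\<lambda>r. H (cshift v t0 \<tau> i r p)) has_vector_derivative d) (at 0)"
proof (rule has_vector_derivative_cong_ev)
  show "\<forall>\<^sub>F r in nhds 0. r \<in> UNIV \<longrightarrow> G (cshift v t0 \<tau> i r p) = H (cshift v t0 \<tau> i r p)"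
  proof -
    have "\<forall>\<^sub>F r in nhds 0. cshift v t0 \<tau> i r p \<in> D"
      using assms(1-3) unfolding line_open_def by blast
    then show ?thesis by (rule eventually_mono) (simp add: assms(4))
  qed
qed (use assms in simp)

lemma pdir_eqI:
  assumes "((\<lambda>r. G (cshift v t0 \<tau> i r p)) has_vector_derivative d) (at 0)"
  shows "pdir v t0 \<tau> i G p = d"
  unfolding pdir_def using assms by (rule vector_derivative_at)

text \<open>Shifts along one coordinate form a one-parameter group, so a derivative at parameter
  \<open>s\<close> is one at parameter 0 from a moved base point. Integration arguments need
  derivatives along a whole segment, while \<open>pdir\<close> looks at 0 only.\<close>

lemma has_pdir_at:
  assumes "((\<lambda>r. G (cshift v t0 \<tau> i r (cshift v t0 \<tau> i s p))) has_vector_derivative d) (at 0)"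
    and "i < ncoord t0 \<tau>"
  shows "((\<lambda>r. G (cshift v t0 \<tau> i r p)) has_vector_derivative d) (at s)"
proof -
  have "((\<lambda>r. r - s) has_vector_derivative 1) (at s)"
    by (auto intro!: derivative_eq_intros)
  moreover have "((\<lambda>r. G (cshift v t0 \<tau> i (s + r) p)) has_vector_derivative d) (at (s - s))"
    using assms by (simp add: cshift_add)
  ultimately have "((\<lambda>r. G (cshift v t0 \<tau> i (s + r) p)) \<circ> (\<lambda>r. r - s) has_vector_derivative 1 *\<^sub>R d) (at s)"
    by (rule vector_diff_chain_at)
  then show ?thesis by (simp add: o_def add_diff_eq cong: if_cong)
qed

lemma smooth_on_has_pdir:
  assumes "smooth_on v t0 \<tau> D G" "set is \<subseteq> {..<ncoord t0 \<tau>}" "p \<in> D" "i < ncoord t0 \<tau>"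
  shows "((\<lambda>r. iterd v t0 \<tau> is G (cshift v t0 \<tau> i r p)) has_vector_derivative
           iterd v t0 \<tau> (i # is) G p) (at 0)"
  using assms unfolding smooth_on_def
  by (auto simp: pdir_def vector_derivative_works)

lemma smooth_on_continuous:
  assumes "smooth_on v t0 \<tau> D G" "set is \<subseteq> {..<ncoord t0 \<tau>}"
  shows "continuous_on D (iterd v t0 \<tau> is G)"
  using assms unfolding smooth_on_def by auto

lemma smooth_on_subset: "smooth_on v t0 \<tau> D G \<Longrightarrow> U \<subseteq> D \<Longrightarrow> smooth_on v t0 \<tau> U G"
  unfolding smooth_on_def by (meson continuous_on_subset subsetD)

text \<open>By induction on the list of directions, every iterated derivative of \<open>G\<close>
  coincides on \<open>D\<close> with a member of \<open>C\<close>. Coincidence on \<open>D\<close>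
  is preserved by differentiation because \<open>D\<close> is open along lines.\<close>

lemma smooth_on_coinduct:
  assumes D: "line_open v t0 \<tau> D" and "C G0" and "\<And>p. p \<in> D \<Longrightarrow> G p = G0 p"
    and cont: "\<And>H. C H \<Longrightarrow> continuous_on D H"
    and step: "\<And>H i. C H \<Longrightarrow> i < ncoord t0 \<tau> \<Longrightarrow>
      \<exists>H'. C H' \<and> (\<forall>p\<in>D. ((\<lambda>r. H (cshift v t0 \<tau> i r p)) has_vector_derivative H' p) (at 0))"
  shows "smooth_on v t0 \<tau> D G"
proof -
  have *: "\<exists>H. C H \<and> (\<forall>p\<in>D. iterd v t0 \<tau> is G p = H p)" if "set is \<subseteq> {..<ncoord t0 \<tau>}" for "is"
    using that
  proof (induction "is")
    case Nil
    then show ?case using assms by auto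
  next
    case (Cons i "is")
    then obtain H where H: "C H" "\<forall>p\<in>D. iterd v t0 \<tau> is G p = H p" by auto
    from Cons have i: "i < ncoord t0 \<tau>" by auto
    from step[OF H(1) i] obtain H' where H': "C H'"
      "\<forall>p\<in>D. ((\<lambda>r. H (cshift v t0 \<tau> i r p)) has_vector_derivative H' p) (at 0)" by blast
    have "iterd v t0 \<tau> (i # is) G p = H' p" if "p \<in> D" for p
      using H'(2) that has_pdir_transform[OF D that i, of "iterd v t0 \<tau> is G" H] H(2)
      by (auto intro: pdir_eqI)
    with H'(1) show ?case by blast
  qed
  show ?thesis
    unfolding smooth_on_def
  proof (intro allI impI conjI ballI)
    fix "is" assume "set is \<subseteq> {..<ncoord t0 \<tau>}"
    from *[OF this] obtain H where H: "C H" "\<forall>p\<in>D. iterd v t0 \<tau> is G p = H p" by blast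
    show "continuous_on D (iterd v t0 \<tau> is G)"
      using cont[OF H(1)] H(2) by (simp cong: continuous_on_cong)
    fix p i assume p: "p \<in> D" and i: "i < ncoord t0 \<tau>"
    from step[OF H(1) i] p obtain d where
      "((\<lambda>r. H (cshift v t0 \<tau> i r p)) has_vector_derivative d) (at 0)" by blast
    then have "((\<lambda>r. iterd v t0 \<tau> is G (cshift v t0 \<tau> i r p)) has_vector_derivative d) (at 0)"
      using has_pdir_transform[OF D p i, of "iterd v t0 \<tau> is G" H] H(2) by auto
    then show "(\<lambda>r. iterd v t0 \<tau> is G (cshift v t0 \<tau> i r p)) differentiable at 0"
      by (auto simp: has_vector_derivative_def differentiable_def)
  qed
qed

text \<open>Lets two unrelated formulas for the quotient, one around \<open>snd p 1 = 0\<close> and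
  one away from it, be used on different relatively open pieces.\<close>

lemma smooth_on_local:
  assumes "\<And>p. p \<in> D \<Longrightarrow> \<exists>U. p \<in> U \<and> openin (top_of_set D) U \<and> smooth_on v t0 \<tau> U G"
  shows "smooth_on v t0 \<tau> D G"
  unfolding smooth_on_def
proof (intro allI impI conjI ballI)
  fix "is" assume is_: "set is \<subseteq> {..<ncoord t0 \<tau>}"
  show "continuous_on D (iterd v t0 \<tau> is G)"
    unfolding continuous_on_def
  proof
    fix p assume p: "p \<in> D"
    from assms[OF p] obtain U where U: "p \<in> U" "openin (top_of_set D) U" "smooth_on v t0 \<tau> U G"
      by blast
    from U(2) obtain W where W: "open W" "U = D \<inter> W" by (auto simp: openin_open)
    have "at p within U = at p within D"
      using W U(1) by (intro at_within_nhd[of p W]) auto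
    moreover have "(iterd v t0 \<tau> is G \<longlongrightarrow> iterd v t0 \<tau> is G p) (at p within U)"
      using smooth_on_continuous[OF U(3) is_] U(1) by (auto simp: continuous_on_def)
    ultimately show "(iterd v t0 \<tau> is G \<longlongrightarrow> iterd v t0 \<tau> is G p) (at p within D)" by simp
  qed
next
  fix "is" p i assume "set is \<subseteq> {..<ncoord t0 \<tau>}" "p \<in> D" "i < ncoord t0 \<tau>"
  with assms[of p] show "(\<lambda>r. iterd v t0 \<tau> is G (cshift v t0 \<tau> i r p)) differentiable at 0"
    unfolding smooth_on_def by blast
qed

section \<open>Dividing a smooth function by a coordinate\<close>

locale frame =
  fixes v :: "nat \<Rightarrow> 'a::{euclidean_space,real_algebra_1}" and N :: nat
  assumes orthonormal: "i \<le> N \<Longrightarrow> j \<le> N \<Longrightarrow> inner (v i) (v j) = (if i = j then 1 else 0)"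
    and square: "1 \<le> s \<Longrightarrow> s \<le> N \<Longrightarrow> v s * v s = - 1"
    and anticommute: "1 \<le> s \<Longrightarrow> s \<le> N \<Longrightarrow> 1 \<le> r \<Longrightarrow> r \<le> N \<Longrightarrow> s \<noteq> r \<Longrightarrow> v s * v r = - (v r * v s)"
begin

text \<open>The left side is the orthogonal projection onto the span: its fixed points form a
  subspace, and by orthonormality it fixes every basis vector.\<close>

lemma Rlm_expansion:
  assumes "a \<in> Rlm v l m" "m \<le> N"
  shows "(\<Sum>s\<in>{l..m}. inner (v s) a *\<^sub>R v s) = a"
  using assms(1) unfolding Rlm_def
proof (induction rule: span_induct)
  case base
  define L where "L = (\<lambda>a. \<Sum>s\<in>{l..m}. inner (v s) a *\<^sub>R v s)"
  have "linear L"
    unfolding L_def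
    by (intro linearI) (simp_all add: inner_add_right scaleR_add_left sum.distrib scaleR_sum_right)
  then have "L 0 = 0" "L (a + b) = L a + L b" "L (k *\<^sub>R a) = k *\<^sub>R L a" for a b k
    by (simp_all add: linear_0 linear_add linear_cmul)
  then have "subspace {a. L a = a}"
    by (simp add: subspace_def)
  then show ?case unfolding L_def .
next
  case (step x)
  then obtain i where i: "i \<in> {l..m}" "x = v i" by auto
  have "(\<Sum>s\<in>{l..m}. inner (v s) x *\<^sub>R v s) = (\<Sum>s\<in>{l..m}. if s = i then v s else 0)"
    using i assms(2) by (intro sum.cong) (auto simp: orthonormal)
  then show ?case using i by simp
qed

end

text \<open>Neighbourhoods in coordinate form rather than balls: a box whose centre has \<beta>_1 =
  0 is stable under shrinking \<beta>_1 towards 0.\<close>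

definition coord_box :: "(nat \<Rightarrow> 'a::real_inner) \<Rightarrow> nat \<Rightarrow> nat \<Rightarrow> real \<Rightarrow> 'a \<times> (nat \<Rightarrow> real)
    \<Rightarrow> ('a \<times> (nat \<Rightarrow> real)) set" where
  "coord_box v t0 \<tau> r p = {q \<in> Rlm v 0 t0 \<times> Rtau \<tau>.
     (\<forall>s\<le>t0. \<bar>inner (v s) (fst q - fst p)\<bar> < r) \<and> (\<forall>h\<in>{1..\<tau>}. \<bar>snd q h - snd p h\<bar> < r)}"

lemma openin_coord_box: "openin (top_of_set (Rlm v 0 t0 \<times> Rtau \<tau>)) (coord_box v t0 \<tau> r p)"
proof -
  let ?W = "(\<Inter>s\<in>{..t0}. {q. \<bar>inner (v s) (fst q - fst p)\<bar> < r}) \<inter>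
            (\<Inter>h\<in>{1..\<tau>}. {q. \<bar>snd q h - snd p h\<bar> < r})"
  have "continuous_on UNIV (\<lambda>q::'a \<times> (nat \<Rightarrow> real). snd q h)" for h
    by (rule continuous_on_product_then_coordinatewise) (intro continuous_intros)
  then have "open ?W"
    by (intro open_Int open_INT ballI open_Collect_less continuous_intros) auto
  moreover have "coord_box v t0 \<tau> r p = (Rlm v 0 t0 \<times> Rtau \<tau>) \<inter> ?W"
    unfolding coord_box_def by auto
  ultimately show ?thesis by (auto simp: openin_open)
qed

text \<open>Pulling \<open>D\<close> back to increments \<open>y\<close> gives an open set of the
  product topology, hence a radius for each coordinate. Increments between points of the carrier
  vanish from \<open>ncoord t0 \<tau>\<close> on, so the minimum of finitely many radii is
  enough.\<close>

lemma (in frame) openin_contains_coord_box: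
  assumes "openin (top_of_set (Rlm v 0 t0 \<times> Rtau \<tau>)) D" "p \<in> D" "t0 \<le> N"
  obtains r where "r > 0" "coord_box v t0 \<tau> r p \<subseteq> D"
proof -
  from assms obtain W where W: "open W" "D = (Rlm v 0 t0 \<times> Rtau \<tau>) \<inter> W"
    by (auto simp: openin_open)
  have coord: "continuous_on UNIV (\<lambda>y::nat \<Rightarrow> real. y i)" for i by simp
  have "continuous_on UNIV (\<lambda>y h. snd p h + (if h \<in> {1..\<tau>} then y (t0 + h) else (0::real)))"
  proof (rule continuous_on_coordinatewise_then_product)
    fix h
    show "continuous_on UNIV (\<lambda>y. snd p h + (if h \<in> {1..\<tau>} then y (t0 + h) else (0::real)))"
      by (cases "h \<in> {1..\<tau>}") (auto intro!: continuous_intros)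
  qed
  then have "continuous_on UNIV (\<lambda>y. shift v t0 \<tau> y p)"
    unfolding shift_def by (intro continuous_on_Pair) (intro continuous_intros coord)
  then have "open ((\<lambda>y. shift v t0 \<tau> y p) -` W)"
    using W(1) by (simp add: continuous_on_open_vimage)
  then have "openin (product_topology (\<lambda>i. euclidean) UNIV) ((\<lambda>y. shift v t0 \<tau> y p) -` W)"
    by (simp add: open_fun_def)
  moreover have "(\<lambda>_. 0) \<in> (\<lambda>y. shift v t0 \<tau> y p) -` W" using W assms(2) by simp
  ultimately obtain X where X: "(\<lambda>_. 0) \<in> (\<Pi>\<^sub>E i\<in>UNIV. X i)" "\<And>i. open (X i)"
      "(\<Pi>\<^sub>E i\<in>UNIV. X i) \<subseteq> (\<lambda>y. shift v t0 \<tau> y p) -` W"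
    using product_topology_open_contains_basis[of "\<lambda>i. euclidean" UNIV] by (metis open_openin)
  have "\<exists>e>0. ball 0 e \<subseteq> X i" for i
    using X(1) X(2)[of i] open_contains_ball by (auto simp: PiE_iff)
  then obtain e where e: "\<And>i. e i > 0" "\<And>i. ball 0 (e i) \<subseteq> X i" by metis
  define r where "r = Min (e ` {..<ncoord t0 \<tau>})"
  have n: "e ` {..<ncoord t0 \<tau>} \<noteq> {}" by (auto simp: ncoord_def lessThan_empty_iff)
  have r: "r > 0" "\<And>i. i < ncoord t0 \<tau> \<Longrightarrow> r \<le> e i"
    unfolding r_def using e(1) n by auto
  have "q \<in> D" if q: "q \<in> coord_box v t0 \<tau> r p" for q
  proof -
    define y where "y = (\<lambda>i. if i \<le> t0 then inner (v i) (fst q - fst p)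
        else if i < ncoord t0 \<tau> then snd q (i - t0) - snd p (i - t0) else 0)"
    have y: "\<bar>y i\<bar> < r" if "i < ncoord t0 \<tau>" for i
      using that
    proof (cases rule: coord_cases)
      case alpha
      with q show ?thesis by (auto simp: y_def coord_box_def)
    next
      case (beta h)
      with q that have "y i = snd q h - snd p h" "\<bar>snd q h - snd p h\<bar> < r"
        by (auto simp: y_def coord_box_def)
      then show ?thesis by simp
    qed
    have "y i \<in> X i" for i
    proof (cases "i < ncoord t0 \<tau>")
      case True
      then have "y i \<in> ball 0 (e i)" using y[OF True] r(2)[OF True] by simp
      then show ?thesis using e(2) by blast
    next
      case False
      then have "y i = 0" by (auto simp: y_def ncoord_def)
      then show ?thesis using X(1) by (auto simp: PiE_iff)
    qed
    then have "shift v t0 \<tau> y p \<in> W" using X(3) by (auto simp: PiE_iff)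
    moreover have "shift v t0 \<tau> y p = q"
    proof (rule prod_eqI)
      have "fst q - fst p \<in> Rlm v 0 t0"
        using q W(2) assms(2) unfolding Rlm_def coord_box_def by (auto intro: span_diff)
      from Rlm_expansion[OF this assms(3)]
      have "fst q - fst p = (\<Sum>s\<le>t0. y s *\<^sub>R v s)"
        by (simp add: y_def atMost_atLeast0 cong: sum.cong_simp)
      then show "fst (shift v t0 \<tau> y p) = fst q" by (simp add: shift_def flip: \<open>_ = (\<Sum>s\<le>t0. y s *\<^sub>R v s)\<close>)
      show "snd (shift v t0 \<tau> y p) = snd q"
        using q W(2) assms(2)
        by (auto simp: shift_def y_def fun_eq_iff coord_box_def ncoord_def Rtau_def split: if_splits)
    qed
    ultimately show "q \<in> D" using q W(2) by (auto simp: coord_box_def)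
  qed
  with r(1) show thesis by (intro that) auto
qed

text \<open>If \<open>Q\<close> vanishes where \<beta>_1 = 0, the second branch is the limit of the
  first, so this is the quotient extended across the hyperplane.\<close>

definition bquot :: "(nat \<Rightarrow> 'a::real_normed_vector) \<Rightarrow> nat \<Rightarrow> nat \<Rightarrow> ('a \<times> (nat \<Rightarrow> real) \<Rightarrow> 'b::real_normed_vector)
    \<Rightarrow> 'a \<times> (nat \<Rightarrow> real) \<Rightarrow> 'b" where
  "bquot v t0 \<tau> Q p =
     (if snd p 1 \<noteq> 0 then inverse (snd p 1) *\<^sub>R Q p else pdir v t0 \<tau> (t0 + 1) Q p)"

text \<open>The linear span of the functions \<beta>_1^(-k) R with R an iterated derivative of
  \<open>Q\<close>. It is closed under partial derivatives: in direction \<beta>_1 one gets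
  \<beta>_1^(-k) R' - k \<beta>_1^(-k-1) R, in the others only the first term.\<close>

inductive quot_class :: "(nat \<Rightarrow> 'a::real_normed_vector) \<Rightarrow> nat \<Rightarrow> nat
    \<Rightarrow> ('a \<times> (nat \<Rightarrow> real) \<Rightarrow> 'b::real_normed_vector) \<Rightarrow> ('a \<times> (nat \<Rightarrow> real) \<Rightarrow> 'b) \<Rightarrow> bool"
  for v t0 \<tau> Q where
  base: "set is \<subseteq> {..<ncoord t0 \<tau>} \<Longrightarrow>
    quot_class v t0 \<tau> Q (\<lambda>p. inverse (snd p 1) ^ k *\<^sub>R iterd v t0 \<tau> is Q p)"
| add: "quot_class v t0 \<tau> Q A \<Longrightarrow> quot_class v t0 \<tau> Q B \<Longrightarrow> quot_class v t0 \<tau> Q (\<lambda>p. A p + B p)"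
| scale: "quot_class v t0 \<tau> Q A \<Longrightarrow> quot_class v t0 \<tau> Q (\<lambda>p. a *\<^sub>R A p)"

lemma smooth_on_bquot_nonzero:
  assumes D: "line_open v t0 \<tau> D" and Q: "smooth_on v t0 \<tau> D Q" and nz: "\<And>p. p \<in> D \<Longrightarrow> snd p 1 \<noteq> 0"
    and "\<tau> \<ge> 1"
  shows "smooth_on v t0 \<tau> D (bquot v t0 \<tau> Q)"
proof (rule smooth_on_coinduct[OF D, where C = "quot_class v t0 \<tau> Q"])
  show "quot_class v t0 \<tau> Q (\<lambda>p. inverse (snd p 1) ^ 1 *\<^sub>R iterd v t0 \<tau> [] Q p)"
    by (rule quot_class.base) simp
next
  fix H assume "quot_class v t0 \<tau> Q H"
  then show "continuous_on D H"
  proof induction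
    case (base "is" k)
    have "continuous_on D (\<lambda>q. snd q 1)"
      by (rule continuous_on_product_then_coordinatewise) (intro continuous_intros)
    then show ?case using base smooth_on_continuous[OF Q] nz by (intro continuous_intros) auto
  qed (auto intro!: continuous_intros)
next
  fix H i assume "quot_class v t0 \<tau> Q H" and i: "i < ncoord t0 \<tau>"
  then show "\<exists>H'. quot_class v t0 \<tau> Q H' \<and>
    (\<forall>p\<in>D. ((\<lambda>r. H (cshift v t0 \<tau> i r p)) has_vector_derivative H' p) (at 0))"
  proof induction
    case (base "is" k)
    let ?R = "iterd v t0 \<tau> is Q" and ?R' = "iterd v t0 \<tau> (i # is) Q"
    have R: "((\<lambda>r. ?R (cshift v t0 \<tau> i r p)) has_vector_derivative ?R' p) (at 0)" if "p \<in> D" for p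
      using smooth_on_has_pdir[OF Q base(1) that i] .
    have is': "set (i # is) \<subseteq> {..<ncoord t0 \<tau>}" using base i by auto
    show ?case
    proof (cases "i = t0 + 1")
      case False
      have "snd (cshift v t0 \<tau> i r p) 1 = snd p 1" for r p
        using i False by (cases rule: coord_cases) (auto simp: cshift_alpha cshift_beta)
      then show ?thesis
        using R by (intro exI[of _ "\<lambda>p. inverse (snd p 1) ^ k *\<^sub>R ?R' p"] conjI
            quot_class.base[OF is']) (auto intro!: derivative_eq_intros)
    next
      case True
      have s: "snd (cshift v t0 \<tau> i r p) 1 = snd p 1 + r" for r p
        unfolding True using assms(4) by (subst cshift_beta) auto
      show ?thesis
      proof (intro exI[of _ "\<lambda>p. inverse (snd p 1) ^ k *\<^sub>R ?R' p +
            (- real k) *\<^sub>R (inverse (snd p 1) ^ (k + 1) *\<^sub>R ?R p)"] conjI quot_class.intros ballI is' base)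
        fix p assume p: "p \<in> D"
        have "((\<lambda>r. inverse (snd p 1 + r)) has_real_derivative
            - (inverse (snd p 1) * inverse (snd p 1))) (at 0)"
          using nz[OF p] by (auto intro!: derivative_eq_intros)
        from DERIV_power[OF this, of k]
        have "((\<lambda>r. inverse (snd p 1 + r) ^ k) has_real_derivative
            - real k * inverse (snd p 1) ^ (k + 1)) (at 0)"
          by (rule DERIV_cong) (cases k; simp add: algebra_simps)
        from has_vector_derivative_scaleR[OF this R[OF p]]
        show "((\<lambda>r. inverse (snd (cshift v t0 \<tau> i r p) 1) ^ k *\<^sub>R ?R (cshift v t0 \<tau> i r p))
           has_vector_derivative inverse (snd p 1) ^ k *\<^sub>R ?R' p +
            (- real k) *\<^sub>R (inverse (snd p 1) ^ (k + 1) *\<^sub>R ?R p)) (at 0)"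
          unfolding s by (rule has_vector_derivative_eq_rhs) simp
      qed
    qed
  next
    case (add A B)
    then obtain A' B' where "quot_class v t0 \<tau> Q A'" "quot_class v t0 \<tau> Q B'"
      "\<forall>p\<in>D. ((\<lambda>r. A (cshift v t0 \<tau> i r p)) has_vector_derivative A' p) (at 0)"
      "\<forall>p\<in>D. ((\<lambda>r. B (cshift v t0 \<tau> i r p)) has_vector_derivative B' p) (at 0)" by blast
    then show ?case
      by (intro exI[of _ "\<lambda>p. A' p + B' p"]) (auto intro!: derivative_intros quot_class.add)
  next
    case (scale A a)
    then obtain A' where "quot_class v t0 \<tau> Q A'"
      "\<forall>p\<in>D. ((\<lambda>r. A (cshift v t0 \<tau> i r p)) has_vector_derivative A' p) (at 0)" by blast
    then show ?case
      by (intro exI[of _ "\<lambda>p. a *\<^sub>R A' p"]) (auto intro!: derivative_eq_intros quot_class.scale)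
  qed
qed (use nz in \<open>simp add: bquot_def\<close>)

section \<open>Hadamard's lemma on a neighbourhood star-shaped towards \<beta>_1 = 0\<close>

definition bscale :: "real \<Rightarrow> 'a \<times> (nat \<Rightarrow> real) \<Rightarrow> 'a \<times> (nat \<Rightarrow> real)" where
  "bscale s p = (fst p, (snd p)(1 := s * snd p 1))"

lemma continuous_on_bscale [continuous_intros]:
  fixes P :: "'c::topological_space \<Rightarrow> 'a::topological_space \<times> (nat \<Rightarrow> real)"
  assumes "continuous_on S s" "continuous_on S P"
  shows "continuous_on S (\<lambda>z. bscale (s z) (P z))"
proof -
  have "continuous_on S (\<lambda>z. snd (P z))" using assms(2) by (rule continuous_on_snd)
  note * = continuous_on_product_then_coordinatewise[OF this, of 1]
  then show ?thesis unfolding bscale_def using assms by (intro continuous_intros) auto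
qed

text \<open>Source of the chain rule factor: scaling commutes with every shift except the one along
  \<beta>_1, whose length is multiplied by \<open>s\<close>.\<close>

lemma bscale_cshift:
  assumes "i < ncoord t0 \<tau>" "\<tau> \<ge> 1"
  shows "bscale s (cshift v t0 \<tau> i r p) =
    cshift v t0 \<tau> i (if i = t0 + 1 then s * r else r) (bscale s p)"
  using assms(1)
proof (cases rule: coord_cases)
  case alpha
  then show ?thesis by (simp add: cshift_alpha bscale_def)
next
  case (beta h)
  then show ?thesis by (auto simp: cshift_beta bscale_def fun_eq_iff distrib_left)
qed

lemma bscale_add:
  assumes "\<tau> \<ge> 1"
  shows "bscale (s + r) p = cshift v t0 \<tau> (t0 + 1) (r * snd p 1) (bscale s p)"
  using assms by (subst cshift_beta) (auto simp: bscale_def fun_eq_iff distrib_right)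

lemma has_vector_derivative_pdir_linear:
  assumes "((\<lambda>r. G (cshift v t0 \<tau> i r p)) has_vector_derivative d) (at 0)"
  shows "((\<lambda>r. G (cshift v t0 \<tau> i (a * r) p)) has_vector_derivative a *\<^sub>R d) (at 0)"
proof -
  have "((\<lambda>r. a * r) has_vector_derivative a) (at 0)"
    by (auto intro!: derivative_eq_intros)
  from vector_diff_chain_at[OF this, of "\<lambda>r. G (cshift v t0 \<tau> i r p)"] assms show ?thesis
    by (simp add: o_def cong: if_cong)
qed

text \<open>Near \<open>\<beta>\<^sub>1 = 0\<close> this is Hadamard's lemma: the quotient is the mean of the derivative over the
  segment from the hyperplane \<open>\<beta>\<^sub>1 = 0\<close>.\<close>

lemma smooth_on_bquot_star:
  fixes Q :: "'a::real_normed_vector \<times> (nat \<Rightarrow> real) \<Rightarrow> 'b::banach"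
  assumes U: "line_open v t0 \<tau> U" and Q: "smooth_on v t0 \<tau> U Q" and \<tau>: "\<tau> \<ge> 1"
    and star: "\<And>q s. q \<in> U \<Longrightarrow> 0 \<le> s \<Longrightarrow> s \<le> 1 \<Longrightarrow> bscale s q \<in> U"
    and odd: "\<And>q. q \<in> U \<Longrightarrow> snd q 1 = 0 \<Longrightarrow> Q q = 0"
  shows "smooth_on v t0 \<tau> U (bquot v t0 \<tau> Q)"
proof -
  \<comment> \<open>The class closed under differentiation. Each derivative along \<beta>_1 brings
    out one factor \<open>s\<close>, which is why the power \<open>s ^ k\<close> is carried
    along.\<close>
  define I where "I = (\<lambda>k is p. integral (cbox 0 (1::real)) (\<lambda>s. s ^ k *\<^sub>R iterd v t0 \<tau> is Q (bscale s p)))"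
  have j: "t0 + 1 < ncoord t0 \<tau>" using \<tau> by (simp add: ncoord_def)
  have cont: "continuous_on (S \<times> cbox 0 1) (\<lambda>(z, s). s ^ k *\<^sub>R iterd v t0 \<tau> is Q (bscale s (P z)))"
    if "set is \<subseteq> {..<ncoord t0 \<tau>}" "continuous_on S P" "P ` S \<subseteq> U"
    for k "is" and S :: "'z::topological_space set" and P
  proof -
    have 1: "continuous_on (S \<times> cbox 0 (1::real)) (\<lambda>zs. P (fst zs))"
      by (rule continuous_on_compose2[OF that(2)]) (auto intro!: continuous_intros)
    have "continuous_on (S \<times> cbox 0 (1::real)) (\<lambda>zs. iterd v t0 \<tau> is Q (bscale (snd zs) (P (fst zs))))"
    proof (rule continuous_on_compose2[OF smooth_on_continuous[OF Q that(1)]])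
      show "continuous_on (S \<times> cbox 0 1) (\<lambda>zs. bscale (snd zs) (P (fst zs)))"
        by (intro continuous_intros 1)
      show "(\<lambda>zs. bscale (snd zs) (P (fst zs))) ` (S \<times> cbox 0 1) \<subseteq> U"
        using that(3) by (intro image_subsetI star) auto
    qed
    then show ?thesis by (auto simp: split_beta intro!: continuous_intros)
  qed
  have step: "((\<lambda>r. I k is (cshift v t0 \<tau> i r p)) has_vector_derivative
      I (if i = t0 + 1 then Suc k else k) (i # is) p) (at 0)"
    if is_: "set is \<subseteq> {..<ncoord t0 \<tau>}" and i: "i < ncoord t0 \<tau>" and p: "p \<in> U" for k "is" i p
  proof -
    have is': "set (i # is) \<subseteq> {..<ncoord t0 \<tau>}" using is_ i by auto
    \<comment> \<open>Differentiating under the integral sign needs a whole ball of parameters for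
      which the integrand is defined and jointly continuous.\<close>
    from U p i have "\<forall>\<^sub>F r in nhds 0. cshift v t0 \<tau> i r p \<in> U" unfolding line_open_def by blast
    then obtain d where d: "d > 0" "\<And>r. r \<in> ball 0 d \<Longrightarrow> cshift v t0 \<tau> i r p \<in> U"
      unfolding eventually_nhds_metric by (auto simp: dist_commute)
    define k' where "k' = (if i = t0 + 1 then Suc k else k)"
    have contP: "continuous_on (ball 0 d) (\<lambda>r. cshift v t0 \<tau> i r p)"
      using i by (intro continuous_intros)
    have "((\<lambda>r. I k is (cshift v t0 \<tau> i r p)) has_vector_derivative
        integral (cbox 0 1) (\<lambda>s. s ^ k' *\<^sub>R iterd v t0 \<tau> (i # is) Q (bscale s (cshift v t0 \<tau> i 0 p))))
        (at 0 within ball 0 d)"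
      unfolding I_def
    proof (rule leibniz_rule_vector_derivative[where
          fx = "\<lambda>r s. s ^ k' *\<^sub>R iterd v t0 \<tau> (i # is) Q (bscale s (cshift v t0 \<tau> i r p))"])
      fix r s :: real assume r: "r \<in> ball 0 d" and s: "s \<in> cbox 0 1"
      let ?p = "bscale s (cshift v t0 \<tau> i r p)"
      have "?p \<in> U" using star[OF d(2)[OF r]] s by auto
      from smooth_on_has_pdir[OF Q is_ this i]
      have "((\<lambda>h. iterd v t0 \<tau> is Q (cshift v t0 \<tau> i ((if i = t0 + 1 then s else 1) * h) ?p)) has_vector_derivative
        (if i = t0 + 1 then s else 1) *\<^sub>R iterd v t0 \<tau> (i # is) Q ?p) (at 0)"
        by (rule has_vector_derivative_pdir_linear)
      moreover have "cshift v t0 \<tau> i ((if i = t0 + 1 then s else 1) * h) ?p =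
          bscale s (cshift v t0 \<tau> i h (cshift v t0 \<tau> i r p))" for h
        unfolding bscale_cshift[OF i \<tau>, of s v h "cshift v t0 \<tau> i r p"]
        by (cases "i = t0 + 1") (simp_all cong: if_cong)
      ultimately have "((\<lambda>h. iterd v t0 \<tau> is Q (bscale s (cshift v t0 \<tau> i h (cshift v t0 \<tau> i r p))))
        has_vector_derivative (if i = t0 + 1 then s else 1) *\<^sub>R iterd v t0 \<tau> (i # is) Q ?p) (at 0)"
        by simp
      from has_pdir_at[where G = "\<lambda>q. iterd v t0 \<tau> is Q (bscale s q)", OF this i]
      have "((\<lambda>h. s ^ k *\<^sub>R iterd v t0 \<tau> is Q (bscale s (cshift v t0 \<tau> i h p))) has_vector_derivative
        s ^ k *\<^sub>R (if i = t0 + 1 then s else 1) *\<^sub>R iterd v t0 \<tau> (i # is) Q ?p) (at r)"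
        by (auto intro!: derivative_eq_intros)
      then show "((\<lambda>h. s ^ k *\<^sub>R iterd v t0 \<tau> is Q (bscale s (cshift v t0 \<tau> i h p))) has_vector_derivative
        s ^ k' *\<^sub>R iterd v t0 \<tau> (i # is) Q ?p) (at r within ball 0 d)"
        by (auto simp: k'_def mult.commute split: if_splits intro: has_vector_derivative_at_within)
    next
      fix r :: real assume r: "r \<in> ball 0 d"
      have "continuous_on ({r} \<times> cbox 0 1)
          (\<lambda>(z, s). s ^ k *\<^sub>R iterd v t0 \<tau> is Q (bscale s (cshift v t0 \<tau> i z p)))"
        by (rule cont[OF is_]) (use d(2)[OF r] in auto)
      moreover have "continuous_on (cbox 0 1) (\<lambda>s. (r, s))" by (intro continuous_intros)
      moreover have "(\<lambda>s. (r, s)) ` cbox 0 1 \<subseteq> {r} \<times> cbox 0 1" by auto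
      note continuous_on_compose2[OF calculation this]
      then
      have "continuous_on (cbox 0 1) (\<lambda>s. s ^ k *\<^sub>R iterd v t0 \<tau> is Q (bscale s (cshift v t0 \<tau> i r p)))"
        by simp
      then show "(\<lambda>s. s ^ k *\<^sub>R iterd v t0 \<tau> is Q (bscale s (cshift v t0 \<tau> i r p))) integrable_on cbox 0 1"
        by (rule integrable_continuous)
    next
      show "continuous_on (ball 0 d \<times> cbox 0 1)
          (\<lambda>(r, s). s ^ k' *\<^sub>R iterd v t0 \<tau> (i # is) Q (bscale s (cshift v t0 \<tau> i r p)))"
        by (rule cont[OF is' contP]) (use d(2) in auto)
    qed (use d(1) in auto)
    then show ?thesis
      using d(1) by (simp add: I_def k'_def at_within_open[of _ "ball 0 d"] del: iterd.simps)
  qed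
  \<comment> \<open>If \<beta>_1 = 0 the segment is a single point and the mean of a constant over
    the unit interval is that constant. Otherwise the fundamental theorem applies to s \<mapsto> Q
    (bscale s p), which vanishes at s = 0 and has derivative \<beta>_1 times the integrand.\<close>
  have hadamard: "bquot v t0 \<tau> Q p = I 0 [t0 + 1] p" if p: "p \<in> U" for p
  proof (cases "snd p 1 = 0")
    case True
    then have "bscale s p = p" for s by (simp add: bscale_def prod_eq_iff fun_eq_iff)
    with True show ?thesis by (simp add: bquot_def I_def)
  next
    case False
    let ?Q' = "\<lambda>s. iterd v t0 \<tau> [t0 + 1] Q (bscale s p)"
    have "((\<lambda>s. snd p 1 *\<^sub>R ?Q' s) has_integral (Q (bscale 1 p) - Q (bscale 0 p))) {0..1}"
    proof (rule fundamental_theorem_of_calculus)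
      fix s :: real assume s: "s \<in> {0..1}"
      then have "bscale s p \<in> U" using star p by auto
      from smooth_on_has_pdir[OF Q _ this j, of "[]"]
      have "((\<lambda>r. Q (cshift v t0 \<tau> (t0 + 1) (snd p 1 * r) (bscale s p))) has_vector_derivative
         snd p 1 *\<^sub>R ?Q' s) (at 0)"
        by (intro has_vector_derivative_pdir_linear) simp
      then have "((\<lambda>r. Q (bscale (s + r) p)) has_vector_derivative snd p 1 *\<^sub>R ?Q' s) (at (s - s))"
        by (simp add: bscale_add[OF \<tau>, of s _ p v t0] mult.commute del: iterd.simps cong: if_cong)
      moreover have "((\<lambda>r. r - s) has_vector_derivative 1) (at s)"
        by (auto intro!: derivative_eq_intros)
      ultimately have "((\<lambda>r. Q (bscale (s + r) p)) \<circ> (\<lambda>r. r - s) has_vector_derivative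
          1 *\<^sub>R (snd p 1 *\<^sub>R ?Q' s)) (at s)"
        by (intro vector_diff_chain_at)
      then show "((\<lambda>s. Q (bscale s p)) has_vector_derivative snd p 1 *\<^sub>R ?Q' s) (at s within {0..1})"
        by (simp add: o_def has_vector_derivative_at_within)
    qed simp
    moreover have "bscale 1 p = p" by (simp add: bscale_def prod_eq_iff fun_eq_iff)
    moreover have "Q (bscale 0 p) = 0"
      using star[OF p, of 0] by (intro odd) (auto simp: bscale_def)
    ultimately have "((\<lambda>s. snd p 1 *\<^sub>R ?Q' s) has_integral Q p) {0..1}" by simp
    then have "((\<lambda>s. inverse (snd p 1) *\<^sub>R snd p 1 *\<^sub>R ?Q' s) has_integral inverse (snd p 1) *\<^sub>R Q p) {0..1}"
      by (rule has_integral_cmul)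
    with False have "(?Q' has_integral inverse (snd p 1) *\<^sub>R Q p) {0..1}" by simp
    with False show ?thesis by (simp add: bquot_def I_def integral_unique del: iterd.simps)
  qed
  show ?thesis
  proof (rule smooth_on_coinduct[OF U, where C = "\<lambda>H. \<exists>k is. set is \<subseteq> {..<ncoord t0 \<tau>} \<and> H = I k is"
        and ?G0.0 = "I 0 [t0 + 1]"])
    show "\<exists>k is. set is \<subseteq> {..<ncoord t0 \<tau>} \<and> I 0 [t0 + 1] = I k is"
      using j by (intro exI[of _ 0] exI[of _ "[t0 + 1]"]) auto
  next
    fix H assume "\<exists>k is. set is \<subseteq> {..<ncoord t0 \<tau>} \<and> H = I k is"
    then obtain k "is" where H: "set is \<subseteq> {..<ncoord t0 \<tau>}" "H = I k is" by blast
    show "continuous_on U H"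
      unfolding H(2) I_def by (intro integral_continuous_on_param cont H(1)) auto
  next
    fix H i assume "\<exists>k is. set is \<subseteq> {..<ncoord t0 \<tau>} \<and> H = I k is" and i: "i < ncoord t0 \<tau>"
    then obtain k "is" where H: "set is \<subseteq> {..<ncoord t0 \<tau>}" "H = I k is" by blast
    show "\<exists>H'. (\<exists>k is. set is \<subseteq> {..<ncoord t0 \<tau>} \<and> H' = I k is) \<and>
        (\<forall>p\<in>U. ((\<lambda>r. H (cshift v t0 \<tau> i r p)) has_vector_derivative H' p) (at 0))"
    proof (intro exI conjI ballI)
      show "set (i # is) \<subseteq> {..<ncoord t0 \<tau>}" using H(1) i by simp
      show "I (if i = t0 + 1 then Suc k else k) (i # is) = I (if i = t0 + 1 then Suc k else k) (i # is)" ..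
      fix p assume "p \<in> U"
      then show "((\<lambda>r. H (cshift v t0 \<tau> i r p)) has_vector_derivative
          I (if i = t0 + 1 then Suc k else k) (i # is) p) (at 0)"
        unfolding H(2) by (rule step[OF H(1) i])
    qed
  qed (fact hadamard)
qed

text \<open>A point with \<beta>_1 = 0 has a coordinate box inside \<open>D\<close>, which
  \<open>bscale\<close> with factor in [0,1] preserves; any other point lies in the relatively open
  part where \<beta>_1 does not vanish.\<close>

lemma (in frame) smooth_on_bquot:
  fixes Q :: "'a \<times> (nat \<Rightarrow> real) \<Rightarrow> 'b::banach"
  assumes D: "openin (top_of_set (Rlm v 0 t0 \<times> Rtau \<tau>)) D" "t0 \<le> N" "\<tau> \<ge> 1"
    and Q: "smooth_on v t0 \<tau> D Q" and odd: "\<And>q. q \<in> D \<Longrightarrow> snd q 1 = 0 \<Longrightarrow> Q q = 0"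
  shows "smooth_on v t0 \<tau> D (bquot v t0 \<tau> Q)"
proof (rule smooth_on_local)
  fix p assume p: "p \<in> D"
  have sub: "D \<subseteq> Rlm v 0 t0 \<times> Rtau \<tau>" using D(1) by (simp add: openin_imp_subset)
  have "\<exists>U. p \<in> U \<and> openin (top_of_set (Rlm v 0 t0 \<times> Rtau \<tau>)) U \<and> U \<subseteq> D \<and> smooth_on v t0 \<tau> U (bquot v t0 \<tau> Q)"
  proof (cases "snd p 1 = 0")
    case True
    from openin_contains_coord_box[OF D(1) p D(2)] obtain r where r: "r > 0" "coord_box v t0 \<tau> r p \<subseteq> D" .
    let ?U = "coord_box v t0 \<tau> r p"
    have "smooth_on v t0 \<tau> ?U (bquot v t0 \<tau> Q)"
    proof (rule smooth_on_bquot_star[OF openin_line_open[OF openin_coord_box] smooth_on_subset[OF Q r(2)] D(3)])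
      fix q and s :: real assume q: "q \<in> ?U" "0 \<le> s" "s \<le> 1"
      have "\<bar>s * snd q 1\<bar> \<le> \<bar>snd q 1\<bar>"
        using q by (simp add: abs_mult mult_left_le_one_le)
      moreover have "\<bar>snd q 1 - snd p 1\<bar> < r"
        using q(1) D(3) unfolding coord_box_def by simp
      with True have "\<bar>snd q 1\<bar> < r" by simp
      ultimately have "\<bar>s * snd q 1\<bar> < r" by linarith
      with q True show "bscale s q \<in> ?U"
        by (auto simp: coord_box_def bscale_def Rtau_def)
    qed (use odd r in auto)
    moreover have "p \<in> ?U" using p sub r(1) by (auto simp: coord_box_def)
    ultimately show ?thesis using r(2) by (intro exI[of _ ?U] conjI openin_coord_box)
  next
    case False
    let ?U = "D \<inter> {q. snd q 1 \<noteq> 0}"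
    have "continuous_on UNIV (\<lambda>q::'a \<times> (nat \<Rightarrow> real). snd q 1)"
      by (rule continuous_on_product_then_coordinatewise) (intro continuous_intros)
    then have "open {q::'a \<times> (nat \<Rightarrow> real). snd q 1 \<noteq> 0}"
      by (intro open_Collect_neq continuous_intros)
    then have op: "openin (top_of_set (Rlm v 0 t0 \<times> Rtau \<tau>)) ?U"
      using D(1) by (rule openin_Int_open[rotated])
    have "smooth_on v t0 \<tau> ?U (bquot v t0 \<tau> Q)"
      by (rule smooth_on_bquot_nonzero[OF openin_line_open[OF op] smooth_on_subset[OF Q] _ D(3)]) auto
    with op False p show ?thesis by (intro exI[of _ ?U]) simp
  qed
  then show "\<exists>U. p \<in> U \<and> openin (top_of_set D) U \<and> smooth_on v t0 \<tau> U (bquot v t0 \<tau> Q)"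
    using sub by (meson openin_subset_trans)
qed

section \<open>Dividing an analytic function by a coordinate\<close>

text \<open>Finite dimension is what makes this true: every real coordinate is absolutely summable,
  and the norm is at most the sum of the absolute coordinates.\<close>

lemma summable_on_imp_norm_summable_on:
  fixes f :: "'i \<Rightarrow> 'b::euclidean_space"
  assumes "f summable_on A"
  shows "(\<lambda>x. norm (f x)) summable_on A"
proof (rule summable_on_comparison_test)
  have *: "(\<lambda>x. \<bar>f x \<bullet> b\<bar>) summable_on A" for b
    using summable_on_iff_abs_summable_on_real[THEN iffD1,
        OF summable_on_bounded_linear[OF bounded_linear_inner_left assms, of b]] by simp
  have "(\<lambda>x. \<Sum>b\<in>B. \<bar>f x \<bullet> b\<bar>) summable_on A" if "finite B" for B
    using that by induction (auto intro: summable_on_add *)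
  from this[OF finite_Basis] show "(\<lambda>x. \<Sum>b\<in>Basis. \<bar>f x \<bullet> b\<bar>) summable_on A" .
qed (simp_all add: norm_le_l1)

text \<open>Termwise differentiation of real power series, applied to each coordinate of the
  vector-valued series.\<close>

lemma power_series_has_vector_derivative:
  fixes a :: "nat \<Rightarrow> 'b::euclidean_space"
  assumes r: "r > 0" and f: "\<And>s. \<bar>s\<bar> < r \<Longrightarrow> ((\<lambda>k. s ^ k *\<^sub>R a k) has_sum f s) UNIV"
  shows "(f has_vector_derivative a 1) (at 0)"
proof -
  have "((\<lambda>s. f s \<bullet> b) has_real_derivative a 1 \<bullet> b) (at 0)" for b
  proof -
    have sums: "(\<lambda>k. (a k \<bullet> b) * s ^ k) sums (f s \<bullet> b)" if "\<bar>s\<bar> < r" for s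
      using has_sum_imp_sums[OF has_sum_bounded_linear[OF bounded_linear_inner_left f[OF that], of b]]
      by (simp add: mult.commute)
    have "((\<lambda>s. \<Sum>k. (a k \<bullet> b) * s ^ k) has_real_derivative (\<Sum>k. diffs (\<lambda>k. a k \<bullet> b) k * 0 ^ k)) (at 0)"
      by (rule termdiffs_strong'[where K = r]) (use sums r in \<open>auto simp: sums_iff\<close>)
    then have "((\<lambda>s. \<Sum>k. (a k \<bullet> b) * s ^ k) has_real_derivative a 1 \<bullet> b) (at 0)"
      by (simp add: diffs_def)
    then show ?thesis
      by (rule has_field_derivative_transform_within_open[where S = "ball 0 r"])
        (use sums r in \<open>auto simp: sums_iff\<close>)
  qed
  then show ?thesis
    unfolding has_vector_derivative_def
    by (subst has_derivative_componentwise_within)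
      (simp add: has_field_derivative_def mult_commute_abs)
qed

text \<open>The convergence half of \<open>analytic_on_dom\<close>, freed from the domain condition
  and from \<open>shift\<close>, so that series can be manipulated as functions of the increment
  alone.\<close>

definition multi_series :: "nat \<Rightarrow> real \<Rightarrow> ((nat \<Rightarrow> nat) \<Rightarrow> 'b::real_normed_vector) \<Rightarrow> ((nat \<Rightarrow> real) \<Rightarrow> 'b) \<Rightarrow> bool" where
  "multi_series n r c f \<longleftrightarrow>
     (\<forall>y. (\<forall>i. i \<ge> n \<longrightarrow> y i = 0) \<and> (\<forall>i<n. \<bar>y i\<bar> < r) \<longrightarrow>
       ((\<lambda>m. (\<Prod>i<n. y i ^ m i) *\<^sub>R c m) has_sum f y) {m. \<forall>i. i \<ge> n \<longrightarrow> m i = 0})"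

text \<open>Grouping the multi-indices by their \<open>j\<close>-th entry turns the series into a
  power series in the \<open>j\<close>-th variable, with the other variables frozen at
  \<open>y\<close>.\<close>

lemma multi_series_slice:
  fixes c :: "(nat \<Rightarrow> nat) \<Rightarrow> 'b::banach"
  assumes c: "multi_series n r c f" and "r > 0" and j: "j < n"
    and y: "\<And>i. i \<ge> n \<Longrightarrow> y i = 0" "\<And>i. i < n \<Longrightarrow> \<bar>y i\<bar> < r"
  obtains b where
    "\<And>k. ((\<lambda>m. (\<Prod>i\<in>{..<n} - {j}. y i ^ m i) *\<^sub>R c m) has_sum b k) {m. (\<forall>i. i \<ge> n \<longrightarrow> m i = 0) \<and> m j = k}"
    "\<And>s. \<bar>s\<bar> < r \<Longrightarrow> ((\<lambda>k. s ^ k *\<^sub>R b k) has_sum f (y(j := s))) UNIV"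
proof -
  let ?M = "{m::nat \<Rightarrow> nat. \<forall>i. i \<ge> n \<longrightarrow> m i = 0}"
  let ?w = "\<lambda>m. \<Prod>i\<in>{..<n} - {j}. y i ^ m i"
  let ?Mk = "\<lambda>k. {m::nat \<Rightarrow> nat. (\<forall>i. i \<ge> n \<longrightarrow> m i = 0) \<and> m j = k}"
  define b where "b = (\<lambda>k. infsum (\<lambda>m. ?w m *\<^sub>R c m) (?Mk k))"
  have prod: "(\<Prod>i<n. (y(j := s)) i ^ m i) = s ^ m j * ?w m" for s and m :: "nat \<Rightarrow> nat"
    using j by (subst prod.remove[of _ j]) (auto intro!: arg_cong2[where f = "(*)"] prod.cong)
  have ser: "((\<lambda>m. (s ^ m j * ?w m) *\<^sub>R c m) has_sum f (y(j := s))) ?M" if "\<bar>s\<bar> < r" for s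
  proof -
    have "(\<forall>i. i \<ge> n \<longrightarrow> (y(j := s)) i = 0) \<and> (\<forall>i<n. \<bar>(y(j := s)) i\<bar> < r)"
      using y j that by auto
    with c have "((\<lambda>m. (\<Prod>i<n. (y(j := s)) i ^ m i) *\<^sub>R c m) has_sum f (y(j := s))) ?M"
      unfolding multi_series_def by blast
    then show ?thesis unfolding prod .
  qed
  have inner: "((\<lambda>m. ?w m *\<^sub>R c m) has_sum b k) (?Mk k)" for k
  proof -
    \<comment> \<open>The value r/2 stands for any nonzero admissible \<open>j\<close>-th
      coordinate: its power can be divided out again, which is impossible with \<open>y j\<close>
      when that is 0.\<close>
    have "(\<lambda>m. ((r/2) ^ m j * ?w m) *\<^sub>R c m) summable_on ?Mk k"
      by (rule summable_on_subset_banach[of _ ?M]) (use ser[of "r/2"] \<open>r > 0\<close> in \<open>auto simp: summable_on_def\<close>)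
    then have "(\<lambda>m. (r/2) ^ k *\<^sub>R (?w m *\<^sub>R c m)) summable_on ?Mk k"
      by (rule summable_on_cong[THEN iffD1, rotated]) auto
    from summable_on_bounded_linear[OF bounded_linear_scaleR_right this, of "inverse ((r/2) ^ k)"]
    have "(\<lambda>m. ?w m *\<^sub>R c m) summable_on ?Mk k"
      using \<open>r > 0\<close> by (simp add: mult.assoc[symmetric])
    then show ?thesis unfolding b_def by (rule has_sum_infsum)
  qed
  have outer: "((\<lambda>k. s ^ k *\<^sub>R b k) has_sum f (y(j := s))) UNIV" if "\<bar>s\<bar> < r" for s
  proof (rule has_sum_SigmaD)
    show "((\<lambda>(k, m). (s ^ m j * ?w m) *\<^sub>R c m) has_sum f (y(j := s))) (Sigma UNIV ?Mk)"
      by (rule has_sum_reindex_bij_witness[where i = "\<lambda>m. (m j, m)" and j = snd, THEN iffD2, OF _ _ _ _ _ refl ser[OF that]])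
        auto
  next
    fix k
    have "((\<lambda>m. s ^ k *\<^sub>R (?w m *\<^sub>R c m)) has_sum s ^ k *\<^sub>R b k) (?Mk k)"
      by (rule has_sum_scaleR[OF inner])
    then show "((\<lambda>m. case (k, m) of (k, m) \<Rightarrow> (s ^ m j * ?w m) *\<^sub>R c m) has_sum s ^ k *\<^sub>R b k) (?Mk k)"
      by (rule has_sum_cong[THEN iffD1, rotated]) auto
  qed
  show thesis using that[OF inner outer] .
qed

lemma multi_series_has_vector_derivative:
  fixes c :: "(nat \<Rightarrow> nat) \<Rightarrow> 'b::euclidean_space"
  assumes "multi_series n r c f" "r > 0" "j < n"
  shows "\<exists>d. ((\<lambda>s. f (\<lambda>i. if i = j then s else 0)) has_vector_derivative d) (at 0)"
proof -
  obtain b where "\<And>s. \<bar>s\<bar> < r \<Longrightarrow> ((\<lambda>k. s ^ k *\<^sub>R b k) has_sum f ((\<lambda>_. 0)(j := s))) UNIV"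
    by (rule multi_series_slice[OF assms, of "\<lambda>_. 0"]) (use \<open>r > 0\<close> in auto)
  from power_series_has_vector_derivative[OF assms(2) this] show ?thesis
    by (auto simp: fun_upd_def)
qed

lemma multi_series_divide_coordinate:
  fixes c :: "(nat \<Rightarrow> nat) \<Rightarrow> 'b::euclidean_space"
  assumes c: "multi_series n r c f" and r: "r > 0" and j: "j < n"
    and zero: "\<And>y. (\<forall>i. i \<ge> n \<longrightarrow> y i = 0) \<Longrightarrow> (\<forall>i<n. \<bar>y i\<bar> < r) \<Longrightarrow> y j = 0 \<Longrightarrow> f y = 0"
    and g: "\<And>y. (\<forall>i. i \<ge> n \<longrightarrow> y i = 0) \<Longrightarrow> (\<forall>i<n. \<bar>y i\<bar> < r) \<Longrightarrow>
      g y = (if y j \<noteq> 0 then inverse (y j) *\<^sub>R f y else vector_derivative (\<lambda>s. f (y(j := s))) (at 0))"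
  shows "multi_series n r (\<lambda>m. c (m(j := Suc (m j)))) g"
  unfolding multi_series_def
proof (intro allI impI)
  fix y assume y: "(\<forall>i. i \<ge> n \<longrightarrow> y i = 0) \<and> (\<forall>i<n. \<bar>y i\<bar> < r)"
  let ?M = "{m::nat \<Rightarrow> nat. \<forall>i. i \<ge> n \<longrightarrow> m i = 0}"
  let ?w = "\<lambda>m. \<Prod>i\<in>{..<n} - {j}. y i ^ m i"
  let ?Mk = "\<lambda>k. {m::nat \<Rightarrow> nat. (\<forall>i. i \<ge> n \<longrightarrow> m i = 0) \<and> m j = k}"
  let ?c = "\<lambda>m. c (m(j := Suc (m j)))"
  have prod: "(\<Prod>i<n. y i ^ m i) = y j ^ m j * ?w m" for m :: "nat \<Rightarrow> nat"
    using j by (subst prod.remove[of _ j]) auto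
  have w: "?w (m(j := k)) = ?w m" for m :: "nat \<Rightarrow> nat" and k
    by (rule prod.cong) auto
  obtain b where b: "\<And>k. ((\<lambda>m. ?w m *\<^sub>R c m) has_sum b k) (?Mk k)"
    "\<And>s. \<bar>s\<bar> < r \<Longrightarrow> ((\<lambda>k. s ^ k *\<^sub>R b k) has_sum f (y(j := s))) UNIV"
    using multi_series_slice[OF c r j, of y] y by auto
  show "((\<lambda>m. (\<Prod>i<n. y i ^ m i) *\<^sub>R ?c m) has_sum g y) ?M"
  proof (cases "y j = 0")
    case False
    \<comment> \<open>Evaluating the slice at 0 isolates \<open>b 0\<close>, as 0 ^ k vanishes for
      positive \<open>k\<close> and 0 ^ 0 = 1.\<close>
    have "((\<lambda>k. 0 ^ k *\<^sub>R b k) has_sum f (y(j := 0))) UNIV"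
      using b(2)[of 0] r by simp
    then have "(b has_sum f (y(j := 0))) {0}"
      by (rule has_sum_cong_neutral[THEN iffD1, rotated -1]) auto
    from has_sum_unique[OF has_sum_finite this] have "b 0 = f (y(j := 0))" by simp
    also have "\<dots> = 0" using y r by (intro zero) auto
    finally have "b 0 = 0" .
    have "((\<lambda>m. (y j ^ m j * ?w m) *\<^sub>R c m) has_sum f y) ?M"
    proof -
      from c y have "((\<lambda>m. (\<Prod>i<n. y i ^ m i) *\<^sub>R c m) has_sum f y) ?M"
        unfolding multi_series_def by blast
      then show ?thesis unfolding prod .
    qed
    moreover have "((\<lambda>m. (y j ^ m j * ?w m) *\<^sub>R c m) has_sum 0) (?Mk 0)"
      using b(1)[of 0] unfolding \<open>b 0 = 0\<close> by (rule has_sum_cong[THEN iffD1, rotated]) auto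
    ultimately have "((\<lambda>m. (y j ^ m j * ?w m) *\<^sub>R c m) has_sum f y - 0) (?M - ?Mk 0)"
      by (rule has_sum_Diff) auto
    moreover have "((\<lambda>m. (y j * (\<Prod>i<n. y i ^ m i)) *\<^sub>R ?c m) has_sum f y) ?M \<longleftrightarrow>
        ((\<lambda>m. (y j ^ m j * ?w m) *\<^sub>R c m) has_sum f y) (?M - ?Mk 0)"
    proof (rule has_sum_reindex_bij_witness)
      fix m assume "m \<in> ?M"
      then show "m(j := Suc (m j)) \<in> ?M - ?Mk 0" using j by auto
      show "(m(j := Suc (m j)))(j := (m(j := Suc (m j))) j - 1) = m" by simp
      show "(y j ^ (m(j := Suc (m j))) j * ?w (m(j := Suc (m j)))) *\<^sub>R c (m(j := Suc (m j))) =
          (y j * (\<Prod>i<n. y i ^ m i)) *\<^sub>R ?c m"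
        unfolding prod w by (simp only: fun_upd_same power_Suc mult.assoc)
    next
      fix m assume "m \<in> ?M - ?Mk 0"
      then show "m(j := m j - 1) \<in> ?M" "(m(j := m j - 1))(j := Suc ((m(j := m j - 1)) j)) = m"
        using j by auto
    qed simp
    ultimately have "((\<lambda>m. (y j * (\<Prod>i<n. y i ^ m i)) *\<^sub>R ?c m) has_sum f y) ?M" by simp
    from has_sum_scaleR[OF this, of "inverse (y j)"] False g[of y] y show ?thesis
      by (simp add: mult.assoc[symmetric])
  next
    case True
    have "((\<lambda>s. f (y(j := s))) has_vector_derivative b 1) (at 0)"
      by (rule power_series_has_vector_derivative[OF r b(2)])
    then have "g y = b 1" using True g[of y] y by (simp add: vector_derivative_at)
    \<comment> \<open>Since y_j = 0, only multi-indices with \<open>m j = 0\<close> survive; their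
      raised coefficients are the original ones with \<open>m j = 1\<close>, whose sum is
      \<open>b 1\<close>.\<close>
    moreover have "((\<lambda>m. ?w m *\<^sub>R ?c m) has_sum b 1) (?Mk 0)
        \<longleftrightarrow> ((\<lambda>m. ?w m *\<^sub>R c m) has_sum b 1) (?Mk 1)"
    proof (rule has_sum_reindex_bij_witness)
      fix m assume m: "m \<in> ?Mk 0"
      then show "m(j := Suc (m j)) \<in> ?Mk 1" using j by auto
      show "(m(j := Suc (m j)))(j := 0) = m" using m by auto
      show "?w (m(j := Suc (m j))) *\<^sub>R c (m(j := Suc (m j))) = ?w m *\<^sub>R ?c m"
        unfolding w ..
    next
      fix m assume "m \<in> ?Mk 1"
      then show "m(j := 0) \<in> ?Mk 0" "(m(j := 0))(j := Suc ((m(j := 0)) j)) = m"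
        using j by auto
    qed simp
    with b(1)[of 1] have "((\<lambda>m. ?w m *\<^sub>R ?c m) has_sum b 1) (?Mk 0)" by blast
    then have "((\<lambda>m. (\<Prod>i<n. y i ^ m i) *\<^sub>R ?c m) has_sum b 1) ?M"
      by (rule has_sum_cong_neutral[THEN iffD1, rotated -1]) (auto simp: prod True)
    ultimately show ?thesis by simp
  qed
qed

lemma has_sum_inverse_add:
  fixes \<beta> x :: real
  assumes "\<bar>x\<bar> < \<bar>\<beta>\<bar>"
  shows "((\<lambda>k. inverse \<beta> * (- inverse \<beta>) ^ k * x ^ k) has_sum inverse (\<beta> + x)) UNIV"
    and "(\<lambda>k. \<bar>inverse \<beta> * (- inverse \<beta>) ^ k * x ^ k\<bar>) summable_on UNIV"
proof -
  have "\<beta> \<noteq> 0" "\<beta> + x \<noteq> 0" using assms by auto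
  have q: "\<bar>- inverse \<beta> * x\<bar> < 1" using assms \<open>\<beta> \<noteq> 0\<close> by (simp add: abs_mult field_simps)
  have "(\<lambda>k. inverse \<beta> * (- inverse \<beta> * x) ^ k) sums (inverse \<beta> * (1 / (1 - (- inverse \<beta> * x))))"
    using q by (intro sums_mult geometric_sums) simp
  moreover have "inverse \<beta> * (1 / (1 - (- inverse \<beta> * x))) = inverse (\<beta> + x)"
    using \<open>\<beta> \<noteq> 0\<close> \<open>\<beta> + x \<noteq> 0\<close> by (simp add: field_simps)
  ultimately have "(\<lambda>k. inverse \<beta> * (- inverse \<beta> * x) ^ k) sums inverse (\<beta> + x)" by simp
  moreover have "summable (\<lambda>k. norm (inverse \<beta> * (- inverse \<beta> * x) ^ k))"
    using q by (auto simp: abs_mult power_abs intro!: summable_mult)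
  ultimately have "((\<lambda>k. inverse \<beta> * (- inverse \<beta> * x) ^ k) has_sum inverse (\<beta> + x)) UNIV"
    by (intro norm_summable_imp_has_sum)
  then show *: "((\<lambda>k. inverse \<beta> * (- inverse \<beta>) ^ k * x ^ k) has_sum inverse (\<beta> + x)) UNIV"
    unfolding power_mult_distrib by (simp only: mult.assoc)
  then have "(\<lambda>k. inverse \<beta> * (- inverse \<beta>) ^ k * x ^ k) summable_on UNIV" by (auto simp: summable_on_def)
  then show "(\<lambda>k. \<bar>inverse \<beta> * (- inverse \<beta>) ^ k * x ^ k\<bar>) summable_on UNIV"
    by (subst (asm) summable_on_iff_abs_summable_on_real) simp
qed

text \<open>Cauchy product of the given series with the geometric series of 1/(\<beta> + y_j), hence
  a convolution in the index \<open>m j\<close> alone. The bound on \<open>r\<close> keeps |y_j|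
  below |\<beta>|.\<close>

lemma multi_series_divide_affine:
  fixes c :: "(nat \<Rightarrow> nat) \<Rightarrow> 'b::euclidean_space"
  assumes c: "multi_series n r c f" and j: "j < n" and \<beta>: "\<beta> \<noteq> 0" "r \<le> \<bar>\<beta>\<bar>"
  shows "multi_series n r
    (\<lambda>m. \<Sum>k\<le>m j. (inverse \<beta> * (- inverse \<beta>) ^ k) *\<^sub>R c (m(j := m j - k)))
    (\<lambda>y. inverse (\<beta> + y j) *\<^sub>R f y)"
  unfolding multi_series_def
proof (intro allI impI)
  fix y assume y: "(\<forall>i. i \<ge> n \<longrightarrow> y i = 0) \<and> (\<forall>i<n. \<bar>y i\<bar> < r)"
  let ?M = "{m::nat \<Rightarrow> nat. \<forall>i. i \<ge> n \<longrightarrow> m i = 0}"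
  let ?u = "\<lambda>m. (\<Prod>i<n. y i ^ m i)"
  define g where "g k = inverse \<beta> * (- inverse \<beta>) ^ k" for k
  define F where "F = (\<lambda>(m, k). (g k * y j ^ k) *\<^sub>R (?u m *\<^sub>R c m))"
  have "\<bar>y j\<bar> < \<bar>\<beta>\<bar>" using y j \<beta> by force
  note geo = has_sum_inverse_add[OF this, folded g_def]
  have f: "((\<lambda>m. ?u m *\<^sub>R c m) has_sum f y) ?M"
    using c y unfolding multi_series_def by blast
  then have abs: "(\<lambda>m. norm (?u m *\<^sub>R c m)) summable_on ?M"
    by (intro summable_on_imp_norm_summable_on) (auto simp: summable_on_def)
  \<comment> \<open>Absolute summability of the double family is what licenses the rearrangement:
    the norm of a term is the product of a geometric term and a term of the series of
    \<open>f\<close>.\<close>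
  have "(\<lambda>mk. norm (F mk)) summable_on (?M \<times> UNIV)"
    unfolding Infinite_Sum.abs_summable_on_Sigma_iff
  proof (intro conjI ballI)
    fix m
    have "(\<lambda>k. norm (?u m *\<^sub>R c m) * \<bar>g k * y j ^ k\<bar>) summable_on UNIV"
      by (rule summable_on_cmult_right[OF geo(2)])
    then show "(\<lambda>k. norm (F (m, k))) summable_on UNIV"
      by (simp add: F_def abs_mult mult_ac)
  next
    have "norm (F (m, k)) = \<bar>g k * y j ^ k\<bar> * norm (?u m *\<^sub>R c m)" for m k
      by (simp add: F_def abs_mult mult_ac)
    then have "(\<Sum>\<^sub>\<infinity>k. norm (F (m, k))) = (\<Sum>\<^sub>\<infinity>k. \<bar>g k * y j ^ k\<bar>) * norm (?u m *\<^sub>R c m)" for m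
      by (simp only: infsum_cmult_left')
    moreover have "(\<lambda>m. norm ((\<Sum>\<^sub>\<infinity>k. \<bar>g k * y j ^ k\<bar>) * norm (?u m *\<^sub>R c m))) summable_on ?M"
      by (rule summable_on_iff_abs_summable_on_real[THEN iffD1, OF summable_on_cmult_right[OF abs]])
    ultimately show "(\<lambda>m. norm (\<Sum>\<^sub>\<infinity>k. norm (F (m, k)))) summable_on ?M" by (simp only:)
  qed
  then have "F summable_on (?M \<times> UNIV)" by (rule abs_summable_summable)
  moreover have "((\<lambda>k. F (m, k)) has_sum inverse (\<beta> + y j) *\<^sub>R (?u m *\<^sub>R c m)) UNIV" for m
    using has_sum_bounded_linear[OF bounded_linear_scaleR_left geo(1), of "?u m *\<^sub>R c m"]
    by (simp add: F_def)
  ultimately have "(F has_sum inverse (\<beta> + y j) *\<^sub>R f y) (?M \<times> UNIV)"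
    by (intro has_sum_SigmaI[OF _ has_sum_scaleR[OF f]])
  \<comment> \<open>Terms are regrouped by the total exponent of y_j: \<open>m j\<close> becomes
    that total, and \<open>k\<close> is the share taken from the geometric series.\<close>
  then have S: "((\<lambda>(m, k). F (m(j := m j - k), k)) has_sum inverse (\<beta> + y j) *\<^sub>R f y) (Sigma ?M (\<lambda>m. {..m j}))"
    by (subst has_sum_reindex_bij_witness[where i = "\<lambda>(m, k). (m(j := m j + k), k)" and
          j = "\<lambda>(m, k). (m(j := m j - k), k)" and T = "?M \<times> UNIV" and h = F]) (use j in auto)
  have "((\<lambda>m. ?u m *\<^sub>R (\<Sum>k\<le>m j. g k *\<^sub>R c (m(j := m j - k)))) has_sum
      inverse (\<beta> + y j) *\<^sub>R f y) ?M"
  proof (rule has_sum_SigmaD[OF S])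
    fix m assume "m \<in> ?M"
    have u: "y j ^ k * ?u (m(j := m j - k)) = ?u m" if "k \<le> m j" for k
    proof -
      have "?u (m(j := m j - k)) = y j ^ (m j - k) * (\<Prod>i\<in>{..<n} - {j}. y i ^ m i)"
        using j by (subst prod.remove[of _ j]) (auto intro!: arg_cong2[where f = "(*)"] prod.cong)
      moreover have "?u m = y j ^ m j * (\<Prod>i\<in>{..<n} - {j}. y i ^ m i)"
        using j by (subst prod.remove[of _ j]) auto
      moreover have "y j ^ m j = y j ^ k * y j ^ (m j - k)"
        using that by (simp flip: power_add)
      ultimately show ?thesis by simp
    qed
    have "?u m *\<^sub>R (\<Sum>k\<le>m j. g k *\<^sub>R c (m(j := m j - k))) = (\<Sum>k\<le>m j. F (m(j := m j - k), k))"
      unfolding scaleR_sum_right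
    proof (rule sum.cong[OF refl])
      fix k assume "k \<in> {..m j}"
      then have "?u m = y j ^ k * ?u (m(j := m j - k))" using u by simp
      then show "?u m *\<^sub>R g k *\<^sub>R c (m(j := m j - k)) = F (m(j := m j - k), k)"
        by (simp only: F_def prod.case scaleR_scaleR mult_ac)
    qed
    then show "((\<lambda>k. case (m, k) of (m, k) \<Rightarrow> F (m(j := m j - k), k)) has_sum
        ?u m *\<^sub>R (\<Sum>k\<le>m j. g k *\<^sub>R c (m(j := m j - k)))) {..m j}"
      by (simp add: has_sum_finiteI)
  qed
  then show "((\<lambda>m. ?u m *\<^sub>R (\<Sum>k\<le>m j. (inverse \<beta> * (- inverse \<beta>) ^ k) *\<^sub>R c (m(j := m j - k)))) has_sum
      inverse (\<beta> + y j) *\<^sub>R f y) ?M"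
    by (simp only: g_def)
qed

section \<open>Analyticity of the quotient, and both regularity classes together\<close>

lemma analytic_on_dom_iff:
  "analytic_on_dom v t0 \<tau> D G \<longleftrightarrow> (\<forall>p\<in>D. \<exists>r>0. \<exists>c.
     multi_series (ncoord t0 \<tau>) r c (\<lambda>y. G (shift v t0 \<tau> y p)) \<and>
     (\<forall>y. (\<forall>i. i \<ge> ncoord t0 \<tau> \<longrightarrow> y i = 0) \<and> (\<forall>i<ncoord t0 \<tau>. \<bar>y i\<bar> < r) \<longrightarrow> shift v t0 \<tau> y p \<in> D))"
  unfolding analytic_on_dom_def multi_series_def 
  by (intro ball_cong refl ex_cong1 conj_cong) blast

lemma analytic_on_dom_has_pdir:
  fixes G :: "_ \<Rightarrow> 'b::euclidean_space"
  assumes "analytic_on_dom v t0 \<tau> D G" "p \<in> D" "i < ncoord t0 \<tau>"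
  shows "((\<lambda>r. G (cshift v t0 \<tau> i r p)) has_vector_derivative pdir v t0 \<tau> i G p) (at 0)"
proof -
  from assms(1,2) obtain r c where r: "r > 0"
      "multi_series (ncoord t0 \<tau>) r c (\<lambda>y. G (shift v t0 \<tau> y p))"
    unfolding analytic_on_dom_iff by blast
  from multi_series_has_vector_derivative[OF r(2,1) assms(3)] show ?thesis
    unfolding pdir_def by (auto intro: vector_derivative_works[THEN iffD1] differentiableI_vector)
qed

lemma regular_has_pdir:
  fixes G :: "_ \<Rightarrow> 'b::euclidean_space"
  assumes "regular p v t0 \<tau> D G" "q \<in> D" "i < ncoord t0 \<tau>"
  shows "((\<lambda>r. G (cshift v t0 \<tau> i r q)) has_vector_derivative pdir v t0 \<tau> i G q) (at 0)"
proof (cases p)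
  case Cinf
  with assms smooth_on_has_pdir[of v t0 \<tau> D G "[]"] show ?thesis by (simp add: regular_def)
next
  case Comega
  with assms analytic_on_dom_has_pdir[of v t0 \<tau> D G q i] show ?thesis by (auto simp: regular_def)
qed

text \<open>In the analytic case even the zero function needs a radius whose shifts stay inside
  \<open>D\<close>; it is borrowed from \<open>Q\<close>.\<close>

lemma regular_zero:
  fixes Q :: "_ \<Rightarrow> 'b::banach"
  assumes "regular p v t0 \<tau> D Q" "line_open v t0 \<tau> D"
  shows "regular p v t0 \<tau> D (\<lambda>_. 0 :: 'b)"
proof (cases p)
  case Cinf
  have "smooth_on v t0 \<tau> D (\<lambda>_. 0 :: 'b)"
    by (rule smooth_on_coinduct[OF assms(2), where C = "\<lambda>H. H = (\<lambda>_. 0)"]) auto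
  with Cinf show ?thesis by (simp add: regular_def)
next
  case Comega
  have "analytic_on_dom v t0 \<tau> D (\<lambda>_. 0 :: 'b)"
    unfolding analytic_on_dom_iff
  proof
    fix q assume "q \<in> D"
    with assms(1) Comega obtain r c where r: "r > 0"
      "\<forall>y. (\<forall>i. i \<ge> ncoord t0 \<tau> \<longrightarrow> y i = 0) \<and> (\<forall>i<ncoord t0 \<tau>. \<bar>y i\<bar> < r) \<longrightarrow> shift v t0 \<tau> y q \<in> D"
      by (auto simp: regular_def analytic_on_dom_iff)
    moreover have "multi_series (ncoord t0 \<tau>) r (\<lambda>_. 0 :: 'b) (\<lambda>y. 0)"
      by (simp add: multi_series_def)
    ultimately show "\<exists>r>0. \<exists>c. multi_series (ncoord t0 \<tau>) r c (\<lambda>y. 0 :: 'b) \<and>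
     (\<forall>y. (\<forall>i. i \<ge> ncoord t0 \<tau> \<longrightarrow> y i = 0) \<and> (\<forall>i<ncoord t0 \<tau>. \<bar>y i\<bar> < r) \<longrightarrow> shift v t0 \<tau> y q \<in> D)"
      by blast
  qed
  with Comega show ?thesis by (simp add: regular_def)
qed

lemma cshift_shift:
  assumes "h \<in> {1..\<tau>}" "y (t0 + h) = 0"
  shows "cshift v t0 \<tau> (t0 + h) s (shift v t0 \<tau> y p) = shift v t0 \<tau> (y(t0 + h := s)) p"
proof -
  have "(\<Sum>i\<le>t0. (y(t0 + h := s)) i *\<^sub>R v i) = (\<Sum>i\<le>t0. y i *\<^sub>R v i)"
    using assms(1) by (intro sum.cong) auto
  then show ?thesis
    unfolding cshift_beta[OF assms(1)] using assms by (auto simp: shift_def fun_eq_iff)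
qed

lemma multi_series_mono: "multi_series n r c f \<Longrightarrow> r' \<le> r \<Longrightarrow> multi_series n r' c f"
  unfolding multi_series_def by (meson order_less_le_trans)

lemma multi_series_cong:
  assumes "multi_series n r c f"
    and "\<And>y. (\<forall>i. i \<ge> n \<longrightarrow> y i = 0) \<Longrightarrow> (\<forall>i<n. \<bar>y i\<bar> < r) \<Longrightarrow> f y = g y"
  shows "multi_series n r c g"
  unfolding multi_series_def
proof (intro allI impI)
  fix y assume y: "(\<forall>i. i \<ge> n \<longrightarrow> y i = 0) \<and> (\<forall>i<n. \<bar>y i\<bar> < r)"
  then have "f y = g y" using assms(2) by simp
  show "((\<lambda>m. (\<Prod>i<n. y i ^ m i) *\<^sub>R c m) has_sum g y) {m. \<forall>i. i \<ge> n \<longrightarrow> m i = 0}"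
    unfolding \<open>f y = g y\<close>[symmetric] using assms(1) y unfolding multi_series_def by blast
qed

text \<open>In the increment \<open>y\<close>, \<beta>_1 reads \<open>snd p 1 + y (t0 + 1)\<close>:
  a bare coordinate if the centre lies on the hyperplane, an affine function with nonzero constant
  term otherwise. The two division lemmas cover these cases.\<close>

lemma analytic_on_dom_bquot:
  fixes Q :: "_ \<Rightarrow> 'b::euclidean_space"
  assumes Q: "analytic_on_dom v t0 \<tau> D Q" and \<tau>: "\<tau> \<ge> 1"
    and odd: "\<And>q. q \<in> D \<Longrightarrow> snd q 1 = 0 \<Longrightarrow> Q q = 0"
  shows "analytic_on_dom v t0 \<tau> D (bquot v t0 \<tau> Q)"
  unfolding analytic_on_dom_iff
proof
  fix p assume p: "p \<in> D"
  let ?n = "ncoord t0 \<tau>"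
  let ?box = "\<lambda>r y. (\<forall>i. i \<ge> ?n \<longrightarrow> y i = 0) \<and> (\<forall>i<?n. \<bar>y i\<bar> < r)"
  have j: "t0 + 1 < ?n" using \<tau> by (simp add: ncoord_def)
  from Q p obtain r c where r: "r > 0" and
      c: "multi_series ?n r c (\<lambda>y. Q (shift v t0 \<tau> y p))" and
      D: "\<And>y. ?box r y \<Longrightarrow> shift v t0 \<tau> y p \<in> D"
    unfolding analytic_on_dom_iff by blast
  have b1: "snd (shift v t0 \<tau> y p) 1 = snd p 1 + y (t0 + 1)" for y
    using \<tau> by (simp add: shift_def)
  show "\<exists>r>0. \<exists>c. multi_series ?n r c (\<lambda>y. bquot v t0 \<tau> Q (shift v t0 \<tau> y p)) \<and>
      (\<forall>y. ?box r y \<longrightarrow> shift v t0 \<tau> y p \<in> D)"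
  proof (cases "snd p 1 = 0")
    case True
    have "multi_series ?n r (\<lambda>m. c (m(t0 + 1 := Suc (m (t0 + 1)))))
        (\<lambda>y. bquot v t0 \<tau> Q (shift v t0 \<tau> y p))"
    proof (rule multi_series_divide_coordinate[OF c r j])
      fix y assume y: "\<forall>i. i \<ge> ?n \<longrightarrow> y i = 0" "\<forall>i<?n. \<bar>y i\<bar> < r"
      show "y (t0 + 1) = 0 \<Longrightarrow> Q (shift v t0 \<tau> y p) = 0"
        using D y True by (intro odd) (auto simp: b1[unfolded One_nat_def])
      have "pdir v t0 \<tau> (t0 + 1) Q (shift v t0 \<tau> y p) =
          vector_derivative (\<lambda>s. Q (shift v t0 \<tau> (y(t0 + 1 := s)) p)) (at 0)" if "y (t0 + 1) = 0"
        unfolding pdir_def using \<tau> that by (subst cshift_shift) auto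
      then show "bquot v t0 \<tau> Q (shift v t0 \<tau> y p) =
          (if y (t0 + 1) \<noteq> 0 then inverse (y (t0 + 1)) *\<^sub>R Q (shift v t0 \<tau> y p)
           else vector_derivative (\<lambda>s. Q (shift v t0 \<tau> (y(t0 + 1 := s)) p)) (at 0))"
        unfolding bquot_def b1 True by simp
    qed
    with r D show ?thesis by blast
  next
    case False
    \<comment> \<open>The smaller radius keeps \<beta>_1 away from 0 on the whole box.\<close>
    define r' where "r' = min r \<bar>snd p 1\<bar>"
    have r': "r' > 0" "r' \<le> r" "r' \<le> \<bar>snd p 1\<bar>" using r False by (auto simp: r'_def)
    note multi_series_divide_affine[OF multi_series_mono[OF c r'(2)] j False r'(3)]
    note S = multi_series_cong[OF this, where g = "\<lambda>y. bquot v t0 \<tau> Q (shift v t0 \<tau> y p)"]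
    have "\<exists>c. multi_series ?n r' c (\<lambda>y. bquot v t0 \<tau> Q (shift v t0 \<tau> y p))"
    proof (rule exI, rule S)
      fix y assume y: "\<forall>i. i \<ge> ?n \<longrightarrow> y i = 0" "\<forall>i<?n. \<bar>y i\<bar> < r'"
      have "\<bar>y (t0 + 1)\<bar> < r'" using y j by blast
      then have "snd p 1 + y (t0 + 1) \<noteq> 0" using r'(3) by linarith
      then show "inverse (snd p 1 + y (t0 + 1)) *\<^sub>R Q (shift v t0 \<tau> y p) =
          bquot v t0 \<tau> Q (shift v t0 \<tau> y p)"
        unfolding bquot_def b1 by simp
    qed
    moreover have "shift v t0 \<tau> y p \<in> D" if "?box r' y" for y
      using that r'(2) by (intro D) force
    ultimately show ?thesis using r'(1) by blast
  qed
qed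

lemma (in frame) regular_bquot:
  fixes Q :: "'a \<times> (nat \<Rightarrow> real) \<Rightarrow> 'b::euclidean_space"
  assumes "openin (top_of_set (Rlm v 0 t0 \<times> Rtau \<tau>)) D" "t0 \<le> N" "\<tau> \<ge> 1"
    and "regular p v t0 \<tau> D Q" "\<And>q. q \<in> D \<Longrightarrow> snd q 1 = 0 \<Longrightarrow> Q q = 0"
  shows "regular p v t0 \<tau> D (bquot v t0 \<tau> Q)"
proof (cases p)
  case Cinf
  then have "smooth_on v t0 \<tau> D Q" using assms(4) by (simp add: regular_def)
  from smooth_on_bquot[OF assms(1-3) this assms(5)] Cinf show ?thesis by (simp add: regular_def)
next
  case Comega
  then have "analytic_on_dom v t0 \<tau> D Q" using assms(4) by (simp add: regular_def)
  from analytic_on_dom_bquot[OF this assms(3,5)] Comega show ?thesis by (simp add: regular_def)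
qed

section \<open>Units, sign changes and the induced function\<close>

lemma Rlm_mono: "l' \<le> l \<Longrightarrow> m \<le> m' \<Longrightarrow> Rlm v l m \<subseteq> Rlm v l' m'"
  unfolding Rlm_def by (intro span_mono image_mono) auto

context frame
begin

text \<open>The expression is bilinear in \<open>a\<close> and \<open>b\<close>, so two span
  inductions reduce it to pairs of basis units, where it combines orthonormality with the square and
  anticommutation rules.\<close>

lemma clifford:
  assumes "a \<in> Rlm v 1 N" "b \<in> Rlm v 1 N"
  shows "a * b + b * a + (2 * inner a b) *\<^sub>R 1 = 0"
proof -
  have base: "v i * v k + v k * v i + (2 * inner (v i) (v k)) *\<^sub>R 1 = 0"
    if "i \<in> {1..N}" "k \<in> {1..N}" for i k
  proof (cases "i = k")
    case True
    with that show ?thesis using square[of k] by (simp add: orthonormal scaleR_2)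
  next
    case False
    with that show ?thesis using anticommute[of i k] by (simp add: orthonormal)
  qed
  have one: "v i * b + b * v i + (2 * inner (v i) b) *\<^sub>R 1 = 0" if i: "i \<in> {1..N}" for i
    using assms(2) unfolding Rlm_def
  proof (induction rule: span_induct)
    case base
    have "linear (\<lambda>b. v i * b + b * v i + (2 * inner (v i) b) *\<^sub>R 1)"
      by (intro linearI) (simp_all add: algebra_simps inner_add_right)
    then show ?case by (rule linear_subspace_kernel)
  next
    case (step x)
    then show ?case using base[OF i] by auto
  qed
  show ?thesis
    using assms(1) unfolding Rlm_def
  proof (induction rule: span_induct)
    case base
    have "linear (\<lambda>a. a * b + b * a + (2 * inner a b) *\<^sub>R 1)"
      by (intro linearI) (simp_all add: algebra_simps inner_add_left)
    then show ?case by (rule linear_subspace_kernel)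
  next
    case (step x)
    then show ?case using one by auto
  qed
qed

lemma Rlm_orthogonal:
  assumes "a \<in> Rlm v l m" "b \<in> Rlm v l' m'" "m < l'" "m' \<le> N"
  shows "inner a b = 0"
proof (cases "l' \<le> m'")
  case True
  then have m: "m \<le> N" using assms by simp
  have "inner a b = inner (\<Sum>s\<in>{l..m}. inner (v s) a *\<^sub>R v s) (\<Sum>s\<in>{l'..m'}. inner (v s) b *\<^sub>R v s)"
    using Rlm_expansion[OF assms(1) m] Rlm_expansion[OF assms(2,4)] by simp
  also have "\<dots> = 0"
    unfolding inner_sum_left inner_sum_right
    by (intro sum.neutral ballI) (use assms m in \<open>auto simp: orthonormal\<close>)
  finally show ?thesis .
next
  case False
  with assms(2) show ?thesis by (simp add: Rlm_def)
qed

lemma Rlm_anticommute: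
  assumes "a \<in> Rlm v l m" "b \<in> Rlm v l' m'" "1 \<le> l" "m < l'" "m' \<le> N"
  shows "a * b = - (b * a)"
proof (cases "l' \<le> m'")
  case True
  with assms have "a \<in> Rlm v 1 N" "b \<in> Rlm v 1 N"
    using Rlm_mono[of 1 l m N v] Rlm_mono[of 1 l' m' N v] by auto
  from clifford[OF this] Rlm_orthogonal[OF assms(1,2,4,5)] show ?thesis
    by (simp add: eq_neg_iff_add_eq_0)
next
  case False
  with assms(2) show ?thesis by (simp add: Rlm_def)
qed

lemma Rlm_square:
  assumes "a \<in> Rlm v l m" "1 \<le> l" "m \<le> N"
  shows "a * a = - ((norm a)\<^sup>2 *\<^sub>R 1)"
proof -
  have "a \<in> Rlm v 1 N" using assms Rlm_mono[of 1 l m N v] by auto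
  from clifford[OF this this] have "2 *\<^sub>R (a * a + (norm a)\<^sup>2 *\<^sub>R 1) = 0"
    by (simp add: scaleR_add_right scaleR_2 dot_square_norm)
  then show ?thesis by (simp add: eq_neg_iff_add_eq_0)
qed

lemma Slm_square: "a \<in> Slm v l m \<Longrightarrow> 1 \<le> l \<Longrightarrow> m \<le> N \<Longrightarrow> a * a = - 1"
  using Rlm_square[of a l m] by (simp add: Slm_def)

lemma v_in_Slm: "i \<in> {l..m} \<Longrightarrow> m \<le> N \<Longrightarrow> v i \<in> Slm v l m"
  unfolding Slm_def Rlm_def by (auto intro: span_base simp: norm_eq_sqrt_inner orthonormal)

end

section \<open>Ordered products of units\<close>

lemma JK_cong:
  assumes "\<And>h. h \<in> K \<Longrightarrow> J h = J' h" "finite K"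
  shows "JK J K = JK J' K"
  unfolding JK_def using assms by (intro arg_cong[where f = prod_list] map_cong) auto

lemma JK_scaleR:
  fixes J :: "nat \<Rightarrow> 'a::real_algebra_1"
  assumes "finite K"
  shows "JK (\<lambda>h. \<epsilon> h *\<^sub>R J h) K = (\<Prod>h\<in>K. \<epsilon> h) *\<^sub>R JK J K"
proof -
  have "prod_list (map (\<lambda>h. \<epsilon> h *\<^sub>R J h) xs) = prod_list (map \<epsilon> xs) *\<^sub>R prod_list (map J xs)" for xs
    by (induction xs) auto
  moreover have "prod_list (map \<epsilon> (sorted_list_of_set K)) = (\<Prod>h\<in>K. \<epsilon> h)"
    using prod.distinct_set_conv_list[of "sorted_list_of_set K" \<epsilon>] assms by simp
  ultimately show ?thesis unfolding JK_def by simp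
qed

text \<open>Multiplying on the left by J_h undoes J_h up to sign, so the factors are stripped from
  the product one by one.\<close>

lemma JK_cancel:
  fixes J :: "nat \<Rightarrow> 'a::real_algebra_1"
  assumes "\<And>h. h \<in> K \<Longrightarrow> J h * J h = - 1" "finite K" "JK J K * a = 0"
  shows "a = 0"
proof -
  have "a = 0" if "prod_list (map J xs) * a = 0" "\<And>h. h \<in> set xs \<Longrightarrow> J h * J h = - 1" for xs
    using that
  proof (induction xs)
    case (Cons h xs)
    have "J h * (J h * (prod_list (map J xs) * a)) = 0"
      using Cons.prems(1) by (simp add: mult.assoc)
    then have "(J h * J h) * (prod_list (map J xs) * a) = 0" by (simp only: mult.assoc)
    then have "prod_list (map J xs) * a = 0" using Cons.prems(2)[of h] by simp
    then show ?case using Cons by auto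
  qed simp
  from this[of "sorted_list_of_set K"] assms show ?thesis by (simp add: JK_def)
qed

lemma sorted_list_of_set_Suc_image:
  assumes "finite H"
  shows "sorted_list_of_set (Suc ` H) = map Suc (sorted_list_of_set H)"
  by (rule sorted_distinct_set_unique)
    (use assms in \<open>auto simp: sorted_map distinct_map intro: sorted_wrt_mono_rel[of _ "(\<le>)"]\<close>)

lemma JK_Suc_image:
  assumes "finite H"
  shows "JK J (Suc ` H) = JK (\<lambda>h. J (Suc h)) H"
  using assms by (simp add: JK_def sorted_list_of_set_Suc_image o_def)

text \<open>The index 1 is the smallest, so J_1 heads the ordered product; carrying it to the far
  right passes \<open>card H\<close> anticommuting units. There it can be absorbed into the
  coefficient that follows.\<close>

lemma JK_insert_one:
  fixes J :: "nat \<Rightarrow> 'a::real_algebra_1"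
  assumes "finite H" "0 \<notin> H" "\<And>h. h \<in> H \<Longrightarrow> J 1 * J (Suc h) = - (J (Suc h) * J 1)"
  shows "JK J (insert 1 (Suc ` H)) = (-1) ^ card H *\<^sub>R (JK (\<lambda>h. J (Suc h)) H * J 1)"
proof -
  have "sorted_list_of_set (insert 1 (Suc ` H)) = 1 # map Suc (sorted_list_of_set H)"
  proof -
    have "Min (insert 1 (Suc ` H)) = 1" using assms by (intro Min_eqI) auto
    moreover have "insert 1 (Suc ` H) - {1} = Suc ` H" using assms by auto
    ultimately show ?thesis
      using assms sorted_list_of_set_nonempty[of "insert 1 (Suc ` H)"]
      by (simp only: sorted_list_of_set_Suc_image finite_insert finite_imageI) simp
  qed
  moreover have comm: "J 1 * prod_list (map (\<lambda>h. J (Suc h)) xs) =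
      (-1) ^ length xs *\<^sub>R (prod_list (map (\<lambda>h. J (Suc h)) xs) * J 1)"
    if "\<And>h. h \<in> set xs \<Longrightarrow> J 1 * J (Suc h) = - (J (Suc h) * J 1)" for xs
    using that
  proof (induction xs)
    case (Cons x xs)
    let ?P = "prod_list (map (\<lambda>h. J (Suc h)) xs)"
    have "J 1 * (J (Suc x) * ?P) = - (J (Suc x) * (J 1 * ?P))"
      using Cons.prems[of x] by (simp flip: mult.assoc)
    also have "\<dots> = - (J (Suc x) * ((-1) ^ length xs *\<^sub>R (?P * J 1)))"
      using Cons by simp
    finally show ?case by (simp add: mult.assoc)
  qed simp
  moreover have "J 1 * prod_list (map (\<lambda>h. J (Suc h)) (sorted_list_of_set H)) =
      (-1) ^ card H *\<^sub>R (prod_list (map (\<lambda>h. J (Suc h)) (sorted_list_of_set H)) * J 1)"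
    using comm[of "sorted_list_of_set H"] assms by simp
  ultimately show ?thesis
    by (simp only: JK_def list.map prod_list.Cons map_map o_def)
qed

text \<open>The coefficient of \<open>J\<^sub>H\<close> when a sum over \<open>K \<subseteq> {1..\<tau>}\<close> is rewritten, by moving \<open>J\<^sub>1\<close> to the
  right of the other units, as a sum over subsets of \<open>{2..\<tau>}\<close>; the latter are re-indexed by
  \<open>H \<subseteq> {1..\<tau> - 1}\<close>.\<close>

definition merge_unit :: "'a::real_algebra_1 \<Rightarrow> (nat set \<Rightarrow> 'a) \<Rightarrow> nat set \<Rightarrow> 'a" where
  "merge_unit J1 A H = A (Suc ` H) + (-1) ^ card H *\<^sub>R (J1 * A (insert 1 (Suc ` H)))"

lemma Pow_Suc_split:
  "Pow {1..Suc n} = (\<lambda>H. Suc ` H) ` Pow {1..n} \<union> (\<lambda>H. insert 1 (Suc ` H)) ` Pow {1..n}"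
proof (intro equalityI subsetI)
  fix K assume K: "K \<in> Pow {1..Suc n}"
  define H where "H = {h \<in> {1..n}. Suc h \<in> K}"
  have "Suc ` H = K - {1}"
  proof (intro equalityI subsetI)
    fix k assume k: "k \<in> K - {1}"
    then obtain h where "k = Suc h" "h \<in> {1..n}" using K by (cases k) force+
    with k show "k \<in> Suc ` H" by (auto simp: H_def)
  qed (auto simp: H_def)
  then have "K = Suc ` H \<or> K = insert 1 (Suc ` H)" by auto
  moreover have "Suc ` H \<in> (\<lambda>H. Suc ` H) ` Pow {1..n}"
    "insert 1 (Suc ` H) \<in> (\<lambda>H. insert 1 (Suc ` H)) ` Pow {1..n}"
    by (rule imageI, simp add: H_def subset_iff)+
  ultimately show "K \<in> (\<lambda>H. Suc ` H) ` Pow {1..n} \<union> (\<lambda>H. insert 1 (Suc ` H)) ` Pow {1..n}"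
    by (elim disjE) (simp_all only: UnI1 UnI2)
qed auto

lemma sum_JK_split:
  fixes J :: "nat \<Rightarrow> 'a::real_algebra_1"
  assumes "\<And>h. h \<in> {1..n} \<Longrightarrow> J 1 * J (Suc h) = - (J (Suc h) * J 1)"
  shows "(\<Sum>K\<in>Pow {1..Suc n}. JK J K * A K) =
    (\<Sum>H\<in>Pow {1..n}. JK (\<lambda>h. J (Suc h)) H * merge_unit (J 1) A H)"
proof -
  have fin: "finite H" "0 \<notin> H" if "H \<in> Pow {1..n}" for H
    using that by (auto intro: finite_subset)
  have inj: "inj_on (\<lambda>H. Suc ` H) (Pow {1..n})" "inj_on (\<lambda>H. insert 1 (Suc ` H)) (Pow {1..n})"
    using fin(2) by (auto simp: inj_on_def inj_image_eq_iff insert_eq_iff)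
      (metis (no_types, lifting) One_nat_def insert_ident inj_image_eq_iff inj_Suc imageE Suc_inject)+
  have "(\<Sum>K\<in>Pow {1..Suc n}. JK J K * A K) =
      (\<Sum>K\<in>(\<lambda>H. Suc ` H) ` Pow {1..n}. JK J K * A K) +
      (\<Sum>K\<in>(\<lambda>H. insert 1 (Suc ` H)) ` Pow {1..n}. JK J K * A K)"
    unfolding Pow_Suc_split using fin(2)
    by (intro sum.union_disjoint) auto
  also have "\<dots> = (\<Sum>H\<in>Pow {1..n}. JK J (Suc ` H) * A (Suc ` H) +
      JK J (insert 1 (Suc ` H)) * A (insert 1 (Suc ` H)))"
    by (simp only: sum.reindex[OF inj(1)] sum.reindex[OF inj(2)] o_def sum.distrib)
  also have "\<dots> = (\<Sum>H\<in>Pow {1..n}. JK (\<lambda>h. J (Suc h)) H * merge_unit (J 1) A H)"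
  proof (rule sum.cong[OF refl])
    fix H assume H: "H \<in> Pow {1..n}"
    have "JK J (insert 1 (Suc ` H)) = (-1) ^ card H *\<^sub>R (JK (\<lambda>h. J (Suc h)) H * J 1)"
      by (rule JK_insert_one[OF fin[OF H]]) (use H assms in auto)
    then show "JK J (Suc ` H) * A (Suc ` H) + JK J (insert 1 (Suc ` H)) * A (insert 1 (Suc ` H)) =
        JK (\<lambda>h. J (Suc h)) H * merge_unit (J 1) A H"
      by (simp add: merge_unit_def JK_Suc_image[OF fin(1)[OF H]] distrib_left mult.assoc)
  qed
  finally show ?thesis .
qed

text \<open>Linear independence of the characters of the group of sign changes.\<close>

lemma sign_sum_eq_0:
  fixes a :: "nat set \<Rightarrow> 'a::real_vector"
  assumes "finite X" "H \<subseteq> X"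
    and "\<And>\<epsilon>. (\<And>h. \<epsilon> h \<in> {1, - 1}) \<Longrightarrow> (\<Sum>H\<in>Pow X. (\<Prod>h\<in>H. \<epsilon> h) *\<^sub>R a H) = 0"
  shows "a H = 0"
  using assms
proof (induction X arbitrary: a H rule: finite_induct)
  case empty
  then show ?case using empty.prems(2)[of "\<lambda>_. 1"] by simp
next
  case (insert x X)
  \<comment> \<open>Splitting off the sign \<open>s\<close> at \<open>x\<close> leaves a character
    sum over \<open>X\<close> for each value of \<open>s\<close>. The induction hypothesis for s = 1
    and s = -1 kills both the sum and the difference of \<open>a H\<close> and
    \<open>a (insert x H)\<close>.\<close>
  have key: "(\<Sum>H\<in>Pow X. (\<Prod>h\<in>H. \<epsilon> h) *\<^sub>R (a H + s *\<^sub>R a (insert x H))) = 0"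
    if \<epsilon>: "\<And>h. \<epsilon> h \<in> {1, - 1}" and s: "s \<in> {1, - 1}" for \<epsilon> s
  proof -
    let ?\<epsilon> = "\<epsilon>(x := s)"
    have inj: "inj_on (insert x) (Pow X)" using insert(2) by (auto simp: inj_on_def)
    have "0 = (\<Sum>H\<in>Pow (insert x X). (\<Prod>h\<in>H. ?\<epsilon> h) *\<^sub>R a H)"
      using \<epsilon> s by (intro insert.prems(2)[symmetric]) auto
    also have "\<dots> = (\<Sum>H\<in>Pow X. (\<Prod>h\<in>H. ?\<epsilon> h) *\<^sub>R a H) + (\<Sum>H\<in>insert x ` Pow X. (\<Prod>h\<in>H. ?\<epsilon> h) *\<^sub>R a H)"
      unfolding Pow_insert using insert(1,2) by (intro sum.union_disjoint) auto
    also have "\<dots> = (\<Sum>H\<in>Pow X. (\<Prod>h\<in>H. ?\<epsilon> h) *\<^sub>R a H + (\<Prod>h\<in>insert x H. ?\<epsilon> h) *\<^sub>R a (insert x H))"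
      by (simp only: sum.reindex[OF inj] o_def sum.distrib)
    also have "\<dots> = (\<Sum>H\<in>Pow X. (\<Prod>h\<in>H. \<epsilon> h) *\<^sub>R (a H + s *\<^sub>R a (insert x H)))"
    proof (rule sum.cong[OF refl])
      fix H assume H: "H \<in> Pow X"
      then have "finite H" "x \<notin> H" using insert(1,2) by (auto intro: finite_subset)
      moreover have "(\<Prod>h\<in>H. ?\<epsilon> h) = (\<Prod>h\<in>H. \<epsilon> h)"
        using \<open>x \<notin> H\<close> by (intro prod.cong) auto
      ultimately show "(\<Prod>h\<in>H. ?\<epsilon> h) *\<^sub>R a H + (\<Prod>h\<in>insert x H. ?\<epsilon> h) *\<^sub>R a (insert x H) =
          (\<Prod>h\<in>H. \<epsilon> h) *\<^sub>R (a H + s *\<^sub>R a (insert x H))"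
        by (simp add: scaleR_add_right mult.commute)
    qed
    finally show ?thesis by simp
  qed
  have "a H + 1 *\<^sub>R a (insert x H) = 0" "a H + (- 1) *\<^sub>R a (insert x H) = 0" if "H \<subseteq> X" for H
    using insert.IH[OF that, of "\<lambda>H. a H + 1 *\<^sub>R a (insert x H)"] key[of _ 1]
      insert.IH[OF that, of "\<lambda>H. a H + (- 1) *\<^sub>R a (insert x H)"] key[of _ "- 1"] by auto
  then have zero: "a H = 0" "a (insert x H) = 0" if "H \<subseteq> X" for H
    using that by (force simp: add_eq_0_iff2 scaleR_2[symmetric] simp flip: scaleR_2)+
  show ?case
  proof (cases "x \<in> H")
    case True
    then have "H = insert x (H - {x})" "H - {x} \<subseteq> X" using insert.prems(1) by auto
    then show ?thesis using zero(2)[of "H - {x}"] by simp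
  next
    case False
    then show ?thesis using zero(1) insert.prems(1) by auto
  qed
qed

text \<open>What well-definedness of \<open>ind\<close> asks of a domain; it is checked for
  \<open>D\<close> with the given steps and for \<open>Dtil\<close> with the shortened ones.\<close>

definition reflection_invariant :: "(nat \<Rightarrow> 'a::real_normed_vector) \<Rightarrow> (nat \<Rightarrow> nat) \<Rightarrow> nat
    \<Rightarrow> ('a \<times> (nat \<Rightarrow> real)) set \<Rightarrow> bool" where
  "reflection_invariant v t \<tau> D \<longleftrightarrow> D \<subseteq> Rlm v 0 (t 0) \<times> Rtau \<tau> \<and>
     (\<forall>\<alpha> \<beta> h. (\<alpha>, \<beta>) \<in> D \<and> h \<in> {1..\<tau>} \<longrightarrow> (\<alpha>, flip h \<beta>) \<in> D)"

lemma stem_signs: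
  assumes D: "reflection_invariant v t \<tau> D" and "(\<alpha>, \<beta>) \<in> D" and \<epsilon>: "\<And>h. \<epsilon> h \<in> {1, - 1}"
  shows "(\<alpha>, \<lambda>h. \<epsilon> h * \<beta> h) \<in> D"
    and "is_stem \<tau> D F \<Longrightarrow> K \<subseteq> {1..\<tau>} \<Longrightarrow>
      F K (\<alpha>, \<lambda>h. \<epsilon> h * \<beta> h) = (\<Prod>h\<in>K. \<epsilon> h) *\<^sub>R F K (\<alpha>, \<beta>)"
proof -
  \<comment> \<open>The sign pattern restricted to \<open>S\<close>. Enlarging \<open>S\<close> by
    one index amounts to at most one reflection, which gives the induction.\<close>
  define e where "e S h = (if h \<in> S then \<epsilon> h else 1)" for S h
  have step: "(\<lambda>h. e (insert x S) h * \<beta> h) =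
      (if \<epsilon> x = 1 then (\<lambda>h. e S h * \<beta> h) else flip x (\<lambda>h. e S h * \<beta> h))" if "x \<notin> S" for x S
    using \<epsilon>[of x] that by (auto simp: e_def flip_def fun_eq_iff)
  have closed: "(\<alpha>, \<lambda>h. e S h * \<beta> h) \<in> D" if "finite S" "S \<subseteq> {1..\<tau>}" for S
    using that
  proof induction
    case empty
    then show ?case using assms by (simp add: e_def)
  next
    case (insert x S)
    then show ?case using D unfolding step[OF insert(2)] reflection_invariant_def by auto
  qed
  have "\<beta> h = 0" if "h \<notin> {1..\<tau>}" for h
    using that assms by (auto simp: reflection_invariant_def Rtau_def)
  then have all: "(\<lambda>h. e {1..\<tau>} h * \<beta> h) = (\<lambda>h. \<epsilon> h * \<beta> h)"
    by (auto simp: e_def fun_eq_iff)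
  show "(\<alpha>, \<lambda>h. \<epsilon> h * \<beta> h) \<in> D" using closed[of "{1..\<tau>}"] all by simp
  assume F: "is_stem \<tau> D F" and K: "K \<subseteq> {1..\<tau>}"
  have "F K (\<alpha>, \<lambda>h. e S h * \<beta> h) = (\<Prod>h\<in>K. e S h) *\<^sub>R F K (\<alpha>, \<beta>)" if "finite S" "S \<subseteq> {1..\<tau>}" for S
    using that
  proof induction
    case empty
    then show ?case by (simp add: e_def)
  next
    case (insert x S)
    have fin: "finite K" using K by (rule finite_subset) simp
    have eq: "e (insert x S) h = e S h" if "h \<noteq> x" for h using that by (auto simp: e_def)
    have *: "(\<Prod>h\<in>K. e (insert x S) h) = (if x \<in> K then \<epsilon> x * (\<Prod>h\<in>K. e S h) else (\<Prod>h\<in>K. e S h))"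
    proof (cases "x \<in> K")
      case True
      have "(\<Prod>h\<in>K - {x}. e (insert x S) h) = (\<Prod>h\<in>K - {x}. e S h)"
        by (intro prod.cong) (auto simp: eq)
      with True insert(2) show ?thesis
        by (simp add: prod.remove[OF fin True] e_def[of S x] e_def[of "insert x S" x])
    next
      case False
      then have "(\<Prod>h\<in>K. e (insert x S) h) = (\<Prod>h\<in>K. e S h)"
        by (intro prod.cong refl eq) auto
      with False show ?thesis by simp
    qed
    have "F K (\<alpha>, flip x (\<lambda>h. e S h * \<beta> h)) =
        (if x \<in> K then - F K (\<alpha>, \<lambda>h. e S h * \<beta> h) else F K (\<alpha>, \<lambda>h. e S h * \<beta> h))"
      using F K insert closed[of S] unfolding is_stem_def by auto
    then show ?case
      using insert \<epsilon>[of x] unfolding step[OF insert(2)] * by auto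
  qed
  from this[OF finite_atLeastAtMost order_refl]
  have "F K (\<alpha>, \<lambda>h. \<epsilon> h * \<beta> h) = (\<Prod>h\<in>K. e {1..\<tau>} h) *\<^sub>R F K (\<alpha>, \<beta>)"
    by (simp only: all)
  also have "(\<Prod>h\<in>K. e {1..\<tau>} h) = (\<Prod>h\<in>K. \<epsilon> h)"
    using K by (intro prod.cong) (auto simp: e_def)
  finally show "F K (\<alpha>, \<lambda>h. \<epsilon> h * \<beta> h) = (\<Prod>h\<in>K. \<epsilon> h) *\<^sub>R F K (\<alpha>, \<beta>)" .
qed

lemma stem_zero:
  assumes "is_stem \<tau> D F" "K \<subseteq> {1..\<tau>}" "h \<in> K" "(\<alpha>, \<beta>) \<in> D" "\<beta> h = 0"
  shows "F K (\<alpha>, \<beta>) = 0"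
proof -
  have "flip h \<beta> = \<beta>" using assms(5) by (simp add: flip_def fun_eq_iff)
  moreover have "F K (\<alpha>, flip h \<beta>) = - F K (\<alpha>, \<beta>)"
    using assms unfolding is_stem_def by (metis subsetD)
  ultimately have "F K (\<alpha>, \<beta>) = - F K (\<alpha>, \<beta>)" by simp
  then have "2 *\<^sub>R F K (\<alpha>, \<beta>) = 0" unfolding scaleR_2 by (simp only: eq_neg_iff_add_eq_0)
  then show ?thesis by simp
qed

section \<open>Representations of a point and well-definedness of the induced function\<close>

locale steps_frame = frame +
  fixes t :: "nat \<Rightarrow> nat" and \<tau> :: nat
  assumes steps: "steps N t \<tau>"
begin

lemma t_less: "i < k \<Longrightarrow> k \<le> \<tau> \<Longrightarrow> t i < t k"
proof (induction k)
  case (Suc k)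
  then have "t k < t (Suc k)" using steps by (auto simp: steps_def)
  with Suc show ?case by (cases "i = k") (auto intro: order.strict_trans)
qed simp

lemma t_le: "i \<le> k \<Longrightarrow> k \<le> \<tau> \<Longrightarrow> t i \<le> t k"
  using t_less[of i k] by (cases "i = k") auto

lemma t_le_N: "i \<le> \<tau> \<Longrightarrow> t i \<le> N"
  using t_le[of i \<tau>] steps by (simp add: steps_def)

lemma torus_orthogonal:
  assumes "J \<in> Rlm v (t (h - 1) + 1) (t h)" "J' \<in> Rlm v (t (k - 1) + 1) (t k)"
    and "h \<in> {1..\<tau>}" "k \<in> {1..\<tau>}" "h \<noteq> k"
  shows "inner J J' = 0"
proof (cases "h < k")
  case True
  then have "t h \<le> t (k - 1)" using assms by (intro t_le) auto
  then show ?thesis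
    using Rlm_orthogonal[OF assms(1,2)] t_le_N[of k] assms by auto
next
  case False
  then have "t k \<le> t (h - 1)" using assms by (intro t_le) auto
  then show ?thesis
    using Rlm_orthogonal[OF assms(2,1)] t_le_N[of h] assms by (auto simp: inner_commute)
qed

lemma mirror_orthogonal:
  assumes "\<alpha> \<in> Rlm v 0 (t 0)" "J \<in> Rlm v (t (h - 1) + 1) (t h)" "h \<in> {1..\<tau>}"
  shows "inner \<alpha> J = 0"
proof -
  have "t 0 \<le> t (h - 1)" using assms by (intro t_le) auto
  then show ?thesis using Rlm_orthogonal[OF assms(1,2)] t_le_N[of h] assms by auto
qed

text \<open>The differences lie in mutually orthogonal blocks and sum to 0, so each of them
  vanishes. Only the products \<beta>_h J_h are determined: the sign of J_h is free, and J_h itself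
  is arbitrary where \<beta>_h = 0.\<close>

lemma decomposition_unique:
  assumes \<alpha>: "\<alpha> \<in> Rlm v 0 (t 0)" "\<alpha>' \<in> Rlm v 0 (t 0)"
    and J: "J \<in> torus v t \<tau>" "J' \<in> torus v t \<tau>"
    and eq: "\<alpha> + bJ \<tau> \<beta> J = \<alpha>' + bJ \<tau> \<beta>' J'"
  shows "\<alpha> = \<alpha>'" and "\<And>h. h \<in> {1..\<tau>} \<Longrightarrow> \<beta> h *\<^sub>R J h = \<beta>' h *\<^sub>R J' h"
proof -
  define w where "w h = \<beta> h *\<^sub>R J h - \<beta>' h *\<^sub>R J' h" for h
  have w: "w h \<in> Rlm v (t (h - 1) + 1) (t h)" if "h \<in> {1..\<tau>}" for h
    using J that unfolding w_def torus_def Slm_def Rlm_def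
    by (intro span_diff span_scale) blast+
  have sum: "(\<alpha> - \<alpha>') + (\<Sum>h\<in>{1..\<tau>}. w h) = 0"
    using eq by (simp add: w_def bJ_def sum_subtractf algebra_simps)
  have a: "\<alpha> - \<alpha>' \<in> Rlm v 0 (t 0)" using \<alpha> unfolding Rlm_def by (rule span_diff)
  have w0: "w h = 0" if h: "h \<in> {1..\<tau>}" for h
  proof -
    have "inner (\<alpha> - \<alpha>') (w h) + (\<Sum>k\<in>{1..\<tau>}. inner (w k) (w h)) = 0"
      using arg_cong[OF sum, of "\<lambda>z. inner z (w h)"] by (simp only: inner_add_left inner_sum_left inner_zero_left)
    moreover have "inner (\<alpha> - \<alpha>') (w h) = 0" by (rule mirror_orthogonal[OF a w[OF h] h])
    moreover have "(\<Sum>k\<in>{1..\<tau>}. inner (w k) (w h)) = (\<Sum>k\<in>{1..\<tau>}. if k = h then inner (w k) (w k) else 0)"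
    proof (rule sum.cong[OF refl])
      fix k assume "k \<in> {1..\<tau>}"
      then show "inner (w k) (w h) = (if k = h then inner (w k) (w k) else 0)"
        using torus_orthogonal[OF w w[OF h] _ h, of k] by auto
    qed
    ultimately show ?thesis using h by simp
  qed
  then show "\<And>h. h \<in> {1..\<tau>} \<Longrightarrow> \<beta> h *\<^sub>R J h = \<beta>' h *\<^sub>R J' h" by (simp add: w_def)
  show "\<alpha> = \<alpha>'" using sum w0 by simp
qed

text \<open>The choice in \<open>ind\<close> is harmless. Where \<beta>_h is nonzero, two
  representations differ by a common sign of \<beta>_h and J_h, and the signs from F_K and from J_K
  cancel. Where \<beta>_h = 0 the units are unrelated, but then F_K vanishes for every K containing
  h, by oddness.\<close>

lemma ind_eq:
  assumes D: "reflection_invariant v t \<tau> D" and F: "is_stem \<tau> D F"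
    and p: "(\<alpha>, \<beta>) \<in> D" and J: "J \<in> torus v t \<tau>"
  shows "ind v t \<tau> D F (\<alpha> + bJ \<tau> \<beta> J) = (\<Sum>K\<in>Pow {1..\<tau>}. JK J K * F K (\<alpha>, \<beta>))"
  unfolding ind_def
proof (rule some_equality)
  show "\<exists>\<alpha>' \<beta>' J'. (\<alpha>', \<beta>') \<in> D \<and> J' \<in> torus v t \<tau> \<and> \<alpha> + bJ \<tau> \<beta> J = \<alpha>' + bJ \<tau> \<beta>' J' \<and>
      (\<Sum>K\<in>Pow {1..\<tau>}. JK J K * F K (\<alpha>, \<beta>)) = (\<Sum>K\<in>Pow {1..\<tau>}. JK J' K * F K (\<alpha>', \<beta>'))"
    using p J by blast
next
  fix y assume "\<exists>\<alpha>' \<beta>' J'. (\<alpha>', \<beta>') \<in> D \<and> J' \<in> torus v t \<tau> \<and> \<alpha> + bJ \<tau> \<beta> J = \<alpha>' + bJ \<tau> \<beta>' J' \<and>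
      y = (\<Sum>K\<in>Pow {1..\<tau>}. JK J' K * F K (\<alpha>', \<beta>'))"
  then obtain \<alpha>' \<beta>' J' where p': "(\<alpha>', \<beta>') \<in> D" and J': "J' \<in> torus v t \<tau>"
    and eq: "\<alpha> + bJ \<tau> \<beta> J = \<alpha>' + bJ \<tau> \<beta>' J'"
    and y: "y = (\<Sum>K\<in>Pow {1..\<tau>}. JK J' K * F K (\<alpha>', \<beta>'))" by blast
  have mem: "\<alpha> \<in> Rlm v 0 (t 0)" "\<alpha>' \<in> Rlm v 0 (t 0)" "\<beta> \<in> Rtau \<tau>" "\<beta>' \<in> Rtau \<tau>"
    using D p p' by (auto simp: reflection_invariant_def)
  note u = decomposition_unique[OF mem(1,2) J J' eq]
  \<comment> \<open>The sign relating the two coordinates; it is 1 when both are 0.\<close>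
  define \<epsilon> :: "nat \<Rightarrow> real" where "\<epsilon> h = (if \<beta>' h = \<beta> h then 1 else - 1)" for h
  have \<epsilon>: "\<epsilon> h \<in> {1, - 1}" for h by (simp add: \<epsilon>_def)
  have \<beta>': "\<beta>' = (\<lambda>h. \<epsilon> h * \<beta> h)"
  proof
    fix h
    show "\<beta>' h = \<epsilon> h * \<beta> h"
    proof (cases "h \<in> {1..\<tau>}")
      case True
      then have "norm (J h) = 1" "norm (J' h) = 1" using J J' by (auto simp: torus_def Slm_def)
      then have "\<bar>\<beta> h\<bar> = \<bar>\<beta>' h\<bar>" using arg_cong[OF u(2)[OF True], of norm] by simp
      then show ?thesis by (auto simp: \<epsilon>_def)
    next
      case False
      then show ?thesis using mem by (simp add: Rtau_def)
    qed
  qed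
  have "JK J' K * F K (\<alpha>', \<beta>') = JK J K * F K (\<alpha>, \<beta>)" if K: "K \<in> Pow {1..\<tau>}" for K
  proof -
    have fin: "finite K" using K by (auto intro: finite_subset)
    have F': "F K (\<alpha>', \<beta>') = (\<Prod>h\<in>K. \<epsilon> h) *\<^sub>R F K (\<alpha>, \<beta>)"
      unfolding \<beta>' u(1)[symmetric] by (rule stem_signs(2)[OF D p \<epsilon> F]) (use K in auto)
    show ?thesis
    proof (cases "\<exists>h\<in>K. \<beta> h = 0")
      case True
      then have "F K (\<alpha>, \<beta>) = 0" using stem_zero[OF F _ _ p] K by blast
      with F' show ?thesis by simp
    next
      case False
      have "J' h = \<epsilon> h *\<^sub>R J h" if "h \<in> K" for h
      proof -
        have "\<beta> h *\<^sub>R J h = (\<epsilon> h * \<beta> h) *\<^sub>R J' h" using u(2)[of h] K that \<beta>' by auto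
        then have "\<beta> h *\<^sub>R J h = \<beta> h *\<^sub>R (\<epsilon> h *\<^sub>R J' h)" by (simp add: mult.commute)
        then have "J h = \<epsilon> h *\<^sub>R J' h" using False that by (metis scaleR_left_imp_eq)
        then show ?thesis using \<epsilon>[of h] by auto
      qed
      then have "JK J' K = JK (\<lambda>h. \<epsilon> h *\<^sub>R J h) K" by (intro JK_cong fin) auto
      also have "\<dots> = (\<Prod>h\<in>K. \<epsilon> h) *\<^sub>R JK J K" by (rule JK_scaleR[OF fin])
      finally have "JK J' K * F K (\<alpha>', \<beta>') = ((\<Prod>h\<in>K. \<epsilon> h) * (\<Prod>h\<in>K. \<epsilon> h)) *\<^sub>R (JK J K * F K (\<alpha>, \<beta>))"
        by (simp add: F')
      also have "(\<Prod>h\<in>K. \<epsilon> h) * (\<Prod>h\<in>K. \<epsilon> h) = (\<Prod>h\<in>K. \<epsilon> h * \<epsilon> h)" by (simp add: prod.distrib)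
      also have "\<dots> = 1" by (rule prod.neutral) (simp add: \<epsilon>_def)
      finally show ?thesis by simp
    qed
  qed
  then show "y = (\<Sum>K\<in>Pow {1..\<tau>}. JK J K * F K (\<alpha>, \<beta>))" unfolding y by (rule sum.cong[OF refl])
qed

end

section \<open>The stem function of the correction term\<close>

text \<open>The norm is not assumed submultiplicative; multiplication is bounded because the algebra
  is finite-dimensional.\<close>

lemma bounded_linear_left_mult:
  fixes a :: "'a::{euclidean_space,real_algebra_1}"
  shows "bounded_linear ((*) a)"
  unfolding linear_conv_bounded_linear[symmetric] by (intro linearI) (simp_all add: distrib_left)

lemma bounded_bilinear_mult_euclidean:
  "bounded_bilinear ((*) :: 'a::{euclidean_space,real_algebra_1} \<Rightarrow> 'a \<Rightarrow> 'a)"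
  unfolding bilinear_conv_bounded_bilinear[symmetric] bilinear_def
  by (auto intro!: linearI simp: distrib_left distrib_right)

text \<open>Away from 0 this is the chain rule, the gradient of the norm at x being J. At x = 0 the
  norm is not differentiable, but evenness allows |r| to be replaced by r and forces d = 0, so the
  formula holds whatever J is.\<close>

lemma has_vector_derivative_even_norm:
  fixes x w J :: "'a::real_inner" and \<phi> :: "real \<Rightarrow> 'b::real_normed_vector"
  assumes \<phi>: "(\<phi> has_vector_derivative d) (at (norm x))" and x: "x = norm x *\<^sub>R J" and w: "norm w = 1"
    and even: "x = 0 \<Longrightarrow> \<forall>\<^sub>F r in nhds 0. \<phi> (- r) = \<phi> r"
  shows "((\<lambda>r. \<phi> (norm (x + r *\<^sub>R w))) has_vector_derivative inner J w *\<^sub>R d) (at 0)"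
proof (cases "x = 0")
  case False
  have n: "norm (x + r *\<^sub>R w) = sqrt (inner x x + 2 * r * inner x w + r * r)" for r
    using w by (simp add: norm_eq_sqrt_inner inner_add_left inner_add_right inner_commute algebra_simps)
  have "inner x x > 0" using False by simp
  then have "((\<lambda>r. sqrt (inner x x + 2 * r * inner x w + r * r)) has_real_derivative inner x w / norm x) (at 0)"
    by (auto intro!: derivative_eq_intros simp: norm_eq_sqrt_inner field_simps leD[OF inner_ge_zero])
  also have "inner x w / norm x = inner J w"
    using False by (subst x) simp
  finally have "((\<lambda>r. norm (x + r *\<^sub>R w)) has_vector_derivative inner J w) (at 0)"
    unfolding n has_real_derivative_iff_has_vector_derivative .
  from vector_diff_chain_at[OF this, of \<phi> d] \<phi> show ?thesis by (simp add: o_def)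
next
  case True
  have \<phi>0: "(\<phi> has_vector_derivative d) (at 0)" using \<phi> True by simp
  have "((\<lambda>r::real. - r) has_vector_derivative - 1) (at 0)"
    by (auto intro!: derivative_eq_intros)
  from vector_diff_chain_at[OF this, of \<phi> d] \<phi>0
  have "((\<lambda>r. \<phi> (- r)) has_vector_derivative - d) (at 0)"
    by (simp add: o_def)
  moreover have "((\<lambda>r. \<phi> (- r)) has_vector_derivative - d) (at 0) \<longleftrightarrow> (\<phi> has_vector_derivative - d) (at 0)"
    by (rule has_vector_derivative_cong_ev) (use even[OF True] in auto)
  ultimately have "d = - d" using \<phi>0 vector_derivative_unique_at by blast
  then have "2 *\<^sub>R d = 0" unfolding scaleR_2 by (simp only: eq_neg_iff_add_eq_0)
  then have d: "d = 0" by simp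
  have "((\<lambda>r. \<phi> \<bar>r\<bar>) has_vector_derivative d) (at 0) \<longleftrightarrow> (\<phi> has_vector_derivative d) (at 0)"
  proof (rule has_vector_derivative_cong_ev)
    show "\<forall>\<^sub>F r in nhds 0. r \<in> UNIV \<longrightarrow> \<phi> \<bar>r\<bar> = \<phi> r"
      using even[OF True] by (rule eventually_mono) (simp add: abs_if)
  qed simp
  with \<phi>0 d True w show ?thesis by simp
qed

text \<open>Both operators at once: e = 1 gives \<open>dbarT\<close> and e = -1 gives
  \<open>dT\<close>. The factor \<open>e\<close> accounts for the opposite signs of the two
  correction terms.\<close>

definition DT :: "real \<Rightarrow> (nat \<Rightarrow> 'a::{real_normed_vector,real_algebra_1}) \<Rightarrow> (nat \<Rightarrow> nat) \<Rightarrow> nat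
    \<Rightarrow> (nat set \<Rightarrow> 'a \<times> (nat \<Rightarrow> real) \<Rightarrow> 'a) \<Rightarrow> nat set \<Rightarrow> 'a \<times> (nat \<Rightarrow> real) \<Rightarrow> 'a" where
  "DT e v t \<tau> F K p = pdir v (t 0) \<tau> 0 (F K) p
     + (e * (-1) ^ card K) *\<^sub>R (\<Sum>s\<in>{1..t 0}. v s * pdir v (t 0) \<tau> s (F K) p)
     - e *\<^sub>R (\<Sum>h\<in>{1..\<tau>}. (-1) ^ sigma h K *\<^sub>R pdir v (t 0) \<tau> (t 0 + h) (F (symd K h)) p)"

lemma dbarT_eq_DT: "dbarT v t \<tau> F = DT 1 v t \<tau> F"
  by (simp add: fun_eq_iff dbarT_def DT_def dbar_alpha_def sum_negf)

lemma dT_eq_DT: "dT v t \<tau> F = DT (- 1) v t \<tau> F"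
  by (simp add: fun_eq_iff dT_def DT_def dbar_alpha_def)

section \<open>Parity of partial derivatives\<close>

lemma cshift_flip:
  assumes "i < ncoord t0 \<tau>" "h \<in> {1..\<tau>}"
  shows "cshift v t0 \<tau> i r (\<alpha>, flip h \<beta>) =
    (let q = cshift v t0 \<tau> i ((if i = t0 + h then - 1 else 1) * r) (\<alpha>, \<beta>) in (fst q, flip h (snd q)))"
  using assms(1)
proof (cases rule: coord_cases)
  case alpha
  then show ?thesis using assms(2) by (auto simp: cshift_alpha Let_def)
next
  case (beta k)
  then show ?thesis by (auto simp: cshift_beta Let_def flip_def fun_eq_iff)
qed

text \<open>Differentiation keeps the parity \<open>s\<close> under reflection of \<beta>_h, except
  that differentiating along \<beta>_h itself contributes another sign by the chain rule.\<close>

lemma has_pdir_flip: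
  fixes G :: "'a::real_normed_vector \<times> (nat \<Rightarrow> real) \<Rightarrow> 'b::real_normed_vector"
  assumes D: "line_open v t0 \<tau> D" "\<And>\<alpha> \<beta>. (\<alpha>, \<beta>) \<in> D \<Longrightarrow> (\<alpha>, flip h \<beta>) \<in> D"
    and p: "(\<alpha>, \<beta>) \<in> D" and i: "i < ncoord t0 \<tau>" and h: "h \<in> {1..\<tau>}"
    and G: "\<And>\<alpha> \<beta>. (\<alpha>, \<beta>) \<in> D \<Longrightarrow> G (\<alpha>, flip h \<beta>) = s *\<^sub>R G (\<alpha>, \<beta>)"
    and d: "((\<lambda>r. G (cshift v t0 \<tau> i r (\<alpha>, \<beta>))) has_vector_derivative d) (at 0)"
  shows "((\<lambda>r. G (cshift v t0 \<tau> i r (\<alpha>, flip h \<beta>))) has_vector_derivative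
    (s * (if i = t0 + h then - 1 else 1)) *\<^sub>R d) (at 0)"
proof -
  define u :: real where "u = (if i = t0 + h then - 1 else 1)"
  let ?q = "\<lambda>r. cshift v t0 \<tau> i (u * r) (\<alpha>, \<beta>)"
  have flip_flip: "flip h (flip h b) = b" for b by (simp add: flip_def fun_eq_iff)
  have sh: "cshift v t0 \<tau> i r (\<alpha>, flip h \<beta>) = (fst (?q r), flip h (snd (?q r)))" for r
    unfolding cshift_flip[OF i h] u_def Let_def ..
  have "((\<lambda>r. s *\<^sub>R G (?q r)) has_vector_derivative s *\<^sub>R u *\<^sub>R d) (at 0)"
    using has_vector_derivative_pdir_linear[OF d, of u]
    by (rule bounded_linear.has_vector_derivative[OF bounded_linear_scaleR_right])
  moreover have "((\<lambda>r. s *\<^sub>R G (?q r)) has_vector_derivative s *\<^sub>R u *\<^sub>R d) (at 0) \<longleftrightarrow>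
      ((\<lambda>r. G (cshift v t0 \<tau> i r (\<alpha>, flip h \<beta>))) has_vector_derivative s *\<^sub>R u *\<^sub>R d) (at 0)"
  proof (rule has_vector_derivative_cong_ev)
    have "\<forall>\<^sub>F r in nhds 0. cshift v t0 \<tau> i r (\<alpha>, flip h \<beta>) \<in> D"
      using D(1) D(2)[OF p] i unfolding line_open_def by blast
    then show "\<forall>\<^sub>F r in nhds 0. r \<in> UNIV \<longrightarrow> s *\<^sub>R G (?q r) = G (cshift v t0 \<tau> i r (\<alpha>, flip h \<beta>))"
    proof (rule eventually_mono)
      fix r assume "cshift v t0 \<tau> i r (\<alpha>, flip h \<beta>) \<in> D"
      then have "(fst (?q r), snd (?q r)) \<in> D" using D(2) unfolding sh by (metis flip_flip)
      from G[OF this] show "r \<in> UNIV \<longrightarrow> s *\<^sub>R G (?q r) = G (cshift v t0 \<tau> i r (\<alpha>, flip h \<beta>))"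
        unfolding sh by simp
    qed
  qed (use G[OF p] in \<open>simp cong: if_cong\<close>)
  ultimately show ?thesis unfolding u_def by simp
qed

text \<open>The torus coordinates left after \<beta>_1 has been absorbed into the mirror; this is
  the second component of the points of \<open>Dtil\<close>.\<close>

definition low :: "nat \<Rightarrow> (nat \<Rightarrow> real) \<Rightarrow> (nat \<Rightarrow> real)" where
  "low \<tau> \<beta> = (\<lambda>i. if i \<in> {1..\<tau> - 1} then \<beta> (Suc i) else 0)"

lemma low_upd_one [simp]: "low \<tau> (\<beta>(Suc 0 := b)) = low \<tau> \<beta>"
  by (auto simp: low_def fun_eq_iff)

lemma bJ_split:
  assumes "\<tau> \<ge> 1"
  shows "bJ \<tau> \<beta> J = \<beta> 1 *\<^sub>R J 1 + bJ (\<tau> - 1) (low \<tau> \<beta>) (\<lambda>h. J (Suc h))"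
proof -
  obtain n where n: "\<tau> = Suc n" using assms by (cases \<tau>) auto
  have "(\<Sum>h\<in>{1..Suc n}. \<beta> h *\<^sub>R J h) = \<beta> 1 *\<^sub>R J 1 + (\<Sum>h\<in>{2..Suc n}. \<beta> h *\<^sub>R J h)"
    by (subst sum.atLeast_Suc_atMost) (auto simp: numeral_2_eq_2)
  also have "(\<Sum>h\<in>{2..Suc n}. \<beta> h *\<^sub>R J h) = (\<Sum>h\<in>{1..n}. \<beta> (Suc h) *\<^sub>R J (Suc h))"
    using sum.shift_bounds_cl_Suc_ivl[of "\<lambda>h. \<beta> h *\<^sub>R J h" 1 n] by (simp add: numeral_2_eq_2)
  finally show ?thesis by (simp add: bJ_def n low_def)
qed

locale stem_frame = steps_frame v N t \<tau>
  for v :: "nat \<Rightarrow> 'a::{euclidean_space,real_algebra_1}" and N t \<tau> +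
  fixes D :: "('a \<times> (nat \<Rightarrow> real)) set" and reg :: regularity
    and F :: "nat set \<Rightarrow> 'a \<times> (nat \<Rightarrow> real) \<Rightarrow> 'a"
  assumes \<tau>: "\<tau> \<ge> 1" and dom: "is_domain v t \<tau> D" and stem: "stem_p v t \<tau> D reg F"
begin

lemma D_open: "openin (top_of_set (Rlm v 0 (t 0) \<times> Rtau \<tau>)) D"
  and D_sub: "D \<subseteq> Rlm v 0 (t 0) \<times> Rtau \<tau>"
  and D_flip: "(\<alpha>, \<beta>) \<in> D \<Longrightarrow> h \<in> {1..\<tau>} \<Longrightarrow> (\<alpha>, flip h \<beta>) \<in> D"
  using dom by (auto simp: is_domain_def)

lemma D_line_open: "line_open v (t 0) \<tau> D"
  by (rule openin_line_open[OF D_open])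

lemma D_refl: "reflection_invariant v t \<tau> D"
  using dom by (simp add: is_domain_def reflection_invariant_def)

lemma F_stem: "is_stem \<tau> D F"
  and F_regular: "K \<subseteq> {1..\<tau>} \<Longrightarrow> regular reg v (t 0) \<tau> D (F K)"
  using stem by (auto simp: stem_p_def)

lemma F_has_pdir:
  assumes "K \<subseteq> {1..\<tau>}" "q \<in> D" "i < ncoord (t 0) \<tau>"
  shows "((\<lambda>r. F K (cshift v (t 0) \<tau> i r q)) has_vector_derivative pdir v (t 0) \<tau> i (F K) q) (at 0)"
  by (rule regular_has_pdir[OF F_regular[OF assms(1)] assms(2,3)])

lemma F_pdir_flip:
  assumes "K \<subseteq> {1..\<tau>}" "(\<alpha>, \<beta>) \<in> D" "i < ncoord (t 0) \<tau>" "h \<in> {1..\<tau>}"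
  shows "pdir v (t 0) \<tau> i (F K) (\<alpha>, flip h \<beta>) =
    ((if h \<in> K then - 1 else 1) * (if i = t 0 + h then - 1 else 1)) *\<^sub>R pdir v (t 0) \<tau> i (F K) (\<alpha>, \<beta>)"
proof (rule pdir_eqI, rule has_pdir_flip[OF D_line_open D_flip assms(2-4)])
  show "((\<lambda>r. F K (cshift v (t 0) \<tau> i r (\<alpha>, \<beta>))) has_vector_derivative pdir v (t 0) \<tau> i (F K) (\<alpha>, \<beta>)) (at 0)"
    by (rule F_has_pdir[OF assms(1-3)])
  show "F K (a, flip h b) = (if h \<in> K then - 1 else 1) *\<^sub>R F K (a, b)" if "(a, b) \<in> D" for a b
    using F_stem assms that unfolding is_stem_def by auto
qed (use assms in auto)

text \<open>In the summand with k = h, passing to \<open>symd K h\<close> changes whether h belongs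
  to the index set, and the derivative along \<beta>_h changes the parity once more; the two signs
  cancel. This makes \<open>ind_eq\<close> available for the operators on \<open>F\<close>.\<close>

lemma DT_stem: "is_stem \<tau> D (DT e v t \<tau> F)"
  unfolding is_stem_def
proof (intro allI impI, elim conjE)
  fix K \<alpha> \<beta> h assume K: "K \<subseteq> {1..\<tau>}" and p: "(\<alpha>, \<beta>) \<in> D" and h: "h \<in> {1..\<tau>}"
  let ?s = "(if h \<in> K then - 1 else 1) :: real"
  have a: "pdir v (t 0) \<tau> i (F K) (\<alpha>, flip h \<beta>) = ?s *\<^sub>R pdir v (t 0) \<tau> i (F K) (\<alpha>, \<beta>)" if "i \<le> t 0" for i
    using that F_pdir_flip[OF K p _ h, of i] h by (simp add: ncoord_def)
  have b: "pdir v (t 0) \<tau> (t 0 + k) (F (symd K k)) (\<alpha>, flip h \<beta>) =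
      ?s *\<^sub>R pdir v (t 0) \<tau> (t 0 + k) (F (symd K k)) (\<alpha>, \<beta>)" if "k \<in> {1..\<tau>}" for k
  proof -
    have "symd K k \<subseteq> {1..\<tau>}" "t 0 + k < ncoord (t 0) \<tau>"
      using K that by (auto simp: symd_def ncoord_def)
    from F_pdir_flip[OF this(1) p this(2) h] show ?thesis
      by (cases "k = h") (auto simp: symd_def)
  qed
  have "DT e v t \<tau> F K (\<alpha>, flip h \<beta>) = ?s *\<^sub>R DT e v t \<tau> F K (\<alpha>, \<beta>)"
  proof -
    have 1: "(\<Sum>s\<in>{1..t 0}. v s * pdir v (t 0) \<tau> s (F K) (\<alpha>, flip h \<beta>)) =
        ?s *\<^sub>R (\<Sum>s\<in>{1..t 0}. v s * pdir v (t 0) \<tau> s (F K) (\<alpha>, \<beta>))"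
      unfolding scaleR_sum_right by (rule sum.cong) (simp_all add: a del: scaleR_minus1_left)
    have 2: "(\<Sum>k\<in>{1..\<tau>}. (-1) ^ sigma k K *\<^sub>R pdir v (t 0) \<tau> (t 0 + k) (F (symd K k)) (\<alpha>, flip h \<beta>)) =
        ?s *\<^sub>R (\<Sum>k\<in>{1..\<tau>}. (-1) ^ sigma k K *\<^sub>R pdir v (t 0) \<tau> (t 0 + k) (F (symd K k)) (\<alpha>, \<beta>))"
      unfolding scaleR_sum_right by (rule sum.cong[OF refl]) (simp only: b scaleR_left_commute)
    have 3: "pdir v (t 0) \<tau> 0 (F K) (\<alpha>, flip h \<beta>) = ?s *\<^sub>R pdir v (t 0) \<tau> 0 (F K) (\<alpha>, \<beta>)"
      by (rule a) simp
    show ?thesis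
      unfolding DT_def 1 2 3
      by (simp only: scaleR_add_right scaleR_diff_right scaleR_left_commute)
  qed
  then show "DT e v t \<tau> F K (\<alpha>, flip h \<beta>) =
      (if h \<in> K then - DT e v t \<tau> F K (\<alpha>, \<beta>) else DT e v t \<tau> F K (\<alpha>, \<beta>))" by auto
qed

definition G :: "nat set \<Rightarrow> 'a \<times> (nat \<Rightarrow> real) \<Rightarrow> 'a" where
  "G K = (if 1 \<in> K then (\<lambda>_. 0) else bquot v (t 0) \<tau> (F (insert 1 K)))"

lemma F_insert_one_zero:
  assumes "K \<subseteq> {1..\<tau>}" "q \<in> D" "snd q 1 = 0"
  shows "F (insert 1 K) q = 0"
  using stem_zero[OF F_stem, of "insert 1 K" 1 "fst q" "snd q"] assms \<tau> by simp

lemma G_regular: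
  assumes "K \<subseteq> {1..\<tau>}"
  shows "regular reg v (t 0) \<tau> D (G K)"
proof (cases "1 \<in> K")
  case True
  then show ?thesis using regular_zero[OF F_regular[OF assms] D_line_open] by (simp add: G_def)
next
  case False
  have "regular reg v (t 0) \<tau> D (bquot v (t 0) \<tau> (F (insert 1 K)))"
    using assms \<tau> t_le_N[of 0]
    by (intro regular_bquot D_open F_regular F_insert_one_zero) auto
  with False show ?thesis by (simp add: G_def)
qed

text \<open>Division by the odd function \<beta>_1 cancels the oddness that the index 1 gives to
  \<open>F (insert 1 K)\<close>, leaving the parity prescribed by K. Where \<beta>_1 = 0 the
  reflection of \<beta>_1 fixes the point.\<close>

lemma G_stem: "is_stem \<tau> D G"
  unfolding is_stem_def
proof (intro allI impI, elim conjE)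
  fix K \<alpha> \<beta> h assume K: "K \<subseteq> {1..\<tau>}" and p: "(\<alpha>, \<beta>) \<in> D" and h: "h \<in> {1..\<tau>}"
  show "G K (\<alpha>, flip h \<beta>) = (if h \<in> K then - G K (\<alpha>, \<beta>) else G K (\<alpha>, \<beta>))"
  proof (cases "1 \<in> K")
    case True
    then show ?thesis by (simp add: G_def)
  next
    case False
    have K1: "insert 1 K \<subseteq> {1..\<tau>}" using K \<tau> by auto
    have F1: "F (insert 1 K) (\<alpha>, flip h \<beta>) =
        (if h \<in> insert 1 K then - F (insert 1 K) (\<alpha>, \<beta>) else F (insert 1 K) (\<alpha>, \<beta>))"
      using F_stem K1 p h unfolding is_stem_def by blast
    show ?thesis
    proof (cases "h = 1")
      case True
      have "flip 1 \<beta> = \<beta>" if "\<beta> 1 = 0" using that by (simp add: flip_def fun_eq_iff)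
      moreover have "flip 1 \<beta> 1 = - \<beta> 1" by (simp add: flip_def)
      ultimately show ?thesis
        using F1 True False by (cases "\<beta> 1 = 0") (simp_all add: G_def bquot_def)
    next
      case h1: False
      then have "flip h \<beta> 1 = \<beta> 1" by (simp add: flip_def)
      moreover have "t 0 + 1 < ncoord (t 0) \<tau>" using \<tau> by (simp add: ncoord_def)
      from F_pdir_flip[OF K1 p this h] h1
      have "pdir v (t 0) \<tau> (t 0 + 1) (F (insert 1 K)) (\<alpha>, flip h \<beta>) =
        (if h \<in> K then - 1 else 1) *\<^sub>R pdir v (t 0) \<tau> (t 0 + 1) (F (insert 1 K)) (\<alpha>, \<beta>)"
        by auto
      ultimately show ?thesis using F1 h1 False by (simp add: G_def bquot_def)
    qed
  qed
qed

lemma G_stem_p: "stem_p v t \<tau> D reg G"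
  using G_stem G_regular by (simp add: stem_p_def)

lemma G_mult:
  assumes "K \<subseteq> {1..\<tau>}" "1 \<notin> K" "q \<in> D"
  shows "F (insert 1 K) q = snd q 1 *\<^sub>R G K q"
  using assms F_insert_one_zero[of K q] by (cases "snd q 1 = 0") (auto simp: G_def bquot_def)

lemma G_has_pdir:
  assumes "K \<subseteq> {1..\<tau>}" "q \<in> D" "i < ncoord (t 0) \<tau>"
  shows "((\<lambda>r. G K (cshift v (t 0) \<tau> i r q)) has_vector_derivative pdir v (t 0) \<tau> i (G K) q) (at 0)"
  by (rule regular_has_pdir[OF G_regular[OF assms(1)] assms(2,3)])

text \<open>Product rule for \<open>G_mult\<close>. Its undifferentiated summand
  \<open>G K q\<close> is the origin of the 1 in the constant 1 + t_0 - t_1.\<close>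

lemma pdir_F_insert_one:
  assumes K: "K \<subseteq> {1..\<tau>}" "1 \<notin> K" and q: "q \<in> D"
  shows "pdir v (t 0) \<tau> (t 0 + 1) (F (insert 1 K)) q =
    G K q + snd q 1 *\<^sub>R pdir v (t 0) \<tau> (t 0 + 1) (G K) q"
proof -
  have i: "t 0 + 1 < ncoord (t 0) \<tau>" using \<tau> by (simp add: ncoord_def)
  have s: "snd (cshift v (t 0) \<tau> (t 0 + 1) r q) 1 = snd q 1 + r" for r
    using \<tau> by (subst cshift_beta) auto
  have "((\<lambda>r. snd q 1 + r) has_real_derivative 1) (at 0)" by (auto intro!: derivative_eq_intros)
  from has_vector_derivative_scaleR[OF this G_has_pdir[OF K(1) q i]]
  have "((\<lambda>r. snd (cshift v (t 0) \<tau> (t 0 + 1) r q) 1 *\<^sub>R G K (cshift v (t 0) \<tau> (t 0 + 1) r q))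
      has_vector_derivative G K q + snd q 1 *\<^sub>R pdir v (t 0) \<tau> (t 0 + 1) (G K) q) (at 0)"
    unfolding s by (rule has_vector_derivative_eq_rhs) simp
  then show ?thesis
    using has_pdir_transform[OF D_line_open q i, of "F (insert 1 K)" "\<lambda>q. snd q 1 *\<^sub>R G K q"] G_mult[OF K]
    by (auto intro: pdir_eqI)
qed

end

section \<open>The stem function for the shortened list of steps\<close>

context stem_frame
begin

lemma tstep_frame: "steps_frame v N (tstep t) (\<tau> - 1)"
proof
  show "steps N (tstep t) (\<tau> - 1)" using steps \<tau> by (auto simp: steps_def tstep_def)
qed

lemma DtilI:
  assumes "x \<in> Rlm v (t 0 + 1) (t 1)" "(\<alpha>, \<beta>(1 := norm x)) \<in> D"
  shows "(\<alpha> + x, low \<tau> \<beta>) \<in> Dtil v t \<tau> D"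
  unfolding Dtil_def low_def mem_Collect_eq using assms
  by (intro exI[of _ \<alpha>] exI[of _ x] exI[of _ \<beta>] conjI refl)

text \<open>\<open>Dtil\<close> records the norm, that is |\<beta>_1|; a negative \<beta>_1 is
  brought to this form by the reflection of the first coordinate.\<close>

lemma Dtil_point:
  assumes "(\<alpha>, \<beta>) \<in> D" "J \<in> Slm v (t 0 + 1) (t 1)"
  shows "(\<alpha> + \<beta> 1 *\<^sub>R J, low \<tau> \<beta>) \<in> Dtil v t \<tau> D"
proof -
  have x: "\<beta> 1 *\<^sub>R J \<in> Rlm v (t 0 + 1) (t 1)" "norm (\<beta> 1 *\<^sub>R J) = \<bar>\<beta> 1\<bar>"
    using assms(2) by (auto simp: Slm_def Rlm_def intro: span_scale)
  have "(\<alpha>, \<beta>(1 := \<bar>\<beta> 1\<bar>)) \<in> D"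
  proof (cases "\<beta> 1 \<ge> 0")
    case False
    then have "\<beta>(1 := \<bar>\<beta> 1\<bar>) = flip 1 \<beta>" by (simp add: flip_def)
    then show ?thesis using D_flip[OF assms(1), of 1] \<tau> by simp
  qed (use assms in simp)
  with x(1) show ?thesis by (intro DtilI) (simp_all only: x(2))
qed

lemma Dtil_refl: "reflection_invariant v (tstep t) (\<tau> - 1) (Dtil v t \<tau> D)"
  unfolding reflection_invariant_def
proof (intro conjI allI impI subsetI)
  fix q assume "q \<in> Dtil v t \<tau> D"
  then obtain \<alpha> x \<beta> where q: "q = (\<alpha> + x, low \<tau> \<beta>)" "x \<in> Rlm v (t 0 + 1) (t 1)" "(\<alpha>, \<beta>(1 := norm x)) \<in> D"
    by (auto simp: Dtil_def low_def)
  have "\<alpha> \<in> Rlm v 0 (t 0)" using q(3) D_sub by auto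
  then have "\<alpha> \<in> Rlm v 0 (t 1)" using Rlm_mono[of 0 0 "t 0" "t 1" v] t_le[of 0 1] \<tau> by auto
  moreover have "x \<in> Rlm v 0 (t 1)" using q(2) Rlm_mono[of 0 "t 0 + 1" "t 1" "t 1" v] by auto
  ultimately have "\<alpha> + x \<in> Rlm v 0 (t 1)" unfolding Rlm_def by (rule span_add)
  then show "q \<in> Rlm v 0 (tstep t 0) \<times> Rtau (\<tau> - 1)"
    by (simp add: q(1) tstep_def Rtau_def low_def)
next
  fix a b h assume "(a, b) \<in> Dtil v t \<tau> D \<and> h \<in> {1..\<tau> - 1}"
  then obtain \<alpha> x \<beta> where q: "a = \<alpha> + x" "b = low \<tau> \<beta>" "x \<in> Rlm v (t 0 + 1) (t 1)"
      "(\<alpha>, \<beta>(1 := norm x)) \<in> D" and h: "h \<in> {1..\<tau> - 1}"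
    by (auto simp: Dtil_def low_def)
  have "flip h b = low \<tau> (flip (Suc h) \<beta>)"
    using h by (auto simp: q(2) low_def flip_def fun_eq_iff)
  moreover have "(\<alpha>, flip (Suc h) (\<beta>(1 := norm x))) \<in> D"
    using h by (intro D_flip[OF q(4)]) auto
  moreover have "flip (Suc h) (\<beta>(1 := norm x)) = (flip (Suc h) \<beta>)(1 := norm x)"
    using h by (auto simp: flip_def fun_eq_iff)
  ultimately show "(a, flip h b) \<in> Dtil v t \<tau> D"
    unfolding q(1) by (simp only:) (intro DtilI q(3))
qed

lemma torus_anticommute:
  assumes "J1 \<in> Rlm v (t 0 + 1) (t 1)" "J \<in> Rlm v (t h + 1) (t (Suc h))" "h \<in> {1..\<tau> - 1}"
  shows "J1 * J = - (J * J1)"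
proof (rule Rlm_anticommute[OF assms(1,2)])
  have "1 \<le> h" "h \<le> \<tau>" "Suc h \<le> \<tau>" using assms(3) by auto
  then show "t 1 < t h + 1" "t (Suc h) \<le> N" using t_le[of 1 h] t_le_N[of "Suc h"] by auto
qed simp

text \<open>Comparing the two representations of \<open>f\<close> at the points obtained by all sign changes of the units
  \<open>J\<^sub>2, \<dots>, J\<^sub>\<tau>\<close> determines the stem function for the shortened list of steps.\<close>

lemma stem_tstep_eq:
  assumes f: "\<forall>x\<in>Omega v t \<tau> D. f x = ind v t \<tau> D F x"
    and Ft: "is_stem (\<tau> - 1) (Dtil v t \<tau> D) Ft"
    and ft: "\<forall>x\<in>Omega v (tstep t) (\<tau> - 1) (Dtil v t \<tau> D). f x = ind v (tstep t) (\<tau> - 1) (Dtil v t \<tau> D) Ft x"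
    and p: "(\<alpha>, \<beta>) \<in> D" and J1: "J1 \<in> Slm v (t 0 + 1) (t 1)" and H: "H \<subseteq> {1..\<tau> - 1}"
  shows "Ft H (\<alpha> + \<beta> 1 *\<^sub>R J1, low \<tau> \<beta>) = merge_unit J1 (\<lambda>K. F K (\<alpha>, \<beta>)) H"
proof -
  interpret til: steps_frame v N "tstep t" "\<tau> - 1" by (rule tstep_frame)
  let ?q = "(\<alpha> + \<beta> 1 *\<^sub>R J1, low \<tau> \<beta>)"
  let ?E = "\<lambda>H. Ft H ?q - merge_unit J1 (\<lambda>K. F K (\<alpha>, \<beta>)) H"
  have \<tau>': "\<tau> = Suc (\<tau> - 1)" using \<tau> by simp
  \<comment> \<open>A reference unit in each remaining block: its last basis vector, which exists
    because the steps increase strictly.\<close>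
  have unit: "v (t (Suc h)) \<in> Slm v (t h + 1) (t (Suc h))" if "h \<in> {1..\<tau> - 1}" for h
  proof -
    have "Suc h \<le> \<tau>" using that by auto
    then show ?thesis using t_less[of h "Suc h"] t_le_N[of "Suc h"] by (intro v_in_Slm) auto
  qed
  \<comment> \<open>The discrepancy \<open>?E\<close> depends on \<open>J1\<close> and the base
    point but not on the signs given to the reference units. The signs enter only through the
    products J_H, as characters.\<close>
  have "JK (\<lambda>h. v (t (Suc h))) H * ?E H = 0"
  proof (rule sign_sum_eq_0[of "{1..\<tau> - 1}" H "\<lambda>H. JK (\<lambda>h. v (t (Suc h))) H * ?E H"])
    fix \<epsilon> :: "nat \<Rightarrow> real" assume \<epsilon>: "\<And>h. \<epsilon> h \<in> {1, - 1}"
    define J where "J h = (if h = 1 then J1 else \<epsilon> (h - 1) *\<^sub>R v (t h))" for h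
    let ?J = "\<lambda>h. \<epsilon> h *\<^sub>R v (t (Suc h))"
    have Jt: "?J h \<in> Slm v (t h + 1) (t (Suc h))" if "h \<in> {1..\<tau> - 1}" for h
      using unit[OF that] \<epsilon>[of h] by (auto simp: Slm_def Rlm_def intro: span_neg)
    have JSuc: "J (Suc h) = ?J h" if "h \<in> {1..\<tau> - 1}" for h
      using that by (auto simp: J_def)
    have J: "J \<in> torus v t \<tau>"
      unfolding torus_def mem_Collect_eq
    proof
      fix h assume h: "h \<in> {1..\<tau>}"
      show "J h \<in> Slm v (t (h - 1) + 1) (t h)"
      proof (cases "h = 1")
        case True
        then show ?thesis using J1 by (simp add: J_def)
      next
        case False
        then obtain k where "h = Suc k" "k \<in> {1..\<tau> - 1}" using h by (cases h) auto
        then show ?thesis using Jt[of k] JSuc[of k] by simp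
      qed
    qed
    have J': "?J \<in> torus v (tstep t) (\<tau> - 1)"
      using Jt by (auto simp: torus_def tstep_def)
    have bJ: "bJ (\<tau> - 1) (low \<tau> \<beta>) (\<lambda>h. J (Suc h)) = bJ (\<tau> - 1) (low \<tau> \<beta>) ?J"
      unfolding bJ_def by (intro sum.cong) (auto simp: JSuc)
    let ?x = "\<alpha> + bJ \<tau> \<beta> J"
    have x: "?x = (\<alpha> + \<beta> 1 *\<^sub>R J1) + bJ (\<tau> - 1) (low \<tau> \<beta>) ?J"
      unfolding bJ_split[OF \<tau>] bJ by (simp add: J_def add.assoc)
    have JKeq: "JK (\<lambda>h. J (Suc h)) H = JK ?J H" if "H \<in> Pow {1..\<tau> - 1}" for H
      using that by (intro JK_cong) (auto simp: JSuc intro: finite_subset)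
    have "?x \<in> Omega v t \<tau> D" unfolding Omega_def using p J by blast
    then have "f ?x = (\<Sum>K\<in>Pow {1..\<tau>}. JK J K * F K (\<alpha>, \<beta>))"
      using f ind_eq[OF D_refl F_stem p J] by simp
    also have "\<dots> = (\<Sum>H\<in>Pow {1..\<tau> - 1}. JK (\<lambda>h. J (Suc h)) H * merge_unit (J 1) (\<lambda>K. F K (\<alpha>, \<beta>)) H)"
    proof (subst \<tau>', rule sum_JK_split)
      fix h assume h: "h \<in> {1..\<tau> - 1}"
      show "J 1 * J (Suc h) = - (J (Suc h) * J 1)"
        using torus_anticommute[of J1 "?J h" h] Jt[OF h] J1 h JSuc[OF h] by (simp add: J_def Slm_def)
    qed
    also have "\<dots> = (\<Sum>H\<in>Pow {1..\<tau> - 1}. JK ?J H * merge_unit J1 (\<lambda>K. F K (\<alpha>, \<beta>)) H)"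
      by (rule sum.cong[OF refl]) (simp only: JKeq, simp add: J_def)
    finally have 1: "f ?x = (\<Sum>H\<in>Pow {1..\<tau> - 1}. JK ?J H * merge_unit J1 (\<lambda>K. F K (\<alpha>, \<beta>)) H)" .
    have q: "?q \<in> Dtil v t \<tau> D" by (rule Dtil_point[OF p J1])
    have "?x \<in> Omega v (tstep t) (\<tau> - 1) (Dtil v t \<tau> D)"
      unfolding x Omega_def using q J' by blast
    then have "f ?x = ind v (tstep t) (\<tau> - 1) (Dtil v t \<tau> D) Ft ?x" using ft by blast
    also have "\<dots> = (\<Sum>H\<in>Pow {1..\<tau> - 1}. JK ?J H * Ft H ?q)"
      unfolding x by (rule til.ind_eq[OF Dtil_refl Ft q J'])
    finally have "(\<Sum>H\<in>Pow {1..\<tau> - 1}. JK ?J H * ?E H) = 0"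
      unfolding 1 by (simp add: right_diff_distrib sum_subtractf)
    moreover have "JK ?J H = (\<Prod>h\<in>H. \<epsilon> h) *\<^sub>R JK (\<lambda>h. v (t (Suc h))) H" if "H \<in> Pow {1..\<tau> - 1}" for H
      using that by (intro JK_scaleR) (auto intro: finite_subset)
    ultimately show "(\<Sum>H\<in>Pow {1..\<tau> - 1}. (\<Prod>h\<in>H. \<epsilon> h) *\<^sub>R (JK (\<lambda>h. v (t (Suc h))) H * ?E H)) = 0"
      by simp
  qed (use H in auto)
  then have "?E H = 0"
  proof (rule JK_cancel[rotated -1])
    fix h assume "h \<in> H"
    then have "h \<in> {1..\<tau> - 1}" using H by auto
    moreover from this have "Suc h \<le> \<tau>" by auto
    ultimately show "v (t (Suc h)) * v (t (Suc h)) = - 1"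
      using unit[of h] t_le_N[of "Suc h"] by (intro Slm_square[of _ "t h + 1" "t (Suc h)"]) auto
  qed (use H in \<open>auto intro: finite_subset\<close>)
  then show ?thesis by simp
qed

lemma G_one [simp]: "1 \<in> K \<Longrightarrow> G K q = 0"
  by (simp add: G_def)

end

text \<open>Isolates the formula of \<open>stem_tstep_eq\<close>, through which \<open>Ft\<close>
  enters the differential calculus below.\<close>

locale tstep_stem = stem_frame +
  fixes Ft :: "nat set \<Rightarrow> 'a \<times> (nat \<Rightarrow> real) \<Rightarrow> 'a"
  assumes Ft_eq: "(\<alpha>, \<beta>) \<in> D \<Longrightarrow> J1 \<in> Slm v (t 0 + 1) (t 1) \<Longrightarrow> H \<subseteq> {1..\<tau> - 1} \<Longrightarrow>
    Ft H (\<alpha> + \<beta> 1 *\<^sub>R J1, low \<tau> \<beta>) = merge_unit J1 (\<lambda>K. F K (\<alpha>, \<beta>)) H"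
begin

text \<open>J F_({1} \<union> H') equals (norm x) J G_H', that is x G_H'. This removes the direction
  J of x, which has no limit as x tends to 0, and leaves an expression that can be differentiated
  there.\<close>

lemma Ft_eq_G:
  assumes x: "x \<in> Rlm v (t 0 + 1) (t 1)" and p: "(\<alpha>, \<beta>(1 := norm x)) \<in> D" and H: "H \<subseteq> {1..\<tau> - 1}"
  shows "Ft H (\<alpha> + x, low \<tau> \<beta>) = F (Suc ` H) (\<alpha>, \<beta>(1 := norm x)) +
    (-1) ^ card H *\<^sub>R (x * G (Suc ` H) (\<alpha>, \<beta>(1 := norm x)))"
proof -
  \<comment> \<open>At x = 0 any unit of the block represents the point; \<open>v (t 1)\<close> is
    one.\<close>
  define J where "J = (if x = 0 then v (t 1) else (1 / norm x) *\<^sub>R x)"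
  have J: "J \<in> Slm v (t 0 + 1) (t 1)"
    using x v_in_Slm[of "t 1" "t 0 + 1" "t 1"] t_less[of 0 1] t_le_N[of 1] \<tau>
    by (auto simp: J_def Slm_def Rlm_def intro: span_scale)
  have xJ: "norm x *\<^sub>R J = x" by (simp add: J_def)
  have H': "Suc ` H \<subseteq> {1..\<tau>}" "1 \<notin> Suc ` H" using H by force+
  have "Ft H (\<alpha> + x, low \<tau> \<beta>) = merge_unit J (\<lambda>K. F K (\<alpha>, \<beta>(1 := norm x))) H"
    using Ft_eq[OF p J H] xJ by simp
  moreover have "J * F (insert 1 (Suc ` H)) (\<alpha>, \<beta>(1 := norm x)) =
      (norm x *\<^sub>R J) * G (Suc ` H) (\<alpha>, \<beta>(1 := norm x))"
    using G_mult[OF H' p] by simp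
  ultimately show ?thesis by (simp only: merge_unit_def xJ)
qed

end

section \<open>Comparison of the operators\<close>

lemma has_vector_derivative_merge_unit:
  fixes A :: "nat set \<Rightarrow> real \<Rightarrow> 'a::{euclidean_space,real_algebra_1}"
  assumes "(A (Suc ` H) has_vector_derivative A' (Suc ` H)) (at r)"
    and "(A (insert 1 (Suc ` H)) has_vector_derivative A' (insert 1 (Suc ` H))) (at r)"
  shows "((\<lambda>r. merge_unit J (\<lambda>K. A K r) H) has_vector_derivative merge_unit J A' H) (at r)"
  unfolding merge_unit_def
  by (rule has_vector_derivative_add[OF assms(1)
        bounded_linear.has_vector_derivative[OF bounded_linear_scaleR_right
        bounded_linear.has_vector_derivative[OF bounded_linear_left_mult assms(2)]]])

lemma symd_Suc_image: "symd (Suc ` H) (Suc h) = Suc ` symd H h"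
  by (auto simp: symd_def)

lemma symd_insert_one_Suc_image:
  assumes "h \<noteq> 0"
  shows "symd (insert 1 (Suc ` H)) (Suc h) = insert 1 (Suc ` symd H h)"
  using assms by (auto simp: symd_def)

lemma sigma_Suc_image: "sigma (Suc h) (Suc ` H) = sigma h H"
proof -
  have "{k \<in> Suc ` H. k \<le> Suc h} = Suc ` {k \<in> H. k \<le> h}" by auto
  then show ?thesis by (simp add: sigma_def card_image)
qed

lemma sigma_insert_one_Suc_image:
  assumes "finite H" "0 \<notin> H"
  shows "sigma (Suc h) (insert 1 (Suc ` H)) = Suc (sigma h H)"
proof -
  have "{k \<in> insert 1 (Suc ` H). k \<le> Suc h} = insert 1 (Suc ` {k \<in> H. k \<le> h})" by auto
  then show ?thesis using assms by (simp add: sigma_def card_image card_insert_if image_iff)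
qed

context tstep_stem
begin

lemma Suc_image_sub:
  assumes "H \<subseteq> {1..\<tau> - 1}"
  shows "Suc ` H \<subseteq> {1..\<tau>}" "insert 1 (Suc ` H) \<subseteq> {1..\<tau>}" "1 \<notin> Suc ` H" "finite H" "0 \<notin> H"
proof -
  show "Suc ` H \<subseteq> {1..\<tau>}" using assms by force
  then show "insert 1 (Suc ` H) \<subseteq> {1..\<tau>}" using \<tau> by simp
  show "0 \<notin> H" using assms by auto
  then show "1 \<notin> Suc ` H" by auto
  show "finite H" using assms by (rule finite_subset) simp
qed

text \<open>In the directions common to both lists of steps the unit \<open>J1\<close> is constant.\<close>

lemma pdir_Ft_common:
  assumes p: "(\<alpha>, \<beta>) \<in> D" and J: "J1 \<in> Slm v (t 0 + 1) (t 1)" and H: "H \<subseteq> {1..\<tau> - 1}"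
    and i: "i < ncoord (t 0) \<tau>"
    and sh: "\<And>r. cshift v (t 1) (\<tau> - 1) i' r (\<alpha> + \<beta> 1 *\<^sub>R J1, low \<tau> \<beta>) =
      (fst (cshift v (t 0) \<tau> i r (\<alpha>, \<beta>)) + snd (cshift v (t 0) \<tau> i r (\<alpha>, \<beta>)) 1 *\<^sub>R J1,
       low \<tau> (snd (cshift v (t 0) \<tau> i r (\<alpha>, \<beta>))))"
  shows "pdir v (t 1) (\<tau> - 1) i' (Ft H) (\<alpha> + \<beta> 1 *\<^sub>R J1, low \<tau> \<beta>) =
    merge_unit J1 (\<lambda>K. pdir v (t 0) \<tau> i (F K) (\<alpha>, \<beta>)) H"
proof (rule pdir_eqI)
  let ?q = "\<lambda>r. cshift v (t 0) \<tau> i r (\<alpha>, \<beta>)"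
  note K = Suc_image_sub[OF H]
  have "((\<lambda>r. merge_unit J1 (\<lambda>K. F K (?q r)) H) has_vector_derivative
      merge_unit J1 (\<lambda>K. pdir v (t 0) \<tau> i (F K) (\<alpha>, \<beta>)) H) (at 0)"
    by (rule has_vector_derivative_merge_unit[where A = "\<lambda>K r. F K (?q r)"]) (intro F_has_pdir K p i)+
  moreover have "\<forall>\<^sub>F r in nhds 0. ?q r \<in> D"
    using D_line_open p i unfolding line_open_def by blast
  then have ev: "\<forall>\<^sub>F r in nhds 0. merge_unit J1 (\<lambda>K. F K (?q r)) H =
      Ft H (cshift v (t 1) (\<tau> - 1) i' r (\<alpha> + \<beta> 1 *\<^sub>R J1, low \<tau> \<beta>))"
    by (rule eventually_mono) (metis sh Ft_eq[OF _ J H] prod.collapse)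
  then have "((\<lambda>r. merge_unit J1 (\<lambda>K. F K (?q r)) H) has_vector_derivative d) (at 0) \<longleftrightarrow>
      ((\<lambda>r. Ft H (cshift v (t 1) (\<tau> - 1) i' r (\<alpha> + \<beta> 1 *\<^sub>R J1, low \<tau> \<beta>))) has_vector_derivative d) (at 0)" for d
    by (intro has_vector_derivative_cong_ev eventually_nhds_x_imp_x[OF ev]) (auto elim: eventually_mono)
  ultimately show "((\<lambda>r. Ft H (cshift v (t 1) (\<tau> - 1) i' r (\<alpha> + \<beta> 1 *\<^sub>R J1, low \<tau> \<beta>)))
      has_vector_derivative merge_unit J1 (\<lambda>K. pdir v (t 0) \<tau> i (F K) (\<alpha>, \<beta>)) H) (at 0)"
    by blast
qed

lemma pdir_Ft_alpha:
  assumes "(\<alpha>, \<beta>) \<in> D" "J1 \<in> Slm v (t 0 + 1) (t 1)" "H \<subseteq> {1..\<tau> - 1}" "s \<le> t 0"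
  shows "pdir v (t 1) (\<tau> - 1) s (Ft H) (\<alpha> + \<beta> 1 *\<^sub>R J1, low \<tau> \<beta>) =
    merge_unit J1 (\<lambda>K. pdir v (t 0) \<tau> s (F K) (\<alpha>, \<beta>)) H"
proof (rule pdir_Ft_common[OF assms(1-3)])
  fix r
  have "s \<le> t 1" using assms(4) t_le[of 0 1] \<tau> by simp
  then show "cshift v (t 1) (\<tau> - 1) s r (\<alpha> + \<beta> 1 *\<^sub>R J1, low \<tau> \<beta>) =
      (fst (cshift v (t 0) \<tau> s r (\<alpha>, \<beta>)) + snd (cshift v (t 0) \<tau> s r (\<alpha>, \<beta>)) 1 *\<^sub>R J1,
       low \<tau> (snd (cshift v (t 0) \<tau> s r (\<alpha>, \<beta>))))"
    unfolding cshift_alpha[OF assms(4)] cshift_alpha[OF \<open>s \<le> t 1\<close>] by simp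
qed (use assms in \<open>simp add: ncoord_def\<close>)

lemma pdir_Ft_beta:
  assumes "(\<alpha>, \<beta>) \<in> D" "J1 \<in> Slm v (t 0 + 1) (t 1)" "H \<subseteq> {1..\<tau> - 1}" and h: "h \<in> {1..\<tau> - 1}"
  shows "pdir v (t 1) (\<tau> - 1) (t 1 + h) (Ft H) (\<alpha> + \<beta> 1 *\<^sub>R J1, low \<tau> \<beta>) =
    merge_unit J1 (\<lambda>K. pdir v (t 0) \<tau> (t 0 + Suc h) (F K) (\<alpha>, \<beta>)) H"
proof (rule pdir_Ft_common[OF assms(1-3)])
  fix r
  have h': "Suc h \<in> {1..\<tau>}" using h by auto
  have "(low \<tau> \<beta>)(h := low \<tau> \<beta> h + r) = low \<tau> (\<beta>(Suc h := \<beta> (Suc h) + r))"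
    using h by (auto simp: low_def fun_eq_iff)
  then show "cshift v (t 1) (\<tau> - 1) (t 1 + h) r (\<alpha> + \<beta> 1 *\<^sub>R J1, low \<tau> \<beta>) =
      (fst (cshift v (t 0) \<tau> (t 0 + Suc h) r (\<alpha>, \<beta>)) +
        snd (cshift v (t 0) \<tau> (t 0 + Suc h) r (\<alpha>, \<beta>)) 1 *\<^sub>R J1,
       low \<tau> (snd (cshift v (t 0) \<tau> (t 0 + Suc h) r (\<alpha>, \<beta>))))"
    unfolding cshift_beta[OF h'] cshift_beta[OF h] using h by simp
qed (use h in \<open>auto simp: ncoord_def\<close>)

text \<open>Presents the partial derivative as an ordinary derivative at \<beta>_1, ready to be
  composed with the norm.\<close>

lemma pdir_beta_one_at:
  assumes "((\<lambda>r. Q (cshift v (t 0) \<tau> (t 0 + 1) r (\<alpha>, \<beta>))) has_vector_derivative d) (at 0)"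
  shows "((\<lambda>\<rho>. Q (\<alpha>, \<beta>(1 := \<rho>))) has_vector_derivative d) (at (\<beta> 1))"
proof -
  have "((\<lambda>\<rho>. \<rho> - \<beta> 1) has_vector_derivative 1) (at (\<beta> 1))"
    by (auto intro!: derivative_eq_intros)
  from vector_diff_chain_at[OF this, of "\<lambda>r. Q (cshift v (t 0) \<tau> (t 0 + 1) r (\<alpha>, \<beta>))" d] assms
  have "((\<lambda>\<rho>. Q (cshift v (t 0) \<tau> (t 0 + 1) (\<rho> - \<beta> 1) (\<alpha>, \<beta>))) has_vector_derivative d) (at (\<beta> 1))"
    by (simp add: o_def cong: if_cong)
  moreover have "cshift v (t 0) \<tau> (t 0 + 1) (\<rho> - \<beta> 1) (\<alpha>, \<beta>) = (\<alpha>, \<beta>(1 := \<rho>))" for \<rho>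
    using \<tau> by (subst cshift_beta) auto
  ultimately show ?thesis by simp
qed

lemma eventually_beta_one_D:
  assumes "(\<alpha>, \<beta>) \<in> D"
  shows "\<forall>\<^sub>F \<rho> in nhds (\<beta> 1). (\<alpha>, \<beta>(1 := \<rho>)) \<in> D"
proof -
  have "t 0 + 1 < ncoord (t 0) \<tau>" using \<tau> by (simp add: ncoord_def)
  then have "\<forall>\<^sub>F r in nhds 0. cshift v (t 0) \<tau> (t 0 + 1) r (\<alpha>, \<beta>) \<in> D"
    using D_line_open assms unfolding line_open_def by blast
  moreover have "filterlim (\<lambda>\<rho>. \<rho> - \<beta> 1) (nhds 0) (nhds (\<beta> 1))"
    using tendsto_diff[OF filterlim_ident tendsto_const[of "\<beta> 1" "nhds (\<beta> 1)"]] by simp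
  ultimately have "\<forall>\<^sub>F \<rho> in nhds (\<beta> 1). cshift v (t 0) \<tau> (t 0 + 1) (\<rho> - \<beta> 1) (\<alpha>, \<beta>) \<in> D"
    by (rule eventually_compose_filterlim)
  moreover have "cshift v (t 0) \<tau> (t 0 + 1) (\<rho> - \<beta> 1) (\<alpha>, \<beta>) = (\<alpha>, \<beta>(1 := \<rho>))" for \<rho>
    using \<tau> by (subst cshift_beta) auto
  ultimately show ?thesis by simp
qed

text \<open>Product and chain rule in the formula of \<open>Ft_eq_G\<close>, along a basis vector of
  the block absorbed by the mirror. The condition on \<beta>_1 ensures that the norm of \<beta>_1
  J_1 is \<beta>_1 itself.\<close>

lemma pdir_Ft_new:
  assumes p: "(\<alpha>, \<beta>) \<in> D" and J: "J1 \<in> Slm v (t 0 + 1) (t 1)" and H: "H \<subseteq> {1..\<tau> - 1}"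
    and \<beta>: "\<beta> 1 \<ge> 0" and s: "s \<in> {t 0 + 1..t 1}"
  shows "pdir v (t 1) (\<tau> - 1) s (Ft H) (\<alpha> + \<beta> 1 *\<^sub>R J1, low \<tau> \<beta>) =
    inner J1 (v s) *\<^sub>R pdir v (t 0) \<tau> (t 0 + 1) (F (Suc ` H)) (\<alpha>, \<beta>) +
    (-1) ^ card H *\<^sub>R (v s * G (Suc ` H) (\<alpha>, \<beta>) +
      inner J1 (v s) *\<^sub>R ((\<beta> 1 *\<^sub>R J1) * pdir v (t 0) \<tau> (t 0 + 1) (G (Suc ` H)) (\<alpha>, \<beta>)))"
proof (rule pdir_eqI)
  define x where "x = \<beta> 1 *\<^sub>R J1"
  note K = Suc_image_sub[OF H]
  have nx: "norm x = \<beta> 1" using J \<beta> by (simp add: x_def Slm_def)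
  have xR: "x \<in> Rlm v (t 0 + 1) (t 1)" using J by (auto simp: x_def Slm_def Rlm_def intro: span_scale)
  have xJ: "x = norm x *\<^sub>R J1" by (simp only: nx) (simp only: x_def)
  have vs: "v s \<in> Slm v (t 0 + 1) (t 1)" using s t_le_N[of 1] \<tau> by (intro v_in_Slm) auto
  then have nvs: "norm (v s) = 1" and vR: "v s \<in> Rlm v (t 0 + 1) (t 1)" by (auto simp: Slm_def)
  have i: "t 0 + 1 < ncoord (t 0) \<tau>" using \<tau> by (simp add: ncoord_def)
  \<comment> \<open>Components whose index set omits 1 are even in \<beta>_1; this is what handles
    the point x = 0.\<close>
  have even: "\<forall>\<^sub>F r in nhds 0. Q K (\<alpha>, \<beta>(1 := - r)) = Q K (\<alpha>, \<beta>(1 := r))"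
    if Q: "is_stem \<tau> D Q" and "x = 0" and K: "K \<subseteq> {1..\<tau>}" "1 \<notin> K" for Q K
  proof -
    have "\<beta> 1 = 0" using nx \<open>x = 0\<close> by simp
    then have "\<forall>\<^sub>F r in nhds 0. (\<alpha>, \<beta>(1 := r)) \<in> D" using eventually_beta_one_D[OF p] by simp
    then show ?thesis
    proof (rule eventually_mono)
      fix r assume r: "(\<alpha>, \<beta>(1 := r)) \<in> D"
      have "flip 1 (\<beta>(1 := r)) = \<beta>(1 := - r)" by (simp add: flip_def)
      moreover have "Q K (\<alpha>, flip 1 (\<beta>(1 := r))) = Q K (\<alpha>, \<beta>(1 := r))"
        using Q K r \<tau> unfolding is_stem_def by auto
      ultimately show "Q K (\<alpha>, \<beta>(1 := - r)) = Q K (\<alpha>, \<beta>(1 := r))" by simp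
    qed
  qed
  let ?\<rho> = "\<lambda>r. norm (x + r *\<^sub>R v s)"
  have dF: "((\<lambda>r. F (Suc ` H) (\<alpha>, \<beta>(1 := ?\<rho> r))) has_vector_derivative
      inner J1 (v s) *\<^sub>R pdir v (t 0) \<tau> (t 0 + 1) (F (Suc ` H)) (\<alpha>, \<beta>)) (at 0)"
    by (rule has_vector_derivative_even_norm[OF _ xJ nvs even[OF F_stem _ K(1,3)]])
      (unfold nx, intro pdir_beta_one_at F_has_pdir K p i)
  have dG: "((\<lambda>r. G (Suc ` H) (\<alpha>, \<beta>(1 := ?\<rho> r))) has_vector_derivative
      inner J1 (v s) *\<^sub>R pdir v (t 0) \<tau> (t 0 + 1) (G (Suc ` H)) (\<alpha>, \<beta>)) (at 0)"
    by (rule has_vector_derivative_even_norm[OF _ xJ nvs even[OF G_stem _ K(1,3)]])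
      (unfold nx, intro pdir_beta_one_at G_has_pdir K p i)
  have "((\<lambda>r. x + r *\<^sub>R v s) has_vector_derivative v s) (at 0)"
    by (auto intro!: derivative_eq_intros)
  from bounded_bilinear.has_vector_derivative[OF bounded_bilinear_mult_euclidean this dG]
  have "((\<lambda>r. (x + r *\<^sub>R v s) * G (Suc ` H) (\<alpha>, \<beta>(1 := ?\<rho> r))) has_vector_derivative
      v s * G (Suc ` H) (\<alpha>, \<beta>) + inner J1 (v s) *\<^sub>R (x * pdir v (t 0) \<tau> (t 0 + 1) (G (Suc ` H)) (\<alpha>, \<beta>))) (at 0)"
    by (rule has_vector_derivative_eq_rhs) (simp add: nx add.commute)
  then have deriv: "((\<lambda>r. F (Suc ` H) (\<alpha>, \<beta>(1 := ?\<rho> r)) + (-1) ^ card H *\<^sub>R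
        ((x + r *\<^sub>R v s) * G (Suc ` H) (\<alpha>, \<beta>(1 := ?\<rho> r)))) has_vector_derivative
      inner J1 (v s) *\<^sub>R pdir v (t 0) \<tau> (t 0 + 1) (F (Suc ` H)) (\<alpha>, \<beta>) + (-1) ^ card H *\<^sub>R
      (v s * G (Suc ` H) (\<alpha>, \<beta>) + inner J1 (v s) *\<^sub>R (x * pdir v (t 0) \<tau> (t 0 + 1) (G (Suc ` H)) (\<alpha>, \<beta>)))) (at 0)"
    by (intro has_vector_derivative_add dF bounded_linear.has_vector_derivative[OF bounded_linear_scaleR_right])
  have "(?\<rho> \<longlongrightarrow> norm (x + 0 *\<^sub>R v s)) (nhds 0)"
    by (intro tendsto_intros filterlim_ident)
  then have "filterlim ?\<rho> (nhds (\<beta> 1)) (nhds 0)" using nx by simp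
  with eventually_beta_one_D[OF p] have "\<forall>\<^sub>F r in nhds 0. (\<alpha>, \<beta>(1 := ?\<rho> r)) \<in> D"
    by (rule eventually_compose_filterlim)
  then have ev: "\<forall>\<^sub>F r in nhds 0. F (Suc ` H) (\<alpha>, \<beta>(1 := ?\<rho> r)) + (-1) ^ card H *\<^sub>R
        ((x + r *\<^sub>R v s) * G (Suc ` H) (\<alpha>, \<beta>(1 := ?\<rho> r))) =
      Ft H (cshift v (t 1) (\<tau> - 1) s r (\<alpha> + x, low \<tau> \<beta>))"
  proof (rule eventually_mono)
    fix r assume r: "(\<alpha>, \<beta>(1 := ?\<rho> r)) \<in> D"
    have xr: "x + r *\<^sub>R v s \<in> Rlm v (t 0 + 1) (t 1)"
      using xR vR unfolding Rlm_def by (intro span_add span_scale)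
    have "cshift v (t 1) (\<tau> - 1) s r (\<alpha> + x, low \<tau> \<beta>) = (\<alpha> + (x + r *\<^sub>R v s), low \<tau> \<beta>)"
      using s by (subst cshift_alpha) (auto simp: add.assoc)
    then show "F (Suc ` H) (\<alpha>, \<beta>(1 := ?\<rho> r)) + (-1) ^ card H *\<^sub>R
        ((x + r *\<^sub>R v s) * G (Suc ` H) (\<alpha>, \<beta>(1 := ?\<rho> r))) =
      Ft H (cshift v (t 1) (\<tau> - 1) s r (\<alpha> + x, low \<tau> \<beta>))"
      using Ft_eq_G[OF xr r H] by simp
  qed
  have "((\<lambda>r. F (Suc ` H) (\<alpha>, \<beta>(1 := ?\<rho> r)) + (-1) ^ card H *\<^sub>R
        ((x + r *\<^sub>R v s) * G (Suc ` H) (\<alpha>, \<beta>(1 := ?\<rho> r)))) has_vector_derivative d) (at 0) \<longleftrightarrow>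
      ((\<lambda>r. Ft H (cshift v (t 1) (\<tau> - 1) s r (\<alpha> + x, low \<tau> \<beta>))) has_vector_derivative d) (at 0)" for d
  proof (rule has_vector_derivative_cong_ev)
    show "\<forall>\<^sub>F r in nhds 0. r \<in> UNIV \<longrightarrow> F (Suc ` H) (\<alpha>, \<beta>(1 := ?\<rho> r)) + (-1) ^ card H *\<^sub>R
        ((x + r *\<^sub>R v s) * G (Suc ` H) (\<alpha>, \<beta>(1 := ?\<rho> r))) =
      Ft H (cshift v (t 1) (\<tau> - 1) s r (\<alpha> + x, low \<tau> \<beta>))"
      using ev by (rule eventually_mono) simp
  qed (rule eventually_nhds_x_imp_x[OF ev])
  with deriv show "((\<lambda>r. Ft H (cshift v (t 1) (\<tau> - 1) s r (\<alpha> + \<beta> 1 *\<^sub>R J1, low \<tau> \<beta>))) has_vector_derivative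
      inner J1 (v s) *\<^sub>R pdir v (t 0) \<tau> (t 0 + 1) (F (Suc ` H)) (\<alpha>, \<beta>) + (-1) ^ card H *\<^sub>R
      (v s * G (Suc ` H) (\<alpha>, \<beta>) + inner J1 (v s) *\<^sub>R
        ((\<beta> 1 *\<^sub>R J1) * pdir v (t 0) \<tau> (t 0 + 1) (G (Suc ` H)) (\<alpha>, \<beta>)))) (at 0)"
    unfolding x_def[symmetric] by blast
qed

text \<open>The mirror sum splits into old directions, whose units anticommute with
  \<open>J1\<close>, and new ones, which recombine into \<open>J1\<close>. The result is matched
  with the components of \<open>DT\<close> on \<open>F\<close> at H' and at {1} \<union> H'.\<close>

lemma DT_tstep:
  assumes p: "(\<alpha>, \<beta>) \<in> D" and J: "J1 \<in> Slm v (t 0 + 1) (t 1)" and H: "H \<subseteq> {1..\<tau> - 1}"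
    and \<beta>: "\<beta> 1 \<ge> 0"
  shows "DT e v (tstep t) (\<tau> - 1) Ft H (\<alpha> + \<beta> 1 *\<^sub>R J1, low \<tau> \<beta>) =
    merge_unit J1 (\<lambda>K. DT e v t \<tau> F K (\<alpha>, \<beta>)) H +
    (e * (1 + real (t 0) - real (t 1))) *\<^sub>R G (Suc ` H) (\<alpha>, \<beta>)"
proof -
  note K = Suc_image_sub[OF H]
  let ?H = "Suc ` H" and ?H1 = "insert 1 (Suc ` H)"
  let ?d = "\<lambda>i K. pdir v (t 0) \<tau> i (F K) (\<alpha>, \<beta>)"
  let ?p = "(\<alpha> + \<beta> 1 *\<^sub>R J1, low \<tau> \<beta>)"
  define g :: real where "g = (-1) ^ card H"
  define SP where "SP = (\<Sum>s\<in>{1..t 0}. v s * ?d s ?H)"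
  define SQ where "SQ = (\<Sum>s\<in>{1..t 0}. v s * ?d s ?H1)"
  define R where "R = (\<Sum>h\<in>{1..\<tau> - 1}. (-1) ^ sigma h H *\<^sub>R ?d (t 0 + Suc h) (Suc ` symd H h))"
  define R1 where "R1 = (\<Sum>h\<in>{1..\<tau> - 1}. (-1) ^ sigma h H *\<^sub>R ?d (t 0 + Suc h) (insert 1 (Suc ` symd H h)))"
  define g0 where "g0 = G ?H (\<alpha>, \<beta>)"
  define g1 where "g1 = pdir v (t 0) \<tau> (t 0 + 1) (G ?H) (\<alpha>, \<beta>)"
  have gg: "g * g = 1" by (simp add: g_def flip: power_add)
  have J': "J1 \<in> Rlm v (t 0 + 1) (t 1)" using J by (simp add: Slm_def)
  have t1: "t 0 < t 1" "t 1 \<le> N" using t_less[of 0 1] t_le_N[of 1] \<tau> by auto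
  have JJ: "J1 * J1 = - 1" using Slm_square[OF J] t1 by simp
  have d1: "?d (t 0 + 1) ?H1 = g0 + \<beta> 1 *\<^sub>R g1"
    using pdir_F_insert_one[OF K(1,3) p] by (simp add: g0_def g1_def)
  have cH: "card ?H = card H" "card ?H1 = Suc (card H)"
    using K(3,4) by (simp_all add: card_image)
  \<comment> \<open>\<open>bJ_split\<close> with all coefficients equal to 1 separates the summand h
    = 1.\<close>
  have sumT: "(\<Sum>h\<in>{1..\<tau>}. q h) = q 1 + (\<Sum>h\<in>{1..\<tau> - 1}. q (Suc h))" for q :: "nat \<Rightarrow> 'a"
    using bJ_split[OF \<tau>, of "\<lambda>_. 1" q] by (simp add: bJ_def low_def)
  have sig1: "sigma 1 ?H = 0" "sigma 1 ?H1 = 1"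
  proof -
    have "{k \<in> ?H. k \<le> 1} = {}" "{k \<in> ?H1. k \<le> 1} = {1}" using K(5) by auto
    then show "sigma 1 ?H = 0" "sigma 1 ?H1 = 1" by (simp_all add: sigma_def)
  qed
  have sym1: "symd ?H 1 = ?H1" "symd ?H1 1 = ?H" using K(3) by (auto simp: symd_def)
  have DH: "DT e v t \<tau> F ?H (\<alpha>, \<beta>) = ?d 0 ?H + (e * g) *\<^sub>R SP - e *\<^sub>R (?d (t 0 + 1) ?H1 + R)"
    unfolding DT_def cH sumT sig1 sym1 SP_def g_def R_def
    by (simp only: sigma_Suc_image symd_Suc_image power_0 scaleR_one)
  \<comment> \<open>The extra index 1 raises every \<open>sigma (Suc h)\<close> by one, so all signs
    change.\<close>
  have R1': "(\<Sum>h\<in>{1..\<tau> - 1}. (-1) ^ sigma (Suc h) ?H1 *\<^sub>R ?d (t 0 + Suc h) (symd ?H1 (Suc h))) = - R1"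
    unfolding R1_def sum_negf[symmetric]
    by (rule sum.cong[OF refl]) (simp add: sigma_insert_one_Suc_image[OF K(4,5), unfolded One_nat_def]
        symd_insert_one_Suc_image[unfolded One_nat_def])
  have DH1: "DT e v t \<tau> F ?H1 (\<alpha>, \<beta>) = ?d 0 ?H1 - (e * g) *\<^sub>R SQ - e *\<^sub>R (- ?d (t 0 + 1) ?H - R1)"
    unfolding DT_def cH sumT sig1 sym1 SQ_def g_def R1'
    by simp
  \<comment> \<open>The minus sign comes from moving each old unit past \<open>J1\<close>.\<close>
  have A: "(\<Sum>s\<in>{1..t 0}. v s * pdir v (t 1) (\<tau> - 1) s (Ft H) ?p) = SP - g *\<^sub>R (J1 * SQ)"
  proof -
    have "v s * pdir v (t 1) (\<tau> - 1) s (Ft H) ?p = v s * ?d s ?H - g *\<^sub>R (J1 * (v s * ?d s ?H1))"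
      if s: "s \<in> {1..t 0}" for s
    proof -
      have "v s * J1 = - (J1 * v s)"
        using s t1 v_in_Slm[of s 1 "t 0"] by (intro Rlm_anticommute[of _ 1 "t 0", OF _ J']) (auto simp: Slm_def)
      then have "v s * (J1 * z) = - (J1 * (v s * z))" for z
        by (metis mult.assoc mult_minus_left)
      moreover have "pdir v (t 1) (\<tau> - 1) s (Ft H) ?p = merge_unit J1 (?d s) H"
        by (rule pdir_Ft_alpha[OF p J H]) (use s in simp)
      ultimately show ?thesis
        by (simp only: merge_unit_def distrib_left g_def mult_scaleR_right scaleR_minus_right
            add_uminus_conv_diff)
    qed
    then show ?thesis
      by (simp add: SP_def SQ_def sum_subtractf sum_distrib_left scaleR_sum_right)
  qed
  \<comment> \<open>Each of the t_1 - t_0 new directions contributes -G_H' through v_s v_s = -1. In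
    the other terms the coefficients inner (v s) J1 reassemble \<open>J1\<close>, and J1 J1 = -1
    then gives -\<beta>_1 times the derivative of G_H'.\<close>
  have B: "(\<Sum>s\<in>{t 0 + 1..t 1}. v s * pdir v (t 1) (\<tau> - 1) s (Ft H) ?p) =
      J1 * ?d (t 0 + 1) ?H + g *\<^sub>R (- (real (t 1) - real (t 0)) *\<^sub>R g0 - \<beta> 1 *\<^sub>R g1)"
  proof -
    let ?P = "?d (t 0 + 1) ?H"
    have "v s * pdir v (t 1) (\<tau> - 1) s (Ft H) ?p =
        (inner (v s) J1 *\<^sub>R v s) * (?P + g *\<^sub>R (\<beta> 1 *\<^sub>R J1 * g1)) + g *\<^sub>R (- g0)" if s: "s \<in> {t 0 + 1..t 1}" for s
    proof -
      have "v s * (v s * z) = - z" for z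
        using square[of s] s t1 by (simp flip: mult.assoc)
      then show ?thesis
        unfolding pdir_Ft_new[OF p J H \<beta> s] g_def[symmetric] g0_def[symmetric] g1_def[symmetric]
        by (simp add: algebra_simps inner_commute)
    qed
    then have "(\<Sum>s\<in>{t 0 + 1..t 1}. v s * pdir v (t 1) (\<tau> - 1) s (Ft H) ?p) =
        (\<Sum>s\<in>{t 0 + 1..t 1}. inner (v s) J1 *\<^sub>R v s) * (?P + g *\<^sub>R (\<beta> 1 *\<^sub>R J1 * g1)) +
        (\<Sum>s\<in>{t 0 + 1..t 1}. g *\<^sub>R (- g0))"
      unfolding sum_distrib_right sum.distrib[symmetric] by (intro sum.cong refl)
    also have "(\<Sum>s\<in>{t 0 + 1..t 1}. inner (v s) J1 *\<^sub>R v s) = J1"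
      by (rule Rlm_expansion[OF J' t1(2)])
    also have "(\<Sum>s\<in>{t 0 + 1..t 1}. g *\<^sub>R (- g0)) = (real (t 1) - real (t 0)) *\<^sub>R g *\<^sub>R (- g0)"
      unfolding sum_constant_scaleR using t1 by (simp add: of_nat_diff)
    also have "J1 * (?P + g *\<^sub>R (\<beta> 1 *\<^sub>R J1 * g1)) = J1 * ?P - (g * \<beta> 1) *\<^sub>R g1"
    proof -
      have "J1 * (J1 * g1) = - g1" using JJ by (simp flip: mult.assoc)
      then show ?thesis by (simp add: distrib_left)
    qed
    finally show ?thesis by (simp add: algebra_simps)
  qed
  have C: "(\<Sum>h\<in>{1..\<tau> - 1}. (-1) ^ sigma h H *\<^sub>R pdir v (t 1) (\<tau> - 1) (t 1 + h) (Ft (symd H h)) ?p) =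
      R - g *\<^sub>R (J1 * R1)"
  proof -
    have "(-1) ^ sigma h H *\<^sub>R pdir v (t 1) (\<tau> - 1) (t 1 + h) (Ft (symd H h)) ?p =
        (-1) ^ sigma h H *\<^sub>R ?d (t 0 + Suc h) (Suc ` symd H h) -
        g *\<^sub>R (J1 * ((-1) ^ sigma h H *\<^sub>R ?d (t 0 + Suc h) (insert 1 (Suc ` symd H h))))"
      if h: "h \<in> {1..\<tau> - 1}" for h
    proof -
      have sub: "symd H h \<subseteq> {1..\<tau> - 1}" using H h by (auto simp: symd_def)
      \<comment> \<open>Adding or removing one index changes the parity of the cardinality; hence
        the minus sign in front of \<open>R1\<close>.\<close>
      have "(-1::real) ^ card (symd H h) = - g"
      proof (cases "h \<in> H")
        case True
        then have "card H = Suc (card (symd H h))"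
          using card.remove[OF K(4) True] by (simp add: symd_def)
        then show ?thesis by (simp add: g_def)
      next
        case False
        then show ?thesis using K(4) by (simp add: symd_def g_def)
      qed
      then show ?thesis
        unfolding pdir_Ft_beta[OF p J sub h] merge_unit_def by (simp add: algebra_simps)
    qed
    then show ?thesis
      by (simp add: R_def R1_def sum_subtractf sum_distrib_left scaleR_sum_right)
  qed
  have D0: "pdir v (t 1) (\<tau> - 1) 0 (Ft H) ?p = ?d 0 ?H + g *\<^sub>R (J1 * ?d 0 ?H1)"
    by (simp only: pdir_Ft_alpha[OF p J H le0] merge_unit_def g_def)
  have split: "(\<Sum>s\<in>{1..t 1}. q s) = (\<Sum>s\<in>{1..t 0}. q s) + (\<Sum>s\<in>{t 0 + 1..t 1}. q s)" for q :: "nat \<Rightarrow> 'a"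
  proof -
    have "{1..t 1} = {1..t 0} \<union> {t 0 + 1..t 1}" using t1 by auto
    then show ?thesis by (simp add: sum.union_disjoint)
  qed
  have ts: "tstep t 0 = t 1" by (simp add: tstep_def)
  have E1: "DT e v (tstep t) (\<tau> - 1) Ft H ?p = ?d 0 ?H + g *\<^sub>R (J1 * ?d 0 ?H1)
      + (e * g) *\<^sub>R (SP - g *\<^sub>R (J1 * SQ) + (J1 * ?d (t 0 + 1) ?H + g *\<^sub>R (- (real (t 1) - real (t 0)) *\<^sub>R g0 - \<beta> 1 *\<^sub>R g1)))
      - e *\<^sub>R (R - g *\<^sub>R (J1 * R1))"
    unfolding DT_def ts split A B C D0 g_def[symmetric] ..
  have E2: "merge_unit J1 (\<lambda>K. DT e v t \<tau> F K (\<alpha>, \<beta>)) H =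
      (?d 0 ?H + (e * g) *\<^sub>R SP - e *\<^sub>R (g0 + \<beta> 1 *\<^sub>R g1 + R)) +
      g *\<^sub>R (J1 * (?d 0 ?H1 - (e * g) *\<^sub>R SQ - e *\<^sub>R (- ?d (t 0 + 1) ?H - R1)))"
    unfolding merge_unit_def DH DH1 d1 g_def[symmetric] ..
  \<comment> \<open>Fixing the sign leaves a linear identity: the \<beta>_1-derivatives of G_H'
    cancel, and the multiples of G_H' left over are e from the product rule and -e (t_1 - t_0) from
    \<open>B\<close>.\<close>
  have "g = 1 \<or> g = - 1" using gg by (simp add: square_eq_1_iff)
  then show ?thesis
    unfolding E1 E2 g0_def[symmetric] by (elim disjE) (simp_all add: algebra_simps)
qed

text \<open>The representation selected by choice on the left is turned into one for the longer
  list, with \<beta>_1 = norm w and J_1 the direction of w. The right-hand side may be evaluated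
  there by \<open>ind_eq\<close>, since \<open>DT\<close> of \<open>F\<close> and \<open>G\<close>
  are stem functions.\<close>

lemma ind_DT_tstep:
  assumes "x \<in> Omega v t \<tau> D"
  shows "ind v (tstep t) (\<tau> - 1) (Dtil v t \<tau> D) (DT e v (tstep t) (\<tau> - 1) Ft) x =
    ind v t \<tau> D (DT e v t \<tau> F) x + (e * (1 + real (t 0) - real (t 1))) *\<^sub>R ind v t \<tau> D G x"
proof -
  have \<tau>': "\<tau> = Suc (\<tau> - 1)" using \<tau> by simp
  let ?P = "\<lambda>y. \<exists>\<alpha> \<beta> J. (\<alpha>, \<beta>) \<in> Dtil v t \<tau> D \<and> J \<in> torus v (tstep t) (\<tau> - 1) \<and>
      x = \<alpha> + bJ (\<tau> - 1) \<beta> J \<and> y = (\<Sum>K\<in>Pow {1..\<tau> - 1}. JK J K * DT e v (tstep t) (\<tau> - 1) Ft K (\<alpha>, \<beta>))"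
  from assms obtain \<alpha> \<beta> J where 0: "x = \<alpha> + bJ \<tau> \<beta> J" "(\<alpha>, \<beta>) \<in> D" "J \<in> torus v t \<tau>"
    by (auto simp: Omega_def)
  \<comment> \<open>The choice is meaningful because any representation for \<open>T\<close> gives
    one for the shortened list: \<beta>_1 J_1 moves into the mirror part.\<close>
  have "\<exists>y. ?P y"
  proof (intro exI conjI)
    have "J 1 \<in> Slm v (t (1 - 1) + 1) (t 1)" using 0(3) \<tau> unfolding torus_def by (metis (no_types, lifting) atLeastAtMost_iff mem_Collect_eq order_refl)
    then show "(\<alpha> + \<beta> 1 *\<^sub>R J 1, low \<tau> \<beta>) \<in> Dtil v t \<tau> D" by (intro Dtil_point 0(2)) simp
    show "(\<lambda>h. J (Suc h)) \<in> torus v (tstep t) (\<tau> - 1)"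
      unfolding torus_def mem_Collect_eq
    proof
      fix h assume h: "h \<in> {1..\<tau> - 1}"
      then have "Suc h \<in> {1..\<tau>}" by auto
      then have "J (Suc h) \<in> Slm v (t (Suc h - 1) + 1) (t (Suc h))" using 0(3) unfolding torus_def by blast
      then show "J (Suc h) \<in> Slm v (tstep t (h - 1) + 1) (tstep t h)" using h by (simp add: tstep_def)
    qed
    show "x = \<alpha> + \<beta> 1 *\<^sub>R J 1 + bJ (\<tau> - 1) (low \<tau> \<beta>) (\<lambda>h. J (Suc h))"
      unfolding 0(1) bJ_split[OF \<tau>] by (simp add: add.assoc)
  qed (rule refl)
  from someI_ex[OF this] have "?P (ind v (tstep t) (\<tau> - 1) (Dtil v t \<tau> D) (DT e v (tstep t) (\<tau> - 1) Ft) x)"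
    unfolding ind_def .
  then obtain a b J' where ab: "(a, b) \<in> Dtil v t \<tau> D" and J': "J' \<in> torus v (tstep t) (\<tau> - 1)"
    and x: "x = a + bJ (\<tau> - 1) b J'"
    and val: "ind v (tstep t) (\<tau> - 1) (Dtil v t \<tau> D) (DT e v (tstep t) (\<tau> - 1) Ft) x =
      (\<Sum>H\<in>Pow {1..\<tau> - 1}. JK J' H * DT e v (tstep t) (\<tau> - 1) Ft H (a, b))"
    by blast
  from ab obtain \<alpha> w \<beta>0 where w: "a = \<alpha> + w" "b = low \<tau> \<beta>0" "w \<in> Rlm v (t 0 + 1) (t 1)"
      "(\<alpha>, \<beta>0(1 := norm w)) \<in> D"
    by (auto simp: Dtil_def low_def)
  define \<beta> where "\<beta> = \<beta>0(1 := norm w)"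
  have p: "(\<alpha>, \<beta>) \<in> D" and \<beta>1: "\<beta> 1 = norm w" and b: "b = low \<tau> \<beta>" using w by (simp_all add: \<beta>_def)
  define J1 where "J1 = (if w = 0 then v (t 1) else (1 / norm w) *\<^sub>R w)"
  have J1: "J1 \<in> Slm v (t 0 + 1) (t 1)"
    using w(3) v_in_Slm[of "t 1" "t 0 + 1" "t 1"] t_less[of 0 1] t_le_N[of 1] \<tau>
    by (auto simp: J1_def Slm_def Rlm_def intro: span_scale)
  have wJ: "w = \<beta> 1 *\<^sub>R J1" by (simp only: J1_def \<beta>1) simp
  define J where "J h = (if h = 1 then J1 else J' (h - 1))" for h
  have JS: "J (Suc h) = J' h" if "h \<in> {1..\<tau> - 1}" for h using that by (simp add: J_def)
  have J't: "J' h \<in> Slm v (t h + 1) (t (Suc h))" if "h \<in> {1..\<tau> - 1}" for h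
  proof -
    have "J' h \<in> Slm v (tstep t (h - 1) + 1) (tstep t h)" using J' that unfolding torus_def by blast
    then show ?thesis using that by (simp add: tstep_def)
  qed
  have J: "J \<in> torus v t \<tau>"
    unfolding torus_def mem_Collect_eq
  proof
    fix h assume h: "h \<in> {1..\<tau>}"
    show "J h \<in> Slm v (t (h - 1) + 1) (t h)"
    proof (cases "h = 1")
      case True
      then show ?thesis using J1 by (simp add: J_def)
    next
      case False
      then obtain k where "h = Suc k" "k \<in> {1..\<tau> - 1}" using h by (cases h) auto
      then show ?thesis using J't[of k] JS[of k] by simp
    qed
  qed
  have "bJ (\<tau> - 1) b J' = bJ (\<tau> - 1) (low \<tau> \<beta>) (\<lambda>h. J (Suc h))"
    unfolding bJ_def b by (intro sum.cong) (auto simp: JS)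
  then have x': "x = \<alpha> + bJ \<tau> \<beta> J"
    unfolding x w(1) wJ bJ_split[OF \<tau>] by (simp add: J_def add.assoc)
  have ind: "ind v t \<tau> D Q x = (\<Sum>H\<in>Pow {1..\<tau> - 1}. JK J' H * merge_unit J1 (\<lambda>K. Q K (\<alpha>, \<beta>)) H)"
    if Q: "is_stem \<tau> D Q" for Q
  proof -
    have "ind v t \<tau> D Q x = (\<Sum>K\<in>Pow {1..\<tau>}. JK J K * Q K (\<alpha>, \<beta>))"
      unfolding x' by (rule ind_eq[OF D_refl Q p J])
    also have "\<dots> = (\<Sum>H\<in>Pow {1..\<tau> - 1}. JK (\<lambda>h. J (Suc h)) H * merge_unit (J 1) (\<lambda>K. Q K (\<alpha>, \<beta>)) H)"
    proof (subst \<tau>', rule sum_JK_split)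
      fix h assume h: "h \<in> {1..\<tau> - 1}"
      show "J 1 * J (Suc h) = - (J (Suc h) * J 1)"
        using torus_anticommute[of J1 "J' h" h] J't[OF h] J1 h JS[OF h] by (simp add: J_def Slm_def)
    qed
    also have "\<dots> = (\<Sum>H\<in>Pow {1..\<tau> - 1}. JK J' H * merge_unit J1 (\<lambda>K. Q K (\<alpha>, \<beta>)) H)"
    proof (rule sum.cong[OF refl])
      fix H assume "H \<in> Pow {1..\<tau> - 1}"
      then have "JK (\<lambda>h. J (Suc h)) H = JK J' H"
        by (intro JK_cong) (auto simp: JS intro: finite_subset)
      then show "JK (\<lambda>h. J (Suc h)) H * merge_unit (J 1) (\<lambda>K. Q K (\<alpha>, \<beta>)) H =
          JK J' H * merge_unit J1 (\<lambda>K. Q K (\<alpha>, \<beta>)) H" by (simp add: J_def)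
    qed
    finally show ?thesis .
  qed
  let ?k = "e * (1 + real (t 0) - real (t 1))"
  have "JK J' H * DT e v (tstep t) (\<tau> - 1) Ft H (a, b) =
      JK J' H * merge_unit J1 (\<lambda>K. DT e v t \<tau> F K (\<alpha>, \<beta>)) H +
      ?k *\<^sub>R (JK J' H * merge_unit J1 (\<lambda>K. G K (\<alpha>, \<beta>)) H)" if "H \<in> Pow {1..\<tau> - 1}" for H
  proof -
    have H: "H \<subseteq> {1..\<tau> - 1}" using that by simp
    have "merge_unit J1 (\<lambda>K. G K (\<alpha>, \<beta>)) H = G (Suc ` H) (\<alpha>, \<beta>)"
      by (simp add: merge_unit_def)
    moreover have "DT e v (tstep t) (\<tau> - 1) Ft H (a, b) =
        merge_unit J1 (\<lambda>K. DT e v t \<tau> F K (\<alpha>, \<beta>)) H + ?k *\<^sub>R G (Suc ` H) (\<alpha>, \<beta>)"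
      unfolding w(1) wJ b by (rule DT_tstep[OF p J1 H]) (simp only: \<beta>1 norm_ge_zero)
    ultimately show ?thesis by (simp add: distrib_left)
  qed
  then show ?thesis
    unfolding val ind[OF DT_stem] ind[OF G_stem] by (simp add: sum.distrib scaleR_sum_right)
qed

end

theorem theorem5p3:
  fixes c :: "'a::{euclidean_space,real_algebra_1} \<Rightarrow> 'a"
    and v :: "nat \<Rightarrow> 'a" and N \<tau> :: nat and t :: "nat \<Rightarrow> nat"
    and D :: "('a \<times> (nat \<Rightarrow> real)) set" and p :: regularity
    and F :: "nat set \<Rightarrow> 'a \<times> (nat \<Rightarrow> real) \<Rightarrow> 'a" and f :: "'a \<Rightarrow> 'a"
  assumes "setting c v N"
    and "steps N t \<tau>"
    and "\<tau> \<ge> 1"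
    and "is_domain v t \<tau> D"
    and "stem_p v t \<tau> D p F"
    and "\<forall>x\<in>Omega v t \<tau> D. f x = ind v t \<tau> D F x"
  shows "\<exists>G g. stem_p v t \<tau> D p G \<and>
           (\<forall>x\<in>Omega v t \<tau> D. g x = ind v t \<tau> D G x) \<and>
           (\<forall>K \<alpha> \<beta>. K \<subseteq> {1..\<tau>} \<and> (\<alpha>, \<beta>) \<in> D \<and> \<beta> 1 \<noteq> 0 \<longrightarrow>
              G K (\<alpha>, \<beta>) = (if 1 \<notin> K then inverse (\<beta> 1) *\<^sub>R F (insert 1 K) (\<alpha>, \<beta>) else 0)) \<and>
           (\<forall>Ft. stem_p v (tstep t) (\<tau> - 1) (Dtil v t \<tau> D) p Ft \<and>
                 (\<forall>x\<in>Omega v (tstep t) (\<tau> - 1) (Dtil v t \<tau> D). f x = ind v (tstep t) (\<tau> - 1) (Dtil v t \<tau> D) Ft x)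
              \<longrightarrow> (\<forall>x\<in>Omega v t \<tau> D.
                    ind v (tstep t) (\<tau> - 1) (Dtil v t \<tau> D) (dbarT v (tstep t) (\<tau> - 1) Ft) x
                      = ind v t \<tau> D (dbarT v t \<tau> F) x + (1 + real (t 0) - real (t 1)) *\<^sub>R g x \<and>
                    ind v (tstep t) (\<tau> - 1) (Dtil v t \<tau> D) (dT v (tstep t) (\<tau> - 1) Ft) x
                      = ind v t \<tau> D (dT v t \<tau> F) x + (real (t 1) - real (t 0) - 1) *\<^sub>R g x))"
proof -
  have set: "\<forall>i\<in>{0..N}. \<forall>j\<in>{0..N}. inner (v i) (v j) = (if i = j then 1 else 0)"
    "\<forall>s\<in>{1..N}. v s \<in> SA c"
    "\<forall>s\<in>{1..N}. \<forall>r\<in>{1..N}. s \<noteq> r \<longrightarrow> v s * v r = - (v r * v s)"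
    using assms(1) unfolding setting_def by blast+
  interpret stem_frame v N t \<tau> D p F
  proof
    show "inner (v i) (v j) = (if i = j then 1 else 0)" if "i \<le> N" "j \<le> N" for i j
      using set(1) that by simp
    show "v s * v s = - 1" if "1 \<le> s" "s \<le> N" for s
    proof -
      have "v s \<in> SA c" using set(2) that by simp
      then have "c (v s) = - v s" "v s * c (v s) = 1"
        by (auto simp: SA_def eq_neg_iff_add_eq_0 add.commute)
      then have "- (v s * v s) = 1" by simp
      then show ?thesis by (metis minus_minus)
    qed
    show "v s * v r = - (v r * v s)" if "1 \<le> s" "s \<le> N" "1 \<le> r" "r \<le> N" "s \<noteq> r" for s r
      by (intro set(3)[rule_format]) (use that in auto)
  qed (fact assms)+
  show ?thesis
  proof (intro exI[of _ G] exI[of _ "ind v t \<tau> D G"] conjI ballI refl)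
    show "stem_p v t \<tau> D p G" by (rule G_stem_p)
    show "\<forall>K \<alpha> \<beta>. K \<subseteq> {1..\<tau>} \<and> (\<alpha>, \<beta>) \<in> D \<and> \<beta> 1 \<noteq> 0 \<longrightarrow>
        G K (\<alpha>, \<beta>) = (if 1 \<notin> K then inverse (\<beta> 1) *\<^sub>R F (insert 1 K) (\<alpha>, \<beta>) else 0)"
      by (simp add: G_def bquot_def)
    show "\<forall>Ft. stem_p v (tstep t) (\<tau> - 1) (Dtil v t \<tau> D) p Ft \<and>
        (\<forall>x\<in>Omega v (tstep t) (\<tau> - 1) (Dtil v t \<tau> D). f x = ind v (tstep t) (\<tau> - 1) (Dtil v t \<tau> D) Ft x)
        \<longrightarrow> (\<forall>x\<in>Omega v t \<tau> D.
          ind v (tstep t) (\<tau> - 1) (Dtil v t \<tau> D) (dbarT v (tstep t) (\<tau> - 1) Ft) x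
            = ind v t \<tau> D (dbarT v t \<tau> F) x + (1 + real (t 0) - real (t 1)) *\<^sub>R ind v t \<tau> D G x \<and>
          ind v (tstep t) (\<tau> - 1) (Dtil v t \<tau> D) (dT v (tstep t) (\<tau> - 1) Ft) x
            = ind v t \<tau> D (dT v t \<tau> F) x + (real (t 1) - real (t 0) - 1) *\<^sub>R ind v t \<tau> D G x)"
    proof (intro allI impI, elim conjE)
      fix Ft
      assume Ft: "stem_p v (tstep t) (\<tau> - 1) (Dtil v t \<tau> D) p Ft"
        and ft: "\<forall>x\<in>Omega v (tstep t) (\<tau> - 1) (Dtil v t \<tau> D).
          f x = ind v (tstep t) (\<tau> - 1) (Dtil v t \<tau> D) Ft x"
      \<comment> \<open>Done separately for each \<open>Ft\<close> representing \<open>f\<close>,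
        while \<open>G\<close> was fixed beforehand: the correction term does not depend on
        \<open>Ft\<close>.\<close>
      interpret tstep_stem v N t \<tau> D p F Ft
      proof
        have "is_stem (\<tau> - 1) (Dtil v t \<tau> D) Ft" using Ft by (simp add: stem_p_def)
        note stem_tstep_eq[OF assms(6) this ft]
        then show "Ft H (\<alpha> + \<beta> 1 *\<^sub>R J1, low \<tau> \<beta>) = merge_unit J1 (\<lambda>K. F K (\<alpha>, \<beta>)) H"
          if "(\<alpha>, \<beta>) \<in> D" "J1 \<in> Slm v (t 0 + 1) (t 1)" "H \<subseteq> {1..\<tau> - 1}" for \<alpha> \<beta> J1 H
          using that by blast
      qed
      show "\<forall>x\<in>Omega v t \<tau> D.
          ind v (tstep t) (\<tau> - 1) (Dtil v t \<tau> D) (dbarT v (tstep t) (\<tau> - 1) Ft) x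
            = ind v t \<tau> D (dbarT v t \<tau> F) x + (1 + real (t 0) - real (t 1)) *\<^sub>R ind v t \<tau> D G x \<and>
          ind v (tstep t) (\<tau> - 1) (Dtil v t \<tau> D) (dT v (tstep t) (\<tau> - 1) Ft) x
            = ind v t \<tau> D (dT v t \<tau> F) x + (real (t 1) - real (t 0) - 1) *\<^sub>R ind v t \<tau> D G x"
      proof (intro ballI conjI)
        fix x assume x: "x \<in> Omega v t \<tau> D"
        show "ind v (tstep t) (\<tau> - 1) (Dtil v t \<tau> D) (dbarT v (tstep t) (\<tau> - 1) Ft) x
            = ind v t \<tau> D (dbarT v t \<tau> F) x + (1 + real (t 0) - real (t 1)) *\<^sub>R ind v t \<tau> D G x"
          unfolding dbarT_eq_DT ind_DT_tstep[OF x] by simp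
        show "ind v (tstep t) (\<tau> - 1) (Dtil v t \<tau> D) (dT v (tstep t) (\<tau> - 1) Ft) x
            = ind v t \<tau> D (dT v t \<tau> F) x + (real (t 1) - real (t 0) - 1) *\<^sub>R ind v t \<tau> D G x"
          unfolding dT_eq_DT ind_DT_tstep[OF x] by (simp add: algebra_simps)
      qed
    qed
  qed
qed

end
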